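(* Let $n\ge2$ and, for $t>1$, let $M_t$ be the hyperbolic catenoid in $\mathbb{H}^{n+1}$ with parameter $t$ (defined in the context). Then $M_t$ is a complete stable hypersurface in $\mathbb{H}^{n+1}$ for every $t$ with $$1<t<1+\frac{(n+1)^2}{4n(n-1)} .$$
   Context: Let $\mathbb{L}^{n+2}$ be $\mathbb{R}^{n+2}$ with the Lorentzian metric $\langle x,y\rangle=-x_1y_1+x_2y_2+\cdots+x_{n+2}y_{n+2}$ and $\mathbb{H}^{n+1}=\{x\in\mathbb{L}^{n+2}:\langle x,x\rangle=-1,\ x_1\ge1\}$, the hyperbolic space of constant sectional curvature $-1$. Hyperbolic catenoid $M_t$ ($t>1$): put $a=t^{n-1}\sqrt{t^2-1}>0$ and let $x:\mathbb{R}\to[t,\infty)$ be the non-constant even function with $x(0)=t$, $x'(0)=0$ and $x'(s)=\sqrt{x^2-1-a^2x^{2(1-n)}}$ for $s\ge0$ (equivalently, the solution of $x''=x+(n-1)a^2x^{1-2n}$ with $x(0)=t$, $x'(0)=0$). Set $$\phi(s)=\int_0^s\frac{\sqrt{x(\tau)^2-x'(\tau)^2-1}}{x(\tau)^2-1}\,d\tau,\quad y(s)=\sqrt{x(s)^2-1}\,\sin\phi(s),\quad z(s)=\sqrt{x(s)^2-1}\,\cos\phi(s),$$ so that $-x^2+y^2+z^2=-1$ and $-x'^2+y'^2+z'^2=1$. Let $(\varphi_1,\dots,\varphi_n)=(\varphi_1,\dots,\varphi_n)(t_1,\dots,t_{n-1})$ be an orthogonal parametrization of $\mathbb{H}^{n-1}=\{-\varphi_1^2+\varphi_2^2+\cdots+\varphi_n^2=-1,\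 \varphi_1\ge1\}$. Then $M_t$ is the (immersed) minimal hypersurface of $\mathbb{H}^{n+1}$ parametrized by $$f(t_1,\dots,t_{n-1},s)=(x(s)\varphi_1,\dots,x(s)\varphi_n,\,y(s),\,z(s)),\qquad s\in\mathbb{R}.$$ A minimal hypersurface $M$ in $\mathbb{H}^{n+1}$ with second fundamental form $A$ is called stable if for every compactly supported Lipschitz function $f$ on $M$ $$\int_M |\nabla f|^2-(|A|^2-n)f^2\,dv\ge 0,$$ where $dv$ is the volume form of the induced metric. *)

theory Defs
  imports "HOL-Analysis.Analysis"
begin

section \<open>Lorentz space and hyperbolic space\<close>

text \<open>Lorentz space is \<^typ>\<open>real \<times> 'v\<close>, the first component being the time coordinate;
  for \<open>'v\<close> of dimension \<open>d\<close> this is the (\<open>d + 1\<close>)-dimensional Lorentz space.\<close>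

definition lorentz :: "real \<times> 'v::euclidean_space \<Rightarrow> real \<times> 'v \<Rightarrow> real" where
  "lorentz u v = - fst u * fst v + snd u \<bullet> snd v"

definition hyperbolic_space :: "(real \<times> 'v::euclidean_space) set" where
  "hyperbolic_space = {u. lorentz u u = -1 \<and> fst u \<ge> 1}"


section \<open>Calculus in a global chart\<close>

definition partial :: "'m \<Rightarrow> (real^'m \<Rightarrow> 'b) \<Rightarrow> real^'m \<Rightarrow> 'b::real_normed_vector" where
  "partial i f p = vector_derivative (\<lambda>h. f (p + h *\<^sub>R axis i 1)) (at 0)"

fun Ck_on :: "nat \<Rightarrow> (real^'m) set \<Rightarrow> (real^'m \<Rightarrow> 'b::real_normed_vector) \<Rightarrow> bool" where
  "Ck_on 0 D f \<longleftrightarrow> continuous_on D f"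
| "Ck_on (Suc k) D f \<longleftrightarrow> (\<forall>p\<in>D. f differentiable (at p)) \<and> (\<forall>i. Ck_on k D (partial i f))"

definition smooth_on :: "(real^'m) set \<Rightarrow> (real^'m \<Rightarrow> 'b::real_normed_vector) \<Rightarrow> bool" where
  "smooth_on D f \<longleftrightarrow> (\<forall>k. Ck_on k D f)"


section \<open>Immersed hypersurfaces of hyperbolic space\<close>

text \<open>A hypersurface is given by a chart domain \<open>D\<close>, which carries the whole (abstract)
  manifold, and an immersion \<open>F\<close> of \<open>D\<close> into hyperbolic space. The dimension of the
  hypersurface is \<open>CARD('m)\<close>.\<close>

definition immersed_hypersurface ::
    "(real^'m) set \<Rightarrow> (real^'m \<Rightarrow> real \<times> 'v::euclidean_space) \<Rightarrow> bool" where
  "immersed_hypersurface D F \<longleftrightarrow>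
     DIM('v) = CARD('m) + 1 \<and> open D \<and> connected D \<and> D \<noteq> {} \<and> smooth_on D F \<and>
     (\<forall>p\<in>D. F p \<in> hyperbolic_space \<and> inj (frechet_derivative F (at p)))"

definition first_form :: "(real^'m \<Rightarrow> real \<times> 'v::euclidean_space) \<Rightarrow> real^'m \<Rightarrow> real^'m^'m" where
  "first_form F p = (\<chi> i j. lorentz (partial i F p) (partial j F p))"

text \<open>At every point of an immersed hypersurface the unit normal is unique up to sign;
  the quantities below do not depend on the sign chosen at each point.\<close>

definition unit_normal ::
    "(real^'m \<Rightarrow> real \<times> 'v::euclidean_space) \<Rightarrow> real^'m \<Rightarrow> real \<times> 'v" where
  "unit_normal F p = (SOME \<nu>. lorentz \<nu> \<nu> = 1 \<and> lorentz \<nu> (F p) = 0 \<and>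
                            (\<forall>i. lorentz \<nu> (partial i F p) = 0))"

text \<open>The Levi-Civita connection of hyperbolic space is the flat derivative of Lorentz space
  minus its component along the position vector \<open>F p\<close>; the latter is orthogonal to the
  unit normal, so it does not contribute to the second fundamental form.\<close>

definition second_form :: "(real^'m \<Rightarrow> real \<times> 'v::euclidean_space) \<Rightarrow> real^'m \<Rightarrow> real^'m^'m" where
  "second_form F p = (\<chi> i j. lorentz (partial i (partial j F) p) (unit_normal F p))"

definition shape_operator ::
    "(real^'m \<Rightarrow> real \<times> 'v::euclidean_space) \<Rightarrow> real^'m \<Rightarrow> real^'m^'m" where
  "shape_operator F p = matrix_inv (first_form F p) ** second_form F p"

text \<open>This is \<open>g\<^sup>i\<^sup>j g\<^sup>k\<^sup>l h\<^sub>i\<^sub>k h\<^sub>j\<^sub>l\<close>.\<close>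

definition norm_A_sq :: "(real^'m \<Rightarrow> real \<times> 'v::euclidean_space) \<Rightarrow> real^'m \<Rightarrow> real" where
  "norm_A_sq F p = trace (shape_operator F p ** shape_operator F p)"

definition minimal_hypersurface ::
    "(real^'m) set \<Rightarrow> (real^'m \<Rightarrow> real \<times> 'v::euclidean_space) \<Rightarrow> bool" where
  "minimal_hypersurface D F \<longleftrightarrow>
     immersed_hypersurface D F \<and> (\<forall>p\<in>D. trace (shape_operator F p) = 0)"


section \<open>Riemannian distance and completeness\<close>

text \<open>The length is a nonnegative integral with values in the extended reals because the
  library's piecewise C1 paths may have an unbounded derivative near the break points.\<close>

definition curve_length ::
    "(real^'m \<Rightarrow> real \<times> 'v::euclidean_space) \<Rightarrow> (real \<Rightarrow> real^'m) \<Rightarrow> ennreal" where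
  "curve_length F \<gamma> =
     (\<integral>\<^sup>+ \<tau>\<in>{0..1}. ennreal (sqrt (vector_derivative \<gamma> (at \<tau>) \<bullet>
          (first_form F (\<gamma> \<tau>) *v vector_derivative \<gamma> (at \<tau>)))) \<partial>lborel)"

definition riem_dist ::
    "(real^'m) set \<Rightarrow> (real^'m \<Rightarrow> real \<times> 'v::euclidean_space) \<Rightarrow> real^'m \<Rightarrow> real^'m \<Rightarrow> ennreal" where
  "riem_dist D F p q =
     (INF \<gamma> \<in> {\<gamma>. valid_path \<gamma> \<and> path_image \<gamma> \<subseteq> D \<and> pathstart \<gamma> = p \<and> pathfinish \<gamma> = q}.
        curve_length F \<gamma>)"

definition complete_hypersurface ::
    "(real^'m) set \<Rightarrow> (real^'m \<Rightarrow> real \<times> 'v::euclidean_space) \<Rightarrow> bool" where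
  "complete_hypersurface D F \<longleftrightarrow>
     immersed_hypersurface D F \<and>
     (\<forall>\<sigma>::nat \<Rightarrow> real^'m. range \<sigma> \<subseteq> D \<longrightarrow>
        (\<forall>e>0. \<exists>N. \<forall>i\<ge>N. \<forall>j\<ge>N. riem_dist D F (\<sigma> i) (\<sigma> j) < ennreal e) \<longrightarrow>
        (\<exists>p\<in>D. (\<lambda>i. riem_dist D F (\<sigma> i) p) \<longlonglongrightarrow> 0))"


section \<open>Stability\<close>

definition compactly_supported_lipschitz ::
    "(real^'m) set \<Rightarrow> (real^'m \<Rightarrow> real \<times> 'v::euclidean_space) \<Rightarrow> (real^'m \<Rightarrow> real) \<Rightarrow> bool" where
  "compactly_supported_lipschitz D F \<psi> \<longleftrightarrow>
     (\<exists>L\<ge>0. \<forall>p\<in>D. \<forall>q\<in>D. ennreal \<bar>\<psi> p - \<psi> q\<bar> \<le> ennreal L * riem_dist D F p q) \<and>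
     (\<exists>K. compact K \<and> K \<subseteq> D \<and> (\<forall>p\<in>D - K. \<psi> p = 0))"

text \<open>The squared length \<open>g\<^sup>i\<^sup>j \<partial>\<^sub>i\<psi> \<partial>\<^sub>j\<psi>\<close> of the gradient. For Lipschitz \<open>\<psi>\<close> it is
  meaningful almost everywhere (Rademacher); the arbitrary values elsewhere do not affect
  the integral below.\<close>

definition norm_grad_sq ::
    "(real^'m \<Rightarrow> real \<times> 'v::euclidean_space) \<Rightarrow> (real^'m \<Rightarrow> real) \<Rightarrow> real^'m \<Rightarrow> real" where
  "norm_grad_sq F \<psi> p =
     (let d\<psi> = (\<chi> i. partial i \<psi> p) in d\<psi> \<bullet> (matrix_inv (first_form F p) *v d\<psi>))"

definition volume_density :: "(real^'m \<Rightarrow> real \<times> 'v::euclidean_space) \<Rightarrow> real^'m \<Rightarrow> real" where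
  "volume_density F p = sqrt (det (first_form F p))"

definition stable_hypersurface ::
    "(real^'m) set \<Rightarrow> (real^'m \<Rightarrow> real \<times> 'v::euclidean_space) \<Rightarrow> bool" where
  "stable_hypersurface D F \<longleftrightarrow>
     minimal_hypersurface D F \<and>
     (\<forall>\<psi>. compactly_supported_lipschitz D F \<psi> \<longrightarrow>
        (LINT p:D|lebesgue. (norm_grad_sq F \<psi> p - (norm_A_sq F p - real CARD('m)) * (\<psi> p)\<^sup>2)
                              * volume_density F p) \<ge> 0)"


section \<open>Hyperbolic catenoids\<close>

definition catenoid_const :: "nat \<Rightarrow> real \<Rightarrow> real" where
  "catenoid_const n t = t ^ (n - 1) * sqrt (t\<^sup>2 - 1)"

text \<open>The first-order equation alone also has spurious solutions that rest at the value \<open>t\<close>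
  for some time before leaving it; the second-order equation singles out the intended one.\<close>

definition catenoid_profile :: "nat \<Rightarrow> real \<Rightarrow> (real \<Rightarrow> real) \<Rightarrow> bool" where
  "catenoid_profile n t x \<longleftrightarrow>
     x 0 = t \<and> deriv x 0 = 0 \<and> (\<forall>s. x s \<ge> t) \<and> (\<forall>s. x (- s) = x s) \<and>
     (\<forall>s. x differentiable (at s)) \<and>
     (\<forall>s\<ge>0. deriv x s =
        sqrt ((x s)\<^sup>2 - 1 - (catenoid_const n t)\<^sup>2 * x s powi (2 * (1 - int n)))) \<and>
     (\<forall>s. (deriv x has_real_derivative
        x s + (real n - 1) * (catenoid_const n t)\<^sup>2 * x s powi (1 - 2 * int n)) (at s))"

definition catenoid_angle :: "(real \<Rightarrow> real) \<Rightarrow> real \<Rightarrow> real" where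
  "catenoid_angle x s =
     (LBINT \<tau>=0..s. sqrt ((x \<tau>)\<^sup>2 - (deriv x \<tau>)\<^sup>2 - 1) / ((x \<tau>)\<^sup>2 - 1))"

text \<open>An orthogonal parametrization of all of the hyperbolic space of dimension
  \<open>CARD('k)\<close> by an open set; for instance horospherical coordinates.\<close>

definition orthogonal_parametrization ::
    "(real^'k) set \<Rightarrow> (real^'k \<Rightarrow> real \<times> (real^'k)) \<Rightarrow> bool" where
  "orthogonal_parametrization U \<phi> \<longleftrightarrow>
     open U \<and> smooth_on U \<phi> \<and> inj_on \<phi> U \<and> \<phi> ` U = hyperbolic_space \<and>
     (\<forall>p\<in>U. inj (frechet_derivative \<phi> (at p))) \<and>
     (\<forall>p\<in>U. \<forall>i j. i \<noteq> j \<longrightarrow> lorentz (partial i \<phi> p) (partial j \<phi> p) = 0)"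

text \<open>A parameter \<open>(t\<^sub>1, \<dots>, t\<^sub>n\<^sub>-\<^sub>1, s)\<close> is a point of \<^typ>\<open>real^('k option)\<close> with
  \<open>CARD('k) = n - 1\<close>: the index \<open>Some i\<close> carries \<open>t\<^sub>i\<close> and \<open>None\<close> carries \<open>s\<close>.\<close>

definition par_t :: "real^('k::finite option) \<Rightarrow> real^'k" where
  "par_t p = (\<chi> i. p $ Some i)"

definition par_s :: "real^('k::finite option) \<Rightarrow> real" where
  "par_s p = p $ None"

definition catenoid_domain :: "(real^'k::finite) set \<Rightarrow> (real^('k option)) set" where
  "catenoid_domain U = {p. par_t p \<in> U}"

definition catenoid_map ::
    "(real \<Rightarrow> real) \<Rightarrow> (real^'k \<Rightarrow> real \<times> (real^'k)) \<Rightarrow>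
     real^('k::finite option) \<Rightarrow> real \<times> (real^'k) \<times> real \<times> real" where
  "catenoid_map x \<phi> p =
     (let s = par_s p; q = \<phi> (par_t p); r = sqrt ((x s)\<^sup>2 - 1)
      in (x s * fst q, x s *\<^sub>R snd q, r * sin (catenoid_angle x s), r * cos (catenoid_angle x s)))"

end

theory Submission
  imports Defs
begin

text \<open>
  In the chart the induced metric is \<open>ds\<^sup>2 + x(s)\<^sup>2 g\<close>, where \<open>g\<close> is the metric of the orbits, and the
  principal curvatures are \<open>a x\<^sup>-\<^sup>n\<close> along the orbits and \<open>-(n - 1) a x\<^sup>-\<^sup>n\<close> along the profile curve,
  so that \<open>\<bar>A\<bar>\<^sup>2 = n (n - 1) a\<^sup>2 x\<^sup>-\<^sup>2\<^sup>n\<close>.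

  Stability holds for every \<open>t > 1\<close>. The function \<open>x\<^sup>1\<^sup>-\<^sup>n\<close> is a positive supersolution of the Jacobi
  equation: \<open>w = - (ln x\<^sup>1\<^sup>-\<^sup>n)' = (n - 1) x'/x\<close> satisfies
  \<open>w' = (n - 1) / x\<^sup>2 + n (n - 1) a\<^sup>2 x\<^sup>-\<^sup>2\<^sup>n \<ge> \<bar>A\<bar>\<^sup>2\<close>. Since the volume density is \<open>x\<^sup>n\<^sup>-\<^sup>1\<close> times a function
  of the orbit, completing the square gives
  \<open>(\<psi>\<^sub>s\<^sup>2 - w' \<psi>\<^sup>2) x\<^sup>n\<^sup>-\<^sup>1 = (\<psi>\<^sub>s + w \<psi>)\<^sup>2 x\<^sup>n\<^sup>-\<^sup>1 - (x\<^sup>n\<^sup>-\<^sup>1 w \<psi>\<^sup>2)\<^sub>s\<close>, and the last term integrates to zero.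
  A Lipschitz \<open>\<psi>\<close> is only differentiable almost everywhere in \<open>s\<close>, by the Vitali covering theorem on
  lines; the integral of the \<open>s\<close>-derivative vanishes because the difference quotients have integral zero
  by translation invariance.

  For completeness, the coordinate \<open>s\<close>, the logarithm of the time coordinate and the Klein projection are
  1-Lipschitz for the Riemannian distance, so they converge along a Cauchy sequence; the orbit chart is a
  homeomorphism onto its hyperbolic space by invariance of domain, so the points converge.
\<close>

section \<open>Lipschitz functions of one real variable\<close>

text \<open>Why the power is \<open>1 - n\<close>: for the power \<open>- c\<close> of
  \<open>x\<close> one has \<open>w = c x'/x\<close>, and completing the square against the density
  \<open>x ^ (n - 1)\<close> leaves the potential \<open>w' + (n - 1) (x'/x) w - w\<^sup>2\<close>.
  At \<open>c = n - 1\<close> the last two terms cancel and \<open>w'\<close> alone remains. The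
  first integral \<open>x'\<^sup>2 = x\<^sup>2 - 1 - b\<^sup>2\<close> with
  \<open>b = a x\<^sup>1\<^sup>-\<^sup>n\<close> then evaluates \<open>w'\<close> without any sign
  discussion of \<open>x'\<close>. Only the derivative of \<open>\<psi>\<close> along
  \<open>s\<close> enters. The metric is diagonal, so the other partial derivatives add nonnegative
  squares to the squared gradient, whatever value \<open>partial\<close> has where
  \<open>\<psi>\<close> is not differentiable. The regularity question thus concerns one family of
  parallel lines instead of all directions at once. The unit normal is an arbitrary choice at each
  point, possibly discontinuous in its sign. The second form is therefore derived from the equations
  that any unit normal satisfies, and only quantities insensitive to the sign are kept.\<close>

definition fine_points :: "(real \<Rightarrow> real \<Rightarrow> bool) \<Rightarrow> real set" where
  "fine_points Q = {x. \<forall>d>0. \<exists>c r. 0 < r \<and> r < d \<and> x \<in> ball c r \<and> Q c r}"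

text \<open>The balls are open and need not be centred at the point, so for each bound on the radius
  their union is open. The set is a countable intersection of such unions, for an arbitrary
  predicate \<open>Q\<close>.\<close>

lemma fine_points_borel: "fine_points Q \<in> sets borel"
proof -
  let ?A = "\<lambda>n. \<Union>{ball c r | c r. 0 < r \<and> r < 1 / real (Suc n) \<and> Q c r}"
  have "fine_points Q = (\<Inter>n. ?A n)"
  proof
    show "fine_points Q \<subseteq> (\<Inter>n. ?A n)"
    proof
      fix x assume x: "x \<in> fine_points Q"
      have "x \<in> ?A n" for n
      proof -
        have "0 < 1 / real (Suc n)" by simp
        then obtain c r where "0 < r" "r < 1 / real (Suc n)" "x \<in> ball c r" "Q c r"
          using x unfolding fine_points_def by blast
        then show ?thesis by blast
      qed
      then show "x \<in> (\<Inter>n. ?A n)" by blast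
    qed
    show "(\<Inter>n. ?A n) \<subseteq> fine_points Q"
    proof
      fix x assume x: "x \<in> (\<Inter>n. ?A n)"
      show "x \<in> fine_points Q"
        unfolding fine_points_def
      proof (intro CollectI allI impI)
        fix d :: real assume "d > 0"
        then obtain n where n: "1 / real (Suc n) < d"
          using nat_approx_posE by blast
        have "x \<in> ?A n" using x by blast
        then show "\<exists>c r. 0 < r \<and> r < d \<and> x \<in> ball c r \<and> Q c r"
          using n by fastforce
      qed
    qed
  qed
  moreover have "open (?A n)" for n by auto
  ultimately show ?thesis by auto
qed

text \<open>The covering theorem yields disjoint closed intervals; passing to the open ones loses
  only countably many endpoints. The open form matters because the union of open balls can serve as
  the set \<open>W\<close> of a second, nested application.\<close>

lemma Vitali_fine_points:
  assumes S: "S \<subseteq> fine_points Q" and W: "open W" "S \<subseteq> W"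
  obtains C where "countable C"
    "\<And>c r. (c, r) \<in> C \<Longrightarrow> 0 < r \<and> Q c r \<and> cball c r \<subseteq> W"
    "disjoint_family_on (\<lambda>(c, r). cball c r) C"
    "negligible (S - (\<Union>(c, r)\<in>C. ball c r))"
proof -
  let ?K = "{(c, r). 0 < r \<and> Q c r \<and> cball c r \<subseteq> W}"
  have cov: "\<exists>i. i \<in> ?K \<and> x \<in> cball (fst i) (snd i) \<and> snd i < d" if x: "x \<in> S" and d: "0 < d" for x d
  proof -
    obtain e where e: "e > 0" "ball x e \<subseteq> W" using W x open_contains_ball by blast
    \<comment> \<open>Here \<open>x\<close> need not be the centre, so the radius is kept below
      \<open>e / 2\<close>: the closed ball then has diameter below \<open>e\<close> and stays
      inside \<open>ball x e\<close>.\<close>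
    obtain c r where cr: "0 < r" "r < min d (e/2)" "x \<in> ball c r" "Q c r"
      using S x d e(1) unfolding fine_points_def by (auto dest!: subsetD spec[of _ "min d (e/2)"])
    have "cball c r \<subseteq> ball x e"
    proof
      fix y assume "y \<in> cball c r"
      then show "y \<in> ball x e" using cr by (auto simp: dist_real_def)
    qed
    then have "(c, r) \<in> ?K" using cr e by auto
    then show "\<exists>i. i \<in> ?K \<and> x \<in> cball (fst i) (snd i) \<and> snd i < d"
      using cr by (intro exI[of _ "(c, r)"]) auto
  qed
  obtain C where C: "countable C" "C \<subseteq> ?K"
     "pairwise (\<lambda>i j. disjnt (cball (fst i) (snd i)) (cball (fst j) (snd j))) C"
     "negligible (S - (\<Union>i \<in> C. cball (fst i) (snd i)))"
    using Vitali_covering_theorem_cballs[of ?K snd S fst, OF _ cov] by (auto simp: case_prod_beta)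
  have "S - (\<Union>(c, r)\<in>C. ball c r) \<subseteq>
      (S - (\<Union>i \<in> C. cball (fst i) (snd i))) \<union> (\<Union>(c, r)\<in>C. {c - r, c + r})"
  proof
    fix x assume x: "x \<in> S - (\<Union>(c, r)\<in>C. ball c r)"
    show "x \<in> (S - (\<Union>i \<in> C. cball (fst i) (snd i))) \<union> (\<Union>(c, r)\<in>C. {c - r, c + r})"
    proof (cases "\<exists>c r. (c, r) \<in> C \<and> x \<in> cball c r")
      case True
      then obtain c r where cr: "(c, r) \<in> C" "x \<in> cball c r" by blast
      then have "x \<notin> ball c r" using x by blast
      then have "x = c - r \<or> x = c + r" using cr(2) by (auto simp: dist_real_def)
      then show ?thesis using cr(1) by blast
    qed (use x in auto)
  qed
  moreover have "negligible (\<Union>(c, r)\<in>C. {c - r, c + r})"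
    by (intro countable_imp_null_set_lborel[THEN null_sets_completionI, folded negligible_iff_null_sets] countable_UN C(1)) auto
  ultimately have neg: "negligible (S - (\<Union>(c, r)\<in>C. ball c r))"
    using C(4) negligible_subset negligible_Un by meson
  show ?thesis
  proof (rule that[OF C(1) _ _ neg])
    show "0 < r \<and> Q c r \<and> cball c r \<subseteq> W" if "(c, r) \<in> C" for c r
      using that C(2) by blast
    show "disjoint_family_on (\<lambda>(c, r). cball c r) C"
      using C(3) unfolding disjoint_family_on_def pairwise_def disjnt_def by (auto simp: case_prod_beta)
  qed
qed

text \<open>Countable additivity reduces the comparison to single intervals. The two factors allow
  both uses: \<open>\<beta>\<close> times length against the measure \<open>dg\<close>, and
  \<open>dg\<close> against \<open>\<alpha>\<close> times length.\<close>

lemma emeasure_disjoint_UN_mono: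
  fixes M N :: "real measure"
  assumes "countable C" "disjoint_family_on X C"
    and "sets M = sets borel" "sets N = sets borel" "\<And>i. i \<in> C \<Longrightarrow> X i \<in> sets borel"
    and le: "\<And>i. i \<in> C \<Longrightarrow> a * emeasure M (X i) \<le> b * emeasure N (X i)"
  shows "a * emeasure M (\<Union>i\<in>C. X i) \<le> b * emeasure N (\<Union>i\<in>C. X i)"
proof -
  have "a * emeasure M (\<Union>i\<in>C. X i) = (\<integral>\<^sup>+i. a * emeasure M (X i) \<partial>count_space C)"
    using assms by (subst emeasure_UN_countable) (auto simp: nn_integral_cmult)
  also have "\<dots> \<le> (\<integral>\<^sup>+i. b * emeasure N (X i) \<partial>count_space C)"
    using le by (intro nn_integral_mono) auto
  also have "\<dots> = b * emeasure N (\<Union>i\<in>C. X i)"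
    using assms by (subst emeasure_UN_countable) (auto simp: nn_integral_cmult)
  finally show ?thesis .
qed

lemma emeasure_le_UN_negligible:
  assumes S: "S \<in> sets borel" and J: "J \<in> sets borel" and n: "negligible (S - J)"
  shows "emeasure lborel (S::real set) \<le> emeasure lborel J"
proof -
  have "AE x in lborel. x \<in> S \<longrightarrow> x \<in> J"
  proof (rule AE_I')
    show "S - J \<in> null_sets lborel" using n S J
      by (simp add: negligible_iff_null_sets null_sets_completion_iff)
  qed auto
  then show ?thesis using J by (intro emeasure_mono_AE) auto
qed

text \<open>Vitali coverings with slope below \<open>\<alpha>\<close> and then, inside these, with slope above \<open>\<beta>\<close>
  contradict the monotonicity of the measure \<open>dg\<close> unless the set is null.\<close>

lemma negligible_two_slopes:
  fixes g :: "real \<Rightarrow> real"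
  assumes mono: "mono g" and cont: "continuous_on UNIV g" and ab: "0 < \<alpha>" "\<alpha> < \<beta>"
  shows "negligible (fine_points (\<lambda>c r. g (c + r) - g (c - r) < \<alpha> * (2 * r)) \<inter>
                     fine_points (\<lambda>c r. g (c + r) - g (c - r) > \<beta> * (2 * r)))"
    (is "negligible (?A \<inter> ?B)")
proof -
  let ?\<nu> = "interval_measure g"
  have nu: "emeasure ?\<nu> (cball c r) = ennreal (g (c + r) - g (c - r))" if "0 < r" for c r
    unfolding cball_eq_atLeastAtMost
    using that monoD[OF mono] cont by (intro emeasure_interval_measure_Icc) auto
  have la: "emeasure lborel (cball c r) = ennreal (2 * r)" if "0 < r" for c r :: real
    unfolding cball_eq_atLeastAtMost using that by simp
  have main: "emeasure lborel (?A \<inter> ?B \<inter> ball 0 R) = 0" for R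
  proof -
    let ?S = "?A \<inter> ?B \<inter> ball 0 R"
    let ?m = "measure lborel ?S"
    have S: "?S \<in> sets borel" by (intro sets.Int fine_points_borel) auto
    have fin: "emeasure lborel ?S < \<infinity>"
      by (rule emeasure_bounded_finite) (auto intro: bounded_subset)
    then have Sm: "emeasure lborel ?S = ennreal ?m"
      by (simp add: emeasure_eq_ennreal_measure)
    \<comment> \<open>The chain is \<open>\<beta> m(S) \<le> \<beta> m(J) \<le> dg(J) \<le> dg(I)
      \<le> \<alpha> m(I) \<le> \<alpha> m(W)\<close>, where the open set \<open>W\<close> exceeds
      \<open>S\<close> by measure less than \<open>e\<close>, the intervals of \<open>I\<close> have
      slope below \<open>\<alpha>\<close>, and those of \<open>J\<close>, chosen inside
      \<open>I\<close>, have slope above \<open>\<beta>\<close>.\<close>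
    have *: "\<beta> * ?m \<le> \<alpha> * (?m + e)" if e: "0 < e" for e
    proof -
      obtain W where W: "open W" "?S \<subseteq> W" "W - ?S \<in> lmeasurable" "emeasure lebesgue (W - ?S) < ennreal e"
        using sets_lebesgue_outer_open[of ?S e] S e by auto
      have "emeasure lborel W = emeasure lborel ?S + emeasure lborel (W - ?S)"
        using S W by (subst plus_emeasure) (auto intro!: arg_cong[of _ _ "emeasure lborel"])
      also have "emeasure lborel (W - ?S) = emeasure lebesgue (W - ?S)"
        using S W by simp
      finally have We: "emeasure lborel W \<le> ennreal (?m + e)"
        using W(4) Sm e by (simp add: ennreal_plus)
      obtain C where C: "countable C"
        "\<And>c r. (c, r) \<in> C \<Longrightarrow> 0 < r \<and> g (c + r) - g (c - r) < \<alpha> * (2 * r) \<and> cball c r \<subseteq> W"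
        "disjoint_family_on (\<lambda>(c, r). cball c r) C"
        "negligible (?S - (\<Union>(c, r)\<in>C. ball c r))"
        using Vitali_fine_points[of ?S "\<lambda>c r. g (c + r) - g (c - r) < \<alpha> * (2 * r)" W] W by blast
      let ?I = "\<Union>i\<in>C. (case i of (c, r) \<Rightarrow> cball c r)" and ?I' = "\<Union>(c, r)\<in>C. ball c r"
      have oI': "open ?I'" by auto
      obtain D where D: "countable D"
        "\<And>c r. (c, r) \<in> D \<Longrightarrow> 0 < r \<and> g (c + r) - g (c - r) > \<beta> * (2 * r) \<and> cball c r \<subseteq> ?I'"
        "disjoint_family_on (\<lambda>(c, r). cball c r) D"
        "negligible (?S \<inter> ?I' - (\<Union>(c, r)\<in>D. ball c r))"
        using Vitali_fine_points[of "?S \<inter> ?I'" "\<lambda>c r. g (c + r) - g (c - r) > \<beta> * (2 * r)" ?I'] oI'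
        by blast
      let ?J = "\<Union>i\<in>D. (case i of (c, r) \<Rightarrow> cball c r)"
      have sI: "?I \<in> sets borel" and sJ: "?J \<in> sets borel"
        by (auto intro!: sets.countable_UN'' C D simp: case_prod_beta)
      have "negligible (?S - ?J)"
        by (rule negligible_subset[OF negligible_Un[OF C(4) D(4)]]) force
      then have "emeasure lborel ?S \<le> emeasure lborel ?J"
        using S sJ by (intro emeasure_le_UN_negligible)
      then have "ennreal \<beta> * emeasure lborel ?S \<le> ennreal \<beta> * emeasure lborel ?J"
        by (rule mult_left_mono) auto
      also have "\<dots> \<le> 1 * emeasure ?\<nu> ?J"
      proof (rule emeasure_disjoint_UN_mono)
        fix i assume i: "i \<in> D"
        obtain c r where [simp]: "i = (c, r)" by fastforce
        have "0 < r" "g (c + r) - g (c - r) > \<beta> * (2 * r)" using D(2) i by auto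
        then show "ennreal \<beta> * emeasure lborel (case i of (c, r) \<Rightarrow> cball c r)
            \<le> 1 * emeasure ?\<nu> (case i of (c, r) \<Rightarrow> cball c r)"
          using ab by (simp add: nu la ennreal_mult[symmetric] ennreal_leI)
      qed (use D in auto)
      also have "\<dots> \<le> 1 * emeasure ?\<nu> ?I"
      proof -
        have "?I' \<subseteq> ?I" using ball_subset_cball by fast
        then have "?J \<subseteq> ?I" using D(2) by fast
        then show ?thesis using sI by (intro mult_left_mono emeasure_mono) auto
      qed
      also have "\<dots> \<le> ennreal \<alpha> * emeasure lborel ?I"
      proof (rule emeasure_disjoint_UN_mono)
        fix i assume i: "i \<in> C"
        obtain c r where [simp]: "i = (c, r)" by fastforce
        have "0 < r" "g (c + r) - g (c - r) < \<alpha> * (2 * r)" using C(2) i by auto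
        then show "1 * emeasure ?\<nu> (case i of (c, r) \<Rightarrow> cball c r)
            \<le> ennreal \<alpha> * emeasure lborel (case i of (c, r) \<Rightarrow> cball c r)"
          using ab by (simp add: nu la ennreal_mult[symmetric] ennreal_leI)
      qed (use C in auto)
      also have "\<dots> \<le> ennreal \<alpha> * emeasure lborel W"
        using C(2) W(1) by (intro mult_left_mono emeasure_mono) auto
      also have "\<dots> \<le> ennreal \<alpha> * ennreal (?m + e)"
        using We by (intro mult_left_mono) auto
      finally have "ennreal (\<beta> * ?m) \<le> ennreal (\<alpha> * (?m + e))"
        using Sm ab e by (simp add: ennreal_mult del: ennreal_plus)
      then show ?thesis using ab e by (subst (asm) ennreal_le_iff) auto
    qed
    have le: "\<beta> * ?m \<le> \<alpha> * ?m + e" if "0 < e" for e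
    proof -
      have "\<beta> * ?m \<le> \<alpha> * (?m + e / \<alpha>)" using that ab by (intro *) simp
      then show ?thesis using ab by (simp add: distrib_left)
    qed
    have "\<beta> * ?m \<le> \<alpha> * ?m" using le by (rule field_le_epsilon)
    then have "?m \<le> 0" using ab by (simp add: mult_le_cancel_right)
    then show ?thesis using Sm by (simp add: ennreal_neg)
  qed
  have "negligible (\<Union>R::nat. ?A \<inter> ?B \<inter> ball 0 (real R))"
  proof (rule negligible_countable_Union)
    fix N assume "N \<in> range (\<lambda>R::nat. ?A \<inter> ?B \<inter> ball 0 (real R))"
    then obtain R :: nat where N: "N = ?A \<inter> ?B \<inter> ball 0 (real R)" by auto
    have "N \<in> sets borel" unfolding N by (intro sets.Int fine_points_borel) auto
    then show "negligible N" using main[of "real R"] N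
      by (simp add: negligible_iff_null_sets null_sets_completion_iff null_sets_def)
  qed auto
  moreover have "(\<Union>R::nat. ?A \<inter> ?B \<inter> ball 0 (real R)) = ?A \<inter> ?B"
    using reals_Archimedean2 by (auto simp: dist_real_def)
  ultimately show ?thesis by simp
qed

text \<open>The number \<open>l\<close> is the lower limit of \<open>q\<close>, written as the
  supremum of its eventual lower bounds. If no two rationals above \<open>l\<close> separated the
  values of \<open>q\<close>, the upper limit would be \<open>l\<close> as well. Rational slopes
  keep the number of exceptional sets countable, and the lower bound 1 on \<open>q\<close> makes
  \<open>\<alpha>\<close> positive.\<close>

lemma not_differentiable_imp_two_slopes:
  fixes q :: "real \<Rightarrow> real"
  assumes b: "\<And>h. h \<noteq> 0 \<Longrightarrow> 1 \<le> q h \<and> q h \<le> M"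
    and n: "\<not> (\<exists>l. (q \<longlongrightarrow> l) (at 0))"
  obtains \<alpha> \<beta> where "\<alpha> \<in> \<rat>" "\<beta> \<in> \<rat>" "0 < \<alpha>" "\<alpha> < \<beta>"
    "\<exists>\<^sub>F h in at 0. q h < \<alpha>" "\<exists>\<^sub>F h in at 0. \<beta> < q h"
proof (rule ccontr)
  assume no: "\<not> thesis"
  let ?T = "{a. \<forall>\<^sub>F h in at 0. a \<le> q h}"
  define l where "l = Sup ?T"
  have T1: "1 \<in> ?T" using b by (auto simp: eventually_at intro!: exI[of _ 1])
  have bdd: "bdd_above ?T"
  proof (rule bdd_aboveI)
    fix a assume "a \<in> ?T"
    then have "\<forall>\<^sub>F h in at (0::real). a \<le> q h" by simp
    moreover have "\<forall>\<^sub>F h in at (0::real). q h \<le> M" using b by (auto simp: eventually_at intro!: exI[of _ 1])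
    ultimately have "\<forall>\<^sub>F h in at (0::real). a \<le> M" by eventually_elim auto
    then show "a \<le> M" by simp
  qed
  have l1: "1 \<le> l" unfolding l_def using T1 bdd by (rule cSup_upper)
  have "(q \<longlongrightarrow> l) (at 0)"
  proof (rule order_tendstoI)
    fix a assume "a < l"
    then obtain c where "c \<in> ?T" "a < c" unfolding l_def using less_cSup_iff[OF _ bdd] T1 by blast
    then show "\<forall>\<^sub>F h in at 0. a < q h" by (auto elim: eventually_mono)
  next
    fix a assume "l < a"
    obtain \<beta> where be: "\<beta> \<in> \<rat>" "l < \<beta>" "\<beta> < a" using Rats_dense_in_real[OF \<open>l < a\<close>] by blast
    obtain \<alpha> where al: "\<alpha> \<in> \<rat>" "l < \<alpha>" "\<alpha> < \<beta>" using Rats_dense_in_real[OF be(2)] by blast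
    have "\<alpha> \<notin> ?T" using al bdd cSup_upper[of \<alpha> ?T] unfolding l_def by force
    then have "\<exists>\<^sub>F h in at 0. q h < \<alpha>" by (simp add: frequently_def not_less)
    then have "\<not> (\<exists>\<^sub>F h in at 0. \<beta> < q h)" using no that al be l1 by force
    then have "\<forall>\<^sub>F h in at 0. q h \<le> \<beta>" by (simp add: frequently_def not_less)
    then show "\<forall>\<^sub>F h in at 0. q h < a" using be(3) by (auto elim: eventually_mono)
  qed
  then show False using n by blast
qed

text \<open>A difference quotient at \<open>x\<close> belongs to an interval with \<open>x\<close>
  as an endpoint, whereas \<open>fine_points\<close> wants \<open>x\<close> inside an open ball.
  Moving both ends outwards by a small \<open>e\<close> changes the slope continuously, so it stays
  in the open set \<open>P\<close>.\<close>

lemma fine_points_of_frequently_slope: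
  fixes g :: "real \<Rightarrow> real"
  assumes cont: "continuous_on UNIV g"
    and P: "open P"
    and f: "\<exists>\<^sub>F h in at 0. (g (x + h) - g x) / h \<in> P"
  shows "x \<in> fine_points (\<lambda>c r. (g (c + r) - g (c - r)) / (2 * r) \<in> P)"
  unfolding fine_points_def
proof (intro CollectI allI impI)
  fix d :: real assume d: "d > 0"
  have "\<forall>\<^sub>F h in at (0::real). \<bar>h\<bar> < d \<and> h \<noteq> 0" using d by (auto simp: eventually_at intro!: exI[of _ d])
  then obtain h where h: "(g (x + h) - g x) / h \<in> P" "\<bar>h\<bar> < d" "h \<noteq> 0"
    using frequently_ex[OF frequently_eventually_frequently[OF f]] by blast
  define u v where "u = min x (x + h)" and "v = max x (x + h)"
  have uv: "u < v" "v - u < d" "u \<le> x" "x \<le> v" using h by (auto simp: u_def v_def)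
  have slope: "(g v - g u) / (v - u) \<in> P"
  proof (cases "h > 0")
    case True
    then show ?thesis using h unfolding u_def v_def by (simp add: min_def max_def)
  next
    case False
    have "(g x - g (x + h)) / (x - (x + h)) = (g (x + h) - g x) / h"
      using h by (simp add: field_simps)
    then show ?thesis using h False unfolding u_def v_def by (simp add: min_def max_def)
  qed
  have ic: "isCont g y" for y using cont continuous_on_eq_continuous_at by blast
  have "((\<lambda>e. (g (v + e) - g (u - e)) / (v + e - (u - e))) \<longlongrightarrow> (g v - g u) / (v - u)) (at_right 0)"
  proof -
    have "isCont (\<lambda>e. (g (v + e) - g (u - e)) / (v + e - (u - e))) 0"
    proof (intro continuous_divide continuous_diff)
      show "isCont (\<lambda>e. g (v + e)) 0" "isCont (\<lambda>e. g (u - e)) 0"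
        by (rule isCont_o2[OF _ ic], intro continuous_intros)+
    qed (use uv in \<open>auto intro!: continuous_intros\<close>)
    then show ?thesis using tendsto_within_subset by (fastforce simp: isCont_def)
  qed
  then have "\<forall>\<^sub>F e in at_right 0. (g (v + e) - g (u - e)) / (v + e - (u - e)) \<in> P"
    using P slope topological_tendstoD by blast
  moreover have "\<forall>\<^sub>F e in at_right (0::real). 0 < e" by (simp add: eventually_at_right_less)
  moreover have "\<forall>\<^sub>F e in at_right (0::real). e < (d - (v - u)) / 2"
    using uv by (intro eventually_at_rightI[of 0 "(d - (v - u)) / 2"]) auto
  ultimately have "\<forall>\<^sub>F e in at_right (0::real). (g (v + e) - g (u - e)) / (v + e - (u - e)) \<in> P
      \<and> 0 < e \<and> e < (d - (v - u)) / 2" by eventually_elim auto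
  then obtain e where e: "(g (v + e) - g (u - e)) / (v + e - (u - e)) \<in> P" "0 < e" "e < (d - (v - u)) / 2"
    using eventually_happens trivial_limit_at_right_real by blast
  let ?c = "(u + v) / 2" and ?r = "(v - u) / 2 + e"
  have eqs: "?c + ?r = v + e" "?c - ?r = u - e" "2 * ?r = v + e - (u - e)"
    by (simp_all add: field_simps)
  have 1: "0 < ?r" "?r < d" using uv e d by (auto simp: field_simps)
  have 2: "x \<in> ball ?c ?r" using uv e by (auto simp: dist_real_def abs_if field_simps)
  have 3: "(g (?c + ?r) - g (?c - ?r)) / (2 * ?r) \<in> P" using e(1) unfolding eqs .
  show "\<exists>c r. 0 < r \<and> r < d \<and> x \<in> ball c r \<and> (g (c + r) - g (c - r)) / (2 * r) \<in> P"
    using 1 2 3 by blast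
qed

text \<open>Adding \<open>(L + 1) x\<close> does not affect differentiability and brings all slopes
  between 1 and \<open>2 L + 1\<close>. The function becomes increasing, so it defines a Stieltjes
  measure, and at a point without derivative its quotients oscillate across a pair of positive
  rationals. There are countably many such pairs, each with a null set.\<close>

theorem Lipschitz_real_differentiable_ae:
  fixes f :: "real \<Rightarrow> real"
  assumes L: "\<And>x y. \<bar>f x - f y\<bar> \<le> L * \<bar>x - y\<bar>"
  shows "negligible {x. \<not> f differentiable (at x)}"
proof -
  define g where "g x = f x + (L + 1) * x" for x
  have slope: "1 \<le> (g (x + h) - g x) / h \<and> (g (x + h) - g x) / h \<le> 2 * L + 1" if "h \<noteq> 0" for x h
  proof -
    have "\<bar>f (x + h) - f x\<bar> \<le> L * \<bar>h\<bar>" using L[of "x + h" x] by simp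
    then have "\<bar>(f (x + h) - f x) / h\<bar> \<le> L" using that by (simp add: abs_divide divide_le_eq)
    moreover have "(g (x + h) - g x) / h = (f (x + h) - f x) / h + (L + 1)"
      using that by (simp add: g_def field_simps)
    ultimately show ?thesis by linarith
  qed
  have mono: "mono g"
  proof (rule monoI)
    fix x y :: real assume "x \<le> y"
    then show "g x \<le> g y" using slope[of "y - x" x] by (cases "x = y") (auto simp: divide_simps)
  qed
  have "L-lipschitz_on UNIV f"
  proof (rule lipschitz_onI)
    show "0 \<le> L" using L[of 0 1] by auto
  qed (use L in \<open>auto simp: dist_real_def\<close>)
  then have "continuous_on UNIV f" by (rule lipschitz_on_continuous_on)
  then have cont: "continuous_on UNIV g" unfolding g_def by (intro continuous_intros)
  let ?P = "{p \<in> \<rat> \<times> \<rat>. 0 < fst p \<and> fst p < (snd p :: real)}"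
  let ?N = "\<lambda>p. fine_points (\<lambda>c r. g (c + r) - g (c - r) < fst p * (2 * r)) \<inter>
                fine_points (\<lambda>c r. g (c + r) - g (c - r) > snd p * (2 * r))"
  have neg: "negligible (\<Union>p\<in>?P. ?N p)"
  proof (rule negligible_countable_Union)
    have "countable ?P" using countable_rat by (auto intro: countable_subset[of _ "\<rat> \<times> \<rat>"])
    then show "countable (?N ` ?P)" by simp
    show "negligible S" if "S \<in> ?N ` ?P" for S
      using that negligible_two_slopes[OF mono cont] by fastforce
  qed
  have "{x. \<not> f differentiable (at x)} \<subseteq> (\<Union>p\<in>?P. ?N p)"
  proof
    fix x assume "x \<in> {x. \<not> f differentiable (at x)}"
    then have nd: "\<not> f differentiable (at x)" by simp
    have nl: "\<not> (\<exists>l. ((\<lambda>h. (g (x + h) - g x) / h) \<longlongrightarrow> l) (at 0))"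
    proof
      assume "\<exists>l. ((\<lambda>h. (g (x + h) - g x) / h) \<longlongrightarrow> l) (at 0)"
      then obtain l where "(g has_real_derivative l) (at x)" by (auto simp: DERIV_def)
      then have "((\<lambda>x. g x - (L + 1) * x) has_real_derivative (l - (L + 1) * 1)) (at x)"
        by (auto intro!: derivative_eq_intros)
      then have "(f has_real_derivative (l - (L + 1) * 1)) (at x)" by (simp add: g_def)
      then show False using nd real_differentiable_def by blast
    qed
    then obtain \<alpha> \<beta> where ab: "\<alpha> \<in> \<rat>" "\<beta> \<in> \<rat>" "0 < \<alpha>" "\<alpha> < \<beta>"
      and fr: "\<exists>\<^sub>F h in at 0. (g (x + h) - g x) / h < \<alpha>" "\<exists>\<^sub>F h in at 0. \<beta> < (g (x + h) - g x) / h"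
      using not_differentiable_imp_two_slopes[where q="\<lambda>h. (g (x + h) - g x) / h", OF slope nl] by blast
    have "x \<in> fine_points (\<lambda>c r. (g (c + r) - g (c - r)) / (2 * r) \<in> {..<\<alpha>})"
      using fr by (intro fine_points_of_frequently_slope cont) auto
    then have 1: "x \<in> fine_points (\<lambda>c r. g (c + r) - g (c - r) < \<alpha> * (2 * r))"
      unfolding fine_points_def by (fastforce simp: divide_less_eq)
    have "x \<in> fine_points (\<lambda>c r. (g (c + r) - g (c - r)) / (2 * r) \<in> {\<beta><..})"
      using fr by (intro fine_points_of_frequently_slope cont) auto
    then have 2: "x \<in> fine_points (\<lambda>c r. g (c + r) - g (c - r) > \<beta> * (2 * r))"
      unfolding fine_points_def by (fastforce simp: less_divide_eq)
    show "x \<in> (\<Union>p\<in>?P. ?N p)"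
      using 1 2 ab by (intro UN_I[of "(\<alpha>, \<beta>)"]) auto
  qed
  then show ?thesis using neg negligible_subset by blast
qed


section \<open>Derivatives along parallel lines\<close>

lemma nn_integral_lborel_translate:
  fixes f :: "'a::euclidean_space \<Rightarrow> ennreal"
  assumes "f \<in> borel_measurable borel"
  shows "(\<integral>\<^sup>+p. f (p + c) \<partial>lborel) = (\<integral>\<^sup>+p. f p \<partial>lborel)"
proof -
  have "(\<integral>\<^sup>+p. f p \<partial>lborel) = (\<integral>\<^sup>+p. f p \<partial>distr lborel borel ((+) c))"
    by (simp add: lborel_distr_plus)
  also have "\<dots> = (\<integral>\<^sup>+p. f (c + p) \<partial>lborel)"
    using assms by (subst nn_integral_distr) auto
  finally show ?thesis by (simp add: add.commute)
qed

lemma integral_lborel_translate: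
  fixes f :: "'a::euclidean_space \<Rightarrow> real"
  assumes "f \<in> borel_measurable borel"
  shows "(\<integral>p. f (p + c) \<partial>lborel) = (\<integral>p. f p \<partial>lborel)"
    and "integrable lborel f \<Longrightarrow> integrable lborel (\<lambda>p. f (p + c))"
proof -
  have "(\<integral>p. f p \<partial>lborel) = (\<integral>p. f p \<partial>distr lborel borel ((+) c))"
    by (simp add: lborel_distr_plus)
  also have "\<dots> = (\<integral>p. f (c + p) \<partial>lborel)"
    using assms by (subst integral_distr) auto
  finally show "(\<integral>p. f (p + c) \<partial>lborel) = (\<integral>p. f p \<partial>lborel)" by (simp add: add.commute)
  assume "integrable lborel f"
  then have "integrable (distr lborel borel ((+) c)) f" by (simp add: lborel_distr_plus)
  then have "integrable lborel (\<lambda>p. f (c + p))" using assms by (subst (asm) integrable_distr_eq) auto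
  then show "integrable lborel (\<lambda>p. f (p + c))" by (simp add: add.commute)
qed

text \<open>By translation invariance the measure of \<open>N\<close> is the average over \<open>h \<in> [0,1]\<close> of the
  measures of its translates, so Tonelli's theorem reduces it to the slices.\<close>

lemma emeasure_eq_0_if_null_slices:
  fixes N :: "'a::euclidean_space set"
  assumes N: "N \<in> sets borel" and sl: "\<And>p. negligible {h. p + h *\<^sub>R e \<in> N}"
  shows "emeasure lborel N = 0"
proof -
  note [measurable] = N
  have ind[measurable]: "(\<lambda>(p, h). indicator N (p + h *\<^sub>R e) * indicator {0..1} h :: ennreal)
      \<in> borel_measurable (lborel \<Otimes>\<^sub>M lborel)"
    by measurable
  have "emeasure lborel N = emeasure lborel N * emeasure lborel {0..1::real}" by simp
  also have "\<dots> = (\<integral>\<^sup>+h. emeasure lborel N * indicator {0..1::real} h \<partial>lborel)"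
    by (subst nn_integral_cmult_indicator) auto
  also have "\<dots> = (\<integral>\<^sup>+h. (\<integral>\<^sup>+p. indicator N (p + h *\<^sub>R e) * indicator {0..1} h \<partial>lborel) \<partial>lborel)"
  proof (intro nn_integral_cong)
    fix h :: real
    have "(\<integral>\<^sup>+p. indicator N (p + h *\<^sub>R e) * indicator {0..1} h \<partial>lborel) =
          (\<integral>\<^sup>+p. indicator N (p + h *\<^sub>R e) \<partial>lborel) * indicator {0..1} h"
      by (rule nn_integral_multc) measurable
    also have "(\<integral>\<^sup>+p. indicator N (p + h *\<^sub>R e) \<partial>lborel) = emeasure lborel N"
      by (subst nn_integral_lborel_translate[where f="indicator N"]) auto
    finally show "emeasure lborel N * indicator {0..1} h =
        (\<integral>\<^sup>+p. indicator N (p + h *\<^sub>R e) * indicator {0..1} h \<partial>lborel)" by simp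
  qed
  also have "\<dots> = (\<integral>\<^sup>+p. (\<integral>\<^sup>+h. indicator N (p + h *\<^sub>R e) * indicator {0..1} h \<partial>lborel) \<partial>lborel)"
    using lborel_pair.Fubini'[OF ind] by simp
  also have "\<dots> = (\<integral>\<^sup>+p. 0 \<partial>(lborel :: 'a measure))"
  proof (intro nn_integral_cong)
    fix p :: 'a
    have "{h. p + h *\<^sub>R e \<in> N} \<in> sets borel" by measurable
    then have "{h. p + h *\<^sub>R e \<in> N} \<in> null_sets lborel"
      using sl[of p] by (simp add: negligible_iff_null_sets null_sets_completion_iff)
    then have "AE h in lborel. indicator N (p + h *\<^sub>R e) * indicator {0..1} h = (0::ennreal)"
      by (rule AE_I') (auto simp: indicator_def)
    then show "(\<integral>\<^sup>+h. indicator N (p + h *\<^sub>R e) * indicator {0..1} h \<partial>lborel) = 0"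
      by (subst nn_integral_cong_AE[where v="\<lambda>_. 0"]) auto
  qed
  finally show ?thesis by simp
qed

text \<open>A witness can be moved to a nearby rational because \<open>q\<close> is continuous off 0
  and \<open>P\<close> is open. The right-hand side consists of countably many conditions, so it
  describes a Borel set when \<open>q\<close> depends measurably on a parameter.\<close>

lemma frequently_at_0_rat:
  fixes q :: "real \<Rightarrow> real"
  assumes c: "continuous_on (- {0}) q" and P: "open P"
  shows "(\<exists>\<^sub>F h in at 0. q h \<in> P) \<longleftrightarrow>
    (\<forall>n::nat. \<exists>h::rat. of_rat h \<noteq> (0::real) \<and> \<bar>of_rat h\<bar> < 1 / real (Suc n) \<and> q (of_rat h) \<in> P)"
    (is "?L \<longleftrightarrow> ?R")
proof
  assume ?L
  show ?R
  proof
    fix n :: nat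
    have "\<forall>\<^sub>F h in at (0::real). \<bar>h\<bar> < 1 / real (Suc n) \<and> h \<noteq> 0"
      unfolding eventually_at by (intro exI[of _ "1 / real (Suc n)"]) auto
    then obtain h where h: "q h \<in> P" "\<bar>h\<bar> < 1 / real (Suc n)" "h \<noteq> 0"
      using frequently_ex[OF frequently_eventually_frequently[OF \<open>?L\<close>]] by blast
    let ?S = "(q -` P \<inter> - {0}) \<inter> ball 0 (1 / real (Suc n))"
    have "open (q -` P \<inter> - {0})"
      using c P by (subst (asm) continuous_on_open_vimage) auto
    then have "open ?S" by auto
    moreover have "h \<in> ?S" using h by auto
    ultimately obtain d where d: "d > 0" "ball h d \<subseteq> ?S" using open_contains_ball by blast
    obtain r where r: "h < of_rat r" "of_rat r < h + d" using of_rat_dense[of h "h + d"] d(1) by auto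
    then have "of_rat r \<in> ?S" using d(2) by (intro subsetD[OF d(2)]) (auto simp: dist_real_def)
    then show "\<exists>h::rat. of_rat h \<noteq> (0::real) \<and> \<bar>of_rat h\<bar> < 1 / real (Suc n) \<and> q (of_rat h) \<in> P"
      by (intro exI[of _ r]) (auto simp: dist_real_def)
  qed
next
  assume R: ?R
  show ?L
    unfolding frequently_def eventually_at
  proof safe
    fix d :: real assume d: "0 < d" "\<forall>x\<in>UNIV. x \<noteq> 0 \<and> dist x 0 < d \<longrightarrow> q x \<notin> P"
    obtain n where n: "1 / real (Suc n) < d" using nat_approx_posE d by blast
    obtain h :: rat where h: "of_rat h \<noteq> (0::real)" "\<bar>of_rat h :: real\<bar> < 1 / real (Suc n)" "q (of_rat h) \<in> P"
      using R by blast
    then show False using d(2) n by (auto simp: dist_real_def)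
  qed
qed

text \<open>Tonelli's theorem needs a Borel exceptional set. \<open>N\<close> is one: it collects
  the points whose quotients are frequently below a rational \<open>a\<close> and frequently above a
  larger rational \<open>b\<close>, tested at rational increments. Its slices consist of points
  where a Lipschitz function of one variable has no derivative, and conversely each point without
  derivative along its line lies in \<open>N\<close>.\<close>

theorem AE_line_differentiable:
  fixes f :: "'a::euclidean_space \<Rightarrow> real"
  assumes f[measurable]: "f \<in> borel_measurable borel"
    and L: "\<And>p h. \<bar>f (p + h *\<^sub>R e) - f p\<bar> \<le> L * \<bar>h\<bar>"
  shows "AE p in lborel. (\<lambda>h. f (p + h *\<^sub>R e)) differentiable (at 0)"
proof -
  \<comment> \<open>The shift by \<open>L + 1\<close> provides the lower bound 1 required by
    \<open>not_differentiable_imp_two_slopes\<close>.\<close>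
  define q where "q p h = (f (p + h *\<^sub>R e) - f p) / h + (L + 1)" for p h
  have q: "1 \<le> q p h \<and> q p h \<le> 2 * L + 1" if "h \<noteq> 0" for p h
  proof -
    have "\<bar>(f (p + h *\<^sub>R e) - f p) / h\<bar> \<le> L" using that L by (simp add: abs_divide divide_le_eq)
    then show ?thesis unfolding q_def by linarith
  qed
  have lip: "\<bar>f (p + a *\<^sub>R e) - f (p + b *\<^sub>R e)\<bar> \<le> L * \<bar>a - b\<bar>" for p a b
    using L[of "p + b *\<^sub>R e" "a - b"] by (simp add: algebra_simps)
  have contf: "continuous_on UNIV (\<lambda>h. f (p + h *\<^sub>R e))" for p
  proof -
    have "L-lipschitz_on UNIV (\<lambda>h. f (p + h *\<^sub>R e))"
    proof (rule lipschitz_onI)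
      show "0 \<le> L" using L[of 0 1] by auto
    qed (use lip in \<open>auto simp: dist_real_def\<close>)
    then show ?thesis by (rule lipschitz_on_continuous_on)
  qed
  have contq: "continuous_on (- {0}) (q p)" for p
    unfolding q_def by (intro continuous_intros continuous_on_subset[OF contf]) auto
  have mq[measurable]: "(\<lambda>p. q p h) \<in> borel_measurable borel" for h
    unfolding q_def by measurable
  define A where "A S = {p. \<forall>n::nat. \<exists>h::rat. of_rat h \<noteq> (0::real) \<and> \<bar>of_rat h\<bar> < 1 / real (Suc n)
      \<and> q p (of_rat h) \<in> S}" for S
  have A: "p \<in> A S \<longleftrightarrow> (\<exists>\<^sub>F h in at 0. q p h \<in> S)" if "open S" for p S
    using frequently_at_0_rat[OF contq that] by (simp add: A_def)
  have mA: "A S \<in> sets borel" if "open S" for S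
  proof -
    have [measurable]: "S \<in> sets borel" using that by simp
    have "{p \<in> space borel. \<forall>n::nat. \<exists>h::rat. of_rat h \<noteq> (0::real) \<and> \<bar>of_rat h\<bar> < 1 / real (Suc n)
      \<and> q p (of_rat h) \<in> S} \<in> sets borel" by measurable
    then show ?thesis by (simp add: A_def)
  qed
  define N where "N = (\<Union>(a, b)\<in>{(a, b). (a::rat) < b}. A {..<of_rat a} \<inter> A {of_rat b<..})"
  have N: "N \<in> sets borel"
    unfolding N_def by (intro sets.countable_UN') (auto intro!: mA)
  have slope_lim: "(f has_real_derivative l) (at x) \<longleftrightarrow> ((\<lambda>h. (f (x + h) - f x) / h) \<longlongrightarrow> l) (at 0)"
    for f and l x :: real by (simp add: DERIV_def)
  have sl: "{h. p + h *\<^sub>R e \<in> N} \<subseteq> {h. \<not> (\<lambda>h. f (p + h *\<^sub>R e)) differentiable (at h)}" for p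
  proof
    fix h assume "h \<in> {h. p + h *\<^sub>R e \<in> N}"
    then obtain a b where ab: "a < b" and fr: "\<exists>\<^sub>F k in at 0. q (p + h *\<^sub>R e) k < of_rat a"
        "\<exists>\<^sub>F k in at 0. q (p + h *\<^sub>R e) k > of_rat b"
      unfolding N_def by (auto simp: A)
    have "\<not> (\<lambda>h. f (p + h *\<^sub>R e)) differentiable (at h)"
    proof
      assume "(\<lambda>h. f (p + h *\<^sub>R e)) differentiable (at h)"
      then obtain l where "((\<lambda>h. f (p + h *\<^sub>R e)) has_real_derivative l) (at h)"
        using real_differentiable_def by blast
      then have "((\<lambda>k. (f (p + (h + k) *\<^sub>R e) - f (p + h *\<^sub>R e)) / k) \<longlongrightarrow> l) (at 0)"
        unfolding slope_lim .
      then have lim: "(q (p + h *\<^sub>R e) \<longlongrightarrow> l + (L + 1)) (at 0)"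
        unfolding q_def by (intro tendsto_add) (auto simp: algebra_simps)
      have 1: "l + (L + 1) \<le> of_rat a"
      proof (rule ccontr)
        assume "\<not> ?thesis"
        then have "\<forall>\<^sub>F k in at 0. of_rat a < q (p + h *\<^sub>R e) k" using order_tendstoD(1)[OF lim] by simp
        then have "\<forall>\<^sub>F k in at 0. \<not> q (p + h *\<^sub>R e) k < of_rat a" by eventually_elim auto
        then show False using fr(1) by (simp add: frequently_def)
      qed
      have 2: "of_rat b \<le> l + (L + 1)"
      proof (rule ccontr)
        assume "\<not> ?thesis"
        then have "\<forall>\<^sub>F k in at 0. q (p + h *\<^sub>R e) k < of_rat b" using order_tendstoD(2)[OF lim] by simp
        then have "\<forall>\<^sub>F k in at 0. \<not> q (p + h *\<^sub>R e) k > of_rat b" by eventually_elim auto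
        then show False using fr(2) by (simp add: frequently_def)
      qed
      have "(of_rat a :: real) < of_rat b" using ab by (simp add: of_rat_less)
      then show False using 1 2 by linarith
    qed
    then show "h \<in> {h. \<not> (\<lambda>h. f (p + h *\<^sub>R e)) differentiable (at h)}" by simp
  qed
  have "emeasure lborel N = 0"
    using Lipschitz_real_differentiable_ae[OF lip] sl N negligible_subset
    by (intro emeasure_eq_0_if_null_slices[where e=e]) blast+
  then have N0: "N \<in> null_sets lborel" using N by (simp add: null_sets_def)
  have "{p. \<not> (\<lambda>h. f (p + h *\<^sub>R e)) differentiable (at 0)} \<subseteq> N"
  proof
    fix p assume "p \<in> {p. \<not> (\<lambda>h. f (p + h *\<^sub>R e)) differentiable (at 0)}"
    then have nd: "\<not> (\<lambda>h. f (p + h *\<^sub>R e)) differentiable (at 0)" by simp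
    have nl: "\<not> (\<exists>l. (q p \<longlongrightarrow> l) (at 0))"
    proof
      assume "\<exists>l. (q p \<longlongrightarrow> l) (at 0)"
      then obtain l where "(q p \<longlongrightarrow> l) (at 0)" by blast
      then have "((\<lambda>h. q p h - (L + 1)) \<longlongrightarrow> l - (L + 1)) (at 0)" by (intro tendsto_intros)
      then have "((\<lambda>h. f (p + h *\<^sub>R e)) has_real_derivative (l - (L + 1))) (at 0)"
        unfolding slope_lim by (simp add: q_def)
      then show False using nd real_differentiable_def by blast
    qed
    obtain \<alpha> \<beta> where ab: "\<alpha> \<in> \<rat>" "\<beta> \<in> \<rat>" "\<alpha> < \<beta>"
      "\<exists>\<^sub>F h in at 0. q p h < \<alpha>" "\<exists>\<^sub>F h in at 0. \<beta> < q p h"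
      using not_differentiable_imp_two_slopes[OF q nl] by blast
    obtain a b :: rat where "\<alpha> = of_rat a" "\<beta> = of_rat b" using ab(1,2) by (auto elim!: Rats_cases)
    then show "p \<in> N" using ab(3-5) unfolding N_def by (auto simp: A of_rat_less)
  qed
  then show ?thesis using N0 by (intro AE_I'[OF N0]) auto
qed

text \<open>Steps of length at most 1 keep all difference quotients supported in one ball, where
  they are bounded by \<open>C\<close>; this gives the dominating function. \<open>D\<close> is
  prescribed only up to a null set and measurability is not part of its description, so the
  conclusion concerns a Borel representative.\<close>

theorem integral_line_derivative_eq_0:
  fixes H :: "'a::euclidean_space \<Rightarrow> real"
  assumes H[measurable]: "H \<in> borel_measurable borel"
    and K: "bounded K" "\<And>p. p \<notin> K \<Longrightarrow> H p = 0"
    and B: "\<And>p. \<bar>H p\<bar> \<le> B"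
    and C: "\<And>p h. \<bar>h\<bar> \<le> 1 \<Longrightarrow> \<bar>H (p + h *\<^sub>R e) - H p\<bar> \<le> C * \<bar>h\<bar>"
    and D: "AE p in lborel. ((\<lambda>h. H (p + h *\<^sub>R e)) has_real_derivative D p) (at 0)"
  obtains D' where "integrable lborel D'" "integral\<^sup>L lborel D' = 0" "AE p in lborel. D' p = D p"
proof -
  obtain R where "\<forall>p\<in>K. norm p \<le> R" using K(1) unfolding bounded_iff by blast
  then have R: "K \<subseteq> cball 0 R" by auto
  define S where "S = cball (0::'a) (R + norm e)"
  have fS: "emeasure lborel S < \<infinity>" unfolding S_def by (rule emeasure_bounded_finite) auto
  have S[measurable]: "S \<in> sets borel" by (simp add: S_def)
  have iS: "integrable lborel (\<lambda>p. c * indicator S p :: real)" for c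
    using fS by (intro integrable_mult_right) auto
  have KS: "p \<in> S" if "p \<in> K" for p
  proof -
    have "p \<in> cball 0 R" using that R by blast
    then show ?thesis unfolding S_def using norm_ge_zero[of e] by (simp add: add_increasing2)
  qed
  have H0: "H p = 0" if "p \<notin> S" for p using KS[of p] that K(2) by blast
  have HhS: "p \<in> S" if "\<bar>h\<bar> \<le> 1" "p + h *\<^sub>R e \<in> K" for p h
  proof -
    have 1: "norm (p + h *\<^sub>R e) \<le> R" using that R by auto
    have 2: "norm (h *\<^sub>R e) \<le> norm e" using that(1) by (simp add: mult_left_le_one_le)
    have "norm p \<le> norm (p + h *\<^sub>R e) + norm (h *\<^sub>R e)"
      by (metis add_diff_cancel norm_triangle_ineq4)
    then show ?thesis using 1 2 by (simp add: S_def)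
  qed
  have iH: "integrable lborel H"
  proof (rule Bochner_Integration.integrable_bound[OF iS[of B]])
    show "AE p in lborel. norm (H p) \<le> norm (B * indicator S p)"
      using B H0 by (intro AE_I2) (auto simp: indicator_def intro: order_trans[OF _ abs_ge_self])
  qed auto
  define Q where "Q m p = real (Suc m) * (H (p + (1 / real (Suc m)) *\<^sub>R e) - H p)" for m p
  have mQ[measurable]: "Q m \<in> borel_measurable borel" for m unfolding Q_def by measurable
  have Qint: "integral\<^sup>L lborel (Q m) = 0" for m
  proof -
    have "integral\<^sup>L lborel (Q m) =
        real (Suc m) * ((\<integral>p. H (p + (1 / real (Suc m)) *\<^sub>R e) \<partial>lborel) - (\<integral>p. H p \<partial>lborel))"
      unfolding Q_def using iH
      by (subst integral_mult_right_zero, subst Bochner_Integration.integral_diff)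
         (auto intro: integral_lborel_translate(2))
    then show ?thesis using integral_lborel_translate(1)[OF H] by simp
  qed
  have Qb: "\<bar>Q m p\<bar> \<le> C * indicator S p" for m p
  proof (cases "p \<in> S")
    case True
    have "\<bar>H (p + (1 / real (Suc m)) *\<^sub>R e) - H p\<bar> \<le> C * (1 / real (Suc m))"
      using C[of "1 / real (Suc m)" p] by (simp add: divide_le_eq)
    then have "real (Suc m) * \<bar>H (p + (1 / real (Suc m)) *\<^sub>R e) - H p\<bar> \<le> real (Suc m) * (C * (1 / real (Suc m)))"
      by (intro mult_left_mono) auto
    then show ?thesis using True unfolding Q_def by (simp add: abs_mult)
  next
    case False
    have "\<bar>1 / real (Suc m)\<bar> \<le> 1" by (simp add: divide_le_eq)
    then have "p + (1 / real (Suc m)) *\<^sub>R e \<notin> K" using HhS False by blast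
    then show ?thesis using False H0 K(2) by (simp add: Q_def)
  qed
  \<comment> \<open>Where the quotients diverge, \<open>lim\<close> has an unspecified value;
    \<open>D'\<close> is Borel all the same, and such points form a null set.\<close>
  define D' where "D' p = lim (\<lambda>m. Q m p)" for p
  have mD': "D' \<in> borel_measurable borel" unfolding D'_def by (rule borel_measurable_lim_metric) (rule mQ)
  have lim: "AE p in lborel. (\<lambda>m. Q m p) \<longlonglongrightarrow> D p"
    using D
  proof eventually_elim
    fix p assume "((\<lambda>h. H (p + h *\<^sub>R e)) has_real_derivative D p) (at 0)"
    then have "((\<lambda>h. (H (p + h *\<^sub>R e) - H p) / h) \<longlongrightarrow> D p) (at 0)" by (simp add: DERIV_def)
    moreover have "filterlim (\<lambda>m. 1 / real (Suc m)) (at 0) sequentially"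
      unfolding filterlim_at using LIMSEQ_Suc[OF lim_const_over_n[of "1::real"]] by auto
    ultimately have "(\<lambda>m. (H (p + (1 / real (Suc m)) *\<^sub>R e) - H p) / (1 / real (Suc m))) \<longlonglongrightarrow> D p"
      by (rule filterlim_compose)
    then show "(\<lambda>m. Q m p) \<longlonglongrightarrow> D p" by (simp add: Q_def mult.commute)
  qed
  then have eq: "AE p in lborel. D' p = D p"
    by eventually_elim (simp add: D'_def limI)
  have lim': "AE p in lborel. (\<lambda>m. Q m p) \<longlonglongrightarrow> D' p"
    using lim eq by eventually_elim simp
  have "integrable lborel D'"
    by (rule integrable_dominated_convergence[OF _ _ iS[of C] lim']) (use mD' Qb in auto)
  moreover have "(\<lambda>m. integral\<^sup>L lborel (Q m)) \<longlonglongrightarrow> integral\<^sup>L lborel D'"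
    by (rule integral_dominated_convergence[OF _ _ iS[of C] lim']) (use mD' Qb in auto)
  ultimately show ?thesis using that eq by (simp add: Qint LIMSEQ_const_iff)
qed


section \<open>Smooth functions in a chart\<close>

lemma partial_eq:
  assumes "(f has_derivative f') (at p)"
  shows "partial i f p = f' (axis i 1)"
proof -
  have d: "((\<lambda>h. p + h *\<^sub>R axis i 1) has_derivative (\<lambda>h. h *\<^sub>R axis i 1)) (at (0::real))"
    by (auto intro!: derivative_eq_intros)
  have "((\<lambda>h. f (p + h *\<^sub>R axis i 1)) has_derivative (\<lambda>h. f' (h *\<^sub>R axis i 1))) (at 0)"
    by (rule has_derivative_compose[OF d]) (simp add: assms)
  moreover have "f' (h *\<^sub>R axis i 1) = h *\<^sub>R f' (axis i 1)" for h
    using has_derivative_linear[OF assms] linear_scale by blast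
  ultimately have "((\<lambda>h. f (p + h *\<^sub>R axis i 1)) has_vector_derivative f' (axis i 1)) (at 0)"
    by (simp add: has_vector_derivative_def)
  then show ?thesis unfolding partial_def by (rule vector_derivative_at)
qed

lemma derivative_eq_sum_partial:
  assumes "(f has_derivative f') (at p)"
  shows "f' v = (\<Sum>i\<in>UNIV. v $ i *\<^sub>R partial i f p)"
proof -
  have "linear f'" using assms by (rule has_derivative_linear)
  then have "f' (\<Sum>i\<in>UNIV. v $ i *\<^sub>R axis i 1) = (\<Sum>i\<in>UNIV. v $ i *\<^sub>R f' (axis i 1))"
    by (simp add: linear_sum linear_scale)
  moreover have "(\<Sum>i\<in>UNIV. v $ i *\<^sub>R axis i 1) = v"
    using basis_expansion[of v] by (simp add: scalar_mult_eq_scaleR)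
  ultimately show ?thesis by (simp add: partial_eq[OF assms])
qed

lemma partial_cong:
  assumes "open D" "p \<in> D" "\<And>q. q \<in> D \<Longrightarrow> f q = g q"
  shows "partial i f p = partial i g p"
proof -
  have "((\<lambda>h::real. p + h *\<^sub>R axis i 1) \<longlongrightarrow> p + 0 *\<^sub>R axis i 1) (nhds 0)"
    by (intro tendsto_intros filterlim_ident)
  then have "((\<lambda>h::real. p + h *\<^sub>R axis i 1) \<longlongrightarrow> p) (nhds 0)" by simp
  then have "\<forall>\<^sub>F h in nhds (0::real). p + h *\<^sub>R axis i 1 \<in> D"
    using assms(1,2) topological_tendstoD by blast
  then have "\<forall>\<^sub>F h in nhds (0::real). f (p + h *\<^sub>R axis i 1) = g (p + h *\<^sub>R axis i 1)"
    by eventually_elim (use assms(3) in blast)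
  then show ?thesis unfolding partial_def
    by (intro vector_derivative_cong_eq) (auto elim: eventually_mono)
qed

text \<open>The sum and product rules identify \<open>partial i\<close> only at points of
  \<open>D\<close>. This permits an induction on the order to replace the derivative by its formula
  there.\<close>

lemma Ck_on_cong:
  assumes "open D" "\<And>q. q \<in> D \<Longrightarrow> f q = g q"
  shows "Ck_on k D f \<longleftrightarrow> Ck_on k D g"
  using assms(2)
proof (induction k arbitrary: f g)
  case 0
  then show ?case by (simp cong: continuous_on_cong)
next
  case (Suc k)
  have *: "f differentiable at p \<longleftrightarrow> g differentiable at p" if "p \<in> D" for p
  proof
    show "f differentiable at p \<Longrightarrow> g differentiable at p"
      using Suc.prems assms(1) that unfolding differentiable_def
      by (metis has_derivative_transform_within_open)
    show "g differentiable at p \<Longrightarrow> f differentiable at p"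
      using Suc.prems assms(1) that unfolding differentiable_def
      by (metis has_derivative_transform_within_open)
  qed
  moreover have "Ck_on k D (partial i f) \<longleftrightarrow> Ck_on k D (partial i g)" for i
    using Suc.prems by (intro Suc.IH partial_cong[OF assms(1)]) auto
  ultimately show ?case by auto
qed

lemma Ck_on_Suc_D: "Ck_on (Suc k) D f \<Longrightarrow> Ck_on k D f"
proof (induction k arbitrary: f)
  case 0
  then show ?case
    by (auto intro!: continuous_at_imp_continuous_on differentiable_imp_continuous_within)
next
  case (Suc k)
  then show ?case by (metis Ck_on.simps(2))
qed

lemma smooth_on_partial: "smooth_on D f \<Longrightarrow> smooth_on D (partial i f)"
  unfolding smooth_on_def by (metis Ck_on.simps(2))

lemma smooth_on_differentiable: "smooth_on D f \<Longrightarrow> p \<in> D \<Longrightarrow> f differentiable (at p)"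
  unfolding smooth_on_def by (metis Ck_on.simps(2))

lemma smooth_on_continuous_on: "smooth_on D f \<Longrightarrow> continuous_on D f"
  unfolding smooth_on_def by (metis Ck_on.simps(1))

lemma partial_const [simp]: "partial i (\<lambda>p. c) = (\<lambda>p. 0)"
  by (rule ext) (simp add: partial_eq[OF has_derivative_const])

lemma Ck_on_const: "Ck_on k D (\<lambda>p. c)"
proof (induction k arbitrary: c)
  case (Suc k)
  then show ?case by simp
qed simp

lemma Ck_on_add:
  assumes "open D" "Ck_on k D f" "Ck_on k D g"
  shows "Ck_on k D (\<lambda>p. f p + g p)"
  using assms(2,3)
proof (induction k arbitrary: f g)
  case 0
  then show ?case by (simp add: continuous_on_add)
next
  case (Suc k)
  have "partial i (\<lambda>p. f p + g p) q = partial i f q + partial i g q" if "q \<in> D" for q i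
  proof -
    have "f differentiable (at q)" "g differentiable (at q)" using Suc.prems that by simp_all
    then obtain f' g' where *: "(f has_derivative f') (at q)" "(g has_derivative g') (at q)"
      unfolding differentiable_def by blast
    show ?thesis using partial_eq[OF has_derivative_add[OF *]] partial_eq[OF *(1)] partial_eq[OF *(2)] by simp
  qed
  then have "Ck_on k D (partial i (\<lambda>p. f p + g p)) \<longleftrightarrow> Ck_on k D (\<lambda>q. partial i f q + partial i g q)" for i
    using assms(1) by (intro Ck_on_cong) auto
  then show ?case using Suc by auto
qed

text \<open>The derivative of a product is a sum of two products, each with one factor
  differentiated; the other factor is lowered by one order, and the induction hypothesis applies to
  both products.\<close>

lemma Ck_on_bilinear:
  assumes "open D" "bounded_bilinear b" "Ck_on k D f" "Ck_on k D g"
  shows "Ck_on k D (\<lambda>p. b (f p) (g p))"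
  using assms(3,4)
proof (induction k arbitrary: f g)
  case 0
  then show ?case using bounded_bilinear.continuous_on[OF assms(2)] by simp
next
  case (Suc k)
  have d: "((\<lambda>p. b (f p) (g p)) has_derivative (\<lambda>h. b (f q) (g' h) + b (f' h) (g q))) (at q)"
    if "(f has_derivative f') (at q)" "(g has_derivative g') (at q)" for f' g' q
    by (rule bounded_bilinear.FDERIV[OF assms(2) that])
  have "partial i (\<lambda>p. b (f p) (g p)) q = b (f q) (partial i g q) + b (partial i f q) (g q)"
    if "q \<in> D" for q i
  proof -
    have "f differentiable (at q)" "g differentiable (at q)" using Suc.prems that by simp_all
    then obtain f' g' where *: "(f has_derivative f') (at q)" "(g has_derivative g') (at q)"
      unfolding differentiable_def by blast
    show ?thesis using partial_eq[OF d[OF *]] partial_eq[OF *(1)] partial_eq[OF *(2)] by simp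
  qed
  then have "Ck_on k D (partial i (\<lambda>p. b (f p) (g p))) \<longleftrightarrow>
      Ck_on k D (\<lambda>q. b (f q) (partial i g q) + b (partial i f q) (g q))" for i
    using assms(1) by (intro Ck_on_cong) auto
  moreover have "Ck_on k D (\<lambda>q. b (f q) (partial i g q) + b (partial i f q) (g q))" for i
    using Suc.prems Ck_on_Suc_D[OF Suc.prems(1)] Ck_on_Suc_D[OF Suc.prems(2)]
    by (intro Ck_on_add assms(1) Suc.IH) auto
  moreover have "(\<lambda>p. b (f p) (g p)) differentiable (at q)" if "q \<in> D" for q
  proof -
    have "f differentiable (at q)" "g differentiable (at q)" using Suc.prems that by simp_all
    then obtain f' g' where "(f has_derivative f') (at q)" "(g has_derivative g') (at q)"
      unfolding differentiable_def by blast
    then show ?thesis by (rule differentiableI[OF d])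
  qed
  ultimately show ?case by auto
qed

text \<open>A linear map is read as a bilinear one with first factor 1, so that linear images
  inherit smoothness from the product rule.\<close>

lemma bounded_bilinear_apply_linear:
  assumes "bounded_linear L"
  shows "bounded_bilinear (\<lambda>(c::real) x. c *\<^sub>R L x)"
  using bounded_bilinear.comp[OF bounded_bilinear_scaleR bounded_linear_ident assms] .

lemma Ck_on_linear:
  assumes "open D" "bounded_linear L" "Ck_on k D f"
  shows "Ck_on k D (\<lambda>p. L (f p))"
  using Ck_on_bilinear[OF assms(1) bounded_bilinear_apply_linear[OF assms(2)] Ck_on_const[of k D 1] assms(3)]
  by simp


section \<open>Functions of class C^k on the real line\<close>

fun Ck_real :: "nat \<Rightarrow> (real \<Rightarrow> real) \<Rightarrow> bool" where
  "Ck_real 0 g \<longleftrightarrow> continuous_on UNIV g"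
| "Ck_real (Suc k) g \<longleftrightarrow> (\<exists>g'. (\<forall>s. (g has_real_derivative g' s) (at s)) \<and> Ck_real k g')"

lemma Ck_real_SucI:
  "(\<And>s. (g has_real_derivative g' s) (at s)) \<Longrightarrow> Ck_real k g' \<Longrightarrow> Ck_real (Suc k) g"
  by auto

lemma Ck_real_Suc_D: "Ck_real (Suc k) g \<Longrightarrow> Ck_real k g"
proof (induction k arbitrary: g)
  case 0
  then show ?case by (auto intro!: continuous_at_imp_continuous_on intro: DERIV_isCont)
next
  case (Suc k)
  then show ?case by (metis Ck_real.simps(2))
qed

lemma Ck_real_const: "Ck_real k (\<lambda>s. c)"
proof (induction k arbitrary: c)
  case (Suc k)
  show ?case by (rule Ck_real_SucI[OF DERIV_const Suc.IH])
qed simp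

lemma Ck_real_add: "Ck_real k f \<Longrightarrow> Ck_real k g \<Longrightarrow> Ck_real k (\<lambda>s. f s + g s)"
proof (induction k arbitrary: f g)
  case 0
  then show ?case by (simp add: continuous_on_add)
next
  case (Suc k)
  then show ?case by (fastforce intro!: derivative_intros)
qed

lemma Ck_real_mult: "Ck_real k f \<Longrightarrow> Ck_real k g \<Longrightarrow> Ck_real k (\<lambda>s. f s * g s)"
proof (induction k arbitrary: f g)
  case 0
  then show ?case by (simp add: continuous_on_mult)
next
  case (Suc k)
  obtain f' g' where 1: "\<And>s. (f has_real_derivative f' s) (at s)" "Ck_real k f'"
    "\<And>s. (g has_real_derivative g' s) (at s)" "Ck_real k g'" using Suc.prems by auto
  have "((\<lambda>s. f s * g s) has_real_derivative (f' s * g s + g' s * f s)) (at s)" for s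
    using 1 by (intro DERIV_mult) auto
  moreover have "Ck_real k (\<lambda>s. f' s * g s + g' s * f s)"
    using 1 Ck_real_Suc_D[OF Suc.prems(1)] Ck_real_Suc_D[OF Suc.prems(2)]
    by (intro Ck_real_add Suc.IH) auto
  ultimately show ?case by (rule Ck_real_SucI)
qed

lemma Ck_real_power: "Ck_real k f \<Longrightarrow> Ck_real k (\<lambda>s. f s ^ m)"
  by (induction m) (auto intro: Ck_real_const Ck_real_mult)

text \<open>The derivative of the reciprocal contains the reciprocal again, one order lower, and the
  induction hypothesis supplies it. The square root and the pair sine and cosine below are treated
  in the same way.\<close>

lemma Ck_real_inverse: "Ck_real k f \<Longrightarrow> (\<And>s. f s \<noteq> 0) \<Longrightarrow> Ck_real k (\<lambda>s. inverse (f s))"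
proof (induction k arbitrary: f)
  case 0
  then show ?case by (simp add: continuous_on_inverse)
next
  case (Suc k)
  obtain f' where 1: "\<And>s. (f has_real_derivative f' s) (at s)" "Ck_real k f'" using Suc.prems by auto
  have "((\<lambda>s. inverse (f s)) has_real_derivative (- 1 * f' s * inverse (f s) * inverse (f s))) (at s)" for s
    using DERIV_inverse'[OF 1(1)[of s] Suc.prems(2)] by (simp add: mult_ac)
  moreover have "Ck_real k (\<lambda>s. inverse (f s))"
    using Suc Ck_real_Suc_D by blast
  then have "Ck_real k (\<lambda>s. - 1 * f' s * inverse (f s) * inverse (f s))"
    by (intro Ck_real_mult Ck_real_const 1)
  ultimately show ?case by (rule Ck_real_SucI)
qed

lemma Ck_real_sqrt: "Ck_real k f \<Longrightarrow> (\<And>s. f s > 0) \<Longrightarrow> Ck_real k (\<lambda>s. sqrt (f s))"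
proof (induction k arbitrary: f)
  case 0
  then show ?case by (simp add: continuous_on_real_sqrt)
next
  case (Suc k)
  obtain f' where 1: "\<And>s. (f has_real_derivative f' s) (at s)" "Ck_real k f'" using Suc.prems by auto
  have "((\<lambda>s. sqrt (f s)) has_real_derivative (inverse (sqrt (f s)) * inverse 2 * f' s)) (at s)" for s
    using DERIV_chain2[OF DERIV_real_sqrt[OF Suc.prems(2)] 1(1)] unfolding divide_inverse .
  moreover have "Ck_real k (\<lambda>s. sqrt (f s))"
    using Suc Ck_real_Suc_D by blast
  then have "Ck_real k (\<lambda>s. inverse (sqrt (f s)) * inverse 2 * f' s)"
    using Suc.prems(2) by (intro Ck_real_mult Ck_real_const 1 Ck_real_inverse) (simp_all add: less_imp_neq[THEN not_sym])
  ultimately show ?case by (rule Ck_real_SucI)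
qed

lemma Ck_real_sin_cos:
  "Ck_real k f \<Longrightarrow> Ck_real k (\<lambda>s. sin (f s)) \<and> Ck_real k (\<lambda>s. cos (f s))"
proof (induction k arbitrary: f)
  case 0
  then show ?case by (simp add: continuous_on_sin continuous_on_cos)
next
  case (Suc k)
  obtain f' where 1: "\<And>s. (f has_real_derivative f' s) (at s)" "Ck_real k f'" using Suc.prems by auto
  have IH: "Ck_real k (\<lambda>s. sin (f s))" "Ck_real k (\<lambda>s. cos (f s))"
    using Suc Ck_real_Suc_D by blast+
  have "((\<lambda>s. sin (f s)) has_real_derivative (cos (f s) * f' s)) (at s)" for s
    using 1 by (auto intro!: derivative_eq_intros)
  moreover have "Ck_real k (\<lambda>s. cos (f s) * f' s)" by (intro Ck_real_mult IH 1)
  ultimately have 2: "Ck_real (Suc k) (\<lambda>s. sin (f s))" by (rule Ck_real_SucI)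
  have "((\<lambda>s. cos (f s)) has_real_derivative (- 1 * sin (f s) * f' s)) (at s)" for s
    using 1 by (auto intro!: derivative_eq_intros)
  moreover have "Ck_real k (\<lambda>s. - 1 * sin (f s) * f' s)" by (intro Ck_real_mult Ck_real_const IH 1)
  ultimately have "Ck_real (Suc k) (\<lambda>s. cos (f s))" by (rule Ck_real_SucI)
  then show ?case using 2 by blast
qed

text \<open>With a linear inner function, each partial derivative is a constant times
  \<open>g'\<close> composed with the same \<open>l\<close>, so the induction closes without a
  higher-order chain rule.\<close>

lemma Ck_on_real_compose:
  assumes "open D" "bounded_linear (l :: real^'m \<Rightarrow> real)" "Ck_real k g"
  shows "Ck_on k D (\<lambda>p. g (l p))"
  using assms(3)
proof (induction k arbitrary: g)
  case 0
  have "continuous_on D l" using assms(2) by (rule linear_continuous_on)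
  then show ?case using 0 by (auto intro: continuous_on_compose2)
next
  case (Suc k)
  obtain g' where 1: "\<And>s. (g has_real_derivative g' s) (at s)" "Ck_real k g'" using Suc.prems by auto
  have d: "((\<lambda>p. g (l p)) has_derivative (\<lambda>h. l h * g' (l p))) (at p)" for p
  proof -
    have "((\<lambda>p. g (l p)) has_derivative (\<lambda>h. g' (l p) * l h)) (at p)"
      by (rule has_derivative_compose[OF bounded_linear_imp_has_derivative[OF assms(2)]])
         (use 1(1) in \<open>simp add: has_field_derivative_def\<close>)
    then show ?thesis by (simp add: mult.commute)
  qed
  have "partial i (\<lambda>p. g (l p)) = (\<lambda>p. l (axis i 1) *\<^sub>R g' (l p))" for i
    by (rule ext) (simp add: partial_eq[OF d])
  moreover have "Ck_on k D (\<lambda>p. l (axis i 1) *\<^sub>R g' (l p))" for i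
    by (intro Ck_on_bilinear[OF assms(1) bounded_bilinear_scaleR] Ck_on_const Suc.IH 1)
  ultimately show ?case using d by (auto simp: differentiable_def)
qed

section \<open>Orbit and profile coordinates of the chart\<close>

lemma bounded_linear_par_t: "bounded_linear par_t"
  by (rule linear_conv_bounded_linear[THEN iffD1], rule linearI) (auto simp: par_t_def vec_eq_iff)

lemma bounded_linear_par_s: "bounded_linear par_s"
  unfolding par_s_def by (rule bounded_linear_vec_nth)

lemma par_t_axis [simp]: "par_t (axis (Some i) c) = axis i c" "par_t (axis None c) = 0"
  by (auto simp: par_t_def axis_def vec_eq_iff)

lemma par_s_axis [simp]: "par_s (axis (Some i) c) = 0" "par_s (axis None c) = c"
  by (auto simp: par_s_def axis_def)

lemma par_t_add [simp]: "par_t (p + q) = par_t p + par_t q"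
  and par_t_scaleR [simp]: "par_t (c *\<^sub>R p) = c *\<^sub>R par_t p"
  and par_s_add [simp]: "par_s (p + q) = par_s p + par_s q"
  and par_s_scaleR [simp]: "par_s (c *\<^sub>R p) = c * par_s p"
  by (auto simp: par_t_def par_s_def vec_eq_iff)

lemma open_catenoid_domain: "open U \<Longrightarrow> open (catenoid_domain U)"
  unfolding catenoid_domain_def vimage_def[symmetric]
  by (rule continuous_open_vimage) (auto intro: linear_continuous_at bounded_linear_par_t)

lemma partial_comp_par_t:
  "partial (Some i) (\<lambda>p. f (par_t p)) = (\<lambda>p. partial i f (par_t p))"
  "partial None (\<lambda>p. f (par_t p)) = (\<lambda>p. 0)"
  by (auto simp: partial_def fun_eq_iff)

lemma Ck_on_comp_par_t:
  assumes "Ck_on k U f"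
  shows "Ck_on k (catenoid_domain U) (\<lambda>p. f (par_t p))"
  using assms
proof (induction k arbitrary: f)
  case 0
  then show ?case
    by (auto simp: catenoid_domain_def intro!: continuous_on_compose2[of U f] linear_continuous_on[OF bounded_linear_par_t])
next
  case (Suc k)
  have "(\<lambda>p. f (par_t p)) differentiable (at p)" if "p \<in> catenoid_domain U" for p :: "real^'a option"
  proof -
    have "f differentiable (at (par_t p))" using Suc.prems that by (simp add: catenoid_domain_def)
    then obtain f' where f': "(f has_derivative f') (at (par_t p))" unfolding differentiable_def by blast
    show ?thesis
      by (rule differentiableI,
          rule has_derivative_compose[OF bounded_linear_imp_has_derivative[OF bounded_linear_par_t] f'])
  qed
  moreover have "Ck_on k (catenoid_domain U) (partial i (\<lambda>p. f (par_t p)))" for i :: "'a option"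
    using Suc.prems Suc.IH[of "partial (the i) f"] by (cases i) (simp_all add: partial_comp_par_t Ck_on_const)
  ultimately show ?case by auto
qed


section \<open>The profile curve\<close>

locale catenoid_profile_curve =
  fixes n :: nat and t :: real and x :: "real \<Rightarrow> real"
  assumes n: "n \<ge> 2" and t: "1 < t" and profile: "catenoid_profile n t x"
begin

definition x' :: "real \<Rightarrow> real" where "x' = deriv x"

text \<open>\<open>b s / x s\<close> is the principal curvature along the orbits; \<open>b\<^sup>2 = x\<^sup>2 - x'\<^sup>2 - 1\<close>.\<close>

definition b :: "real \<Rightarrow> real" where "b s = catenoid_const n t / x s ^ (n - 1)"
definition x'' :: "real \<Rightarrow> real" where "x'' s = x s + (real n - 1) * (b s)\<^sup>2 / x s"
definition r :: "real \<Rightarrow> real" where "r s = sqrt ((x s)\<^sup>2 - 1)"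
definition \<theta> :: "real \<Rightarrow> real" where "\<theta> = catenoid_angle x"

lemma x_ge: "x s \<ge> t" and x_gt_1: "x s > 1" and x_pos [simp]: "x s > 0"
proof -
  show "x s \<ge> t" using profile by (simp add: catenoid_profile_def)
  then show "x s > 1" "x s > 0" using t by auto
qed

lemma x_nonzero [simp]: "x s \<noteq> 0" using x_pos[of s] by linarith

lemma b_pos: "b s > 0"
proof -
  have "t\<^sup>2 > 1" using t by (simp add: one_less_power)
  then show ?thesis using t by (simp add: b_def catenoid_const_def)
qed

lemma b_sq: "(b s)\<^sup>2 = (catenoid_const n t)\<^sup>2 / x s ^ (2 * n - 2)"
proof -
  have "(x s ^ (n - 1))\<^sup>2 = x s ^ (2 * n - 2)"
    by (simp only: power_even_eq[symmetric] right_diff_distrib' mult_1_right)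
  then show ?thesis by (simp add: b_def power_divide)
qed

lemma DERIV_x: "(x has_real_derivative x' s) (at s)"
  using profile unfolding catenoid_profile_def x'_def
  by (auto intro: DERIV_deriv_iff_real_differentiable[THEN iffD2])

lemma DERIV_x': "(x' has_real_derivative x'' s) (at s)"
proof -
  have "x s powi (1 - 2 * int n) = 1 / x s ^ (2 * n - 1)"
    using n by (simp add: power_int_def nat_diff_distrib nat_mult_distrib divide_inverse power_inverse)
  also have "\<dots> = 1 / (x s ^ (2 * n - 2) * x s)"
    using n by (simp add: power_Suc2[symmetric] Suc_diff_Suc numeral_2_eq_2 del: power_Suc power_Suc2)
  finally have "x s + (real n - 1) * (catenoid_const n t)\<^sup>2 * x s powi (1 - 2 * int n) = x'' s"
    unfolding x''_def b_sq by simp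
  then show ?thesis using profile unfolding catenoid_profile_def x'_def by metis
qed

text \<open>At \<open>x = t\<close> this is an equality, by the choice of
  \<open>catenoid_const\<close>, and \<open>x ^ (2 * n - 2) * (x\<^sup>2 - 1)\<close> grows with
  \<open>x\<close>. It makes the radicand of the first-order equation nonnegative, so that this
  equation can be squared.\<close>

lemma b_sq_le: "(b s)\<^sup>2 \<le> (x s)\<^sup>2 - 1"
proof -
  have "(catenoid_const n t)\<^sup>2 = t ^ (2 * n - 2) * (t\<^sup>2 - 1)"
  proof -
    have "t\<^sup>2 > 1" using t by (simp add: one_less_power)
    moreover have "(t ^ (n - 1))\<^sup>2 = t ^ (2 * n - 2)"
      by (simp only: power_even_eq[symmetric] right_diff_distrib' mult_1_right)
    ultimately show ?thesis by (simp add: catenoid_const_def power_mult_distrib)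
  qed
  also have "\<dots> \<le> x s ^ (2 * n - 2) * ((x s)\<^sup>2 - 1)"
  proof (intro mult_mono)
    show "t ^ (2 * n - 2) \<le> x s ^ (2 * n - 2)" using x_ge t by (intro power_mono) auto
    show "t\<^sup>2 - 1 \<le> (x s)\<^sup>2 - 1" using x_ge[of s] t by (simp add: power_mono)
    show "0 \<le> t\<^sup>2 - 1" using t by (simp add: one_le_power)
  qed (use less_imp_le[OF x_pos[of s]] in auto)
  finally show ?thesis unfolding b_sq by (simp add: divide_le_eq mult.commute)
qed

text \<open>The first-order equation is given for \<open>s \<ge> 0\<close>. Since \<open>x\<close>
  is even, \<open>x'\<close> is odd and its square is even, which carries the identity over to
  negative \<open>s\<close>.\<close>

lemma x'_sq: "(x' s)\<^sup>2 = (x s)\<^sup>2 - 1 - (b s)\<^sup>2"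
proof -
  have nonneg: "(x' s)\<^sup>2 = (x s)\<^sup>2 - 1 - (b s)\<^sup>2" if "s \<ge> 0" for s
  proof -
    have "x s powi (2 * (1 - int n)) = 1 / x s ^ (2 * n - 2)"
      using n by (simp add: power_int_def nat_diff_distrib nat_mult_distrib divide_inverse power_inverse right_diff_distrib)
    then have "x' s = sqrt ((x s)\<^sup>2 - 1 - (b s)\<^sup>2)"
      using profile that unfolding catenoid_profile_def x'_def b_sq by simp
    then show ?thesis using b_sq_le[of s] by simp
  qed
  show ?thesis
  proof (cases "s \<ge> 0")
    case False
    have ev: "x (- s) = x s" for s using profile by (simp add: catenoid_profile_def)
    have "((\<lambda>s. x (- s)) has_real_derivative x' (- s) * (- 1)) (at s)"
      by (rule DERIV_chain2[OF DERIV_x]) (auto intro!: derivative_eq_intros)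
    then have "x' s = - x' (- s)" using DERIV_unique[OF DERIV_x] by (simp add: ev)
    then show ?thesis using nonneg[of "- s"] False ev by (simp add: b_def)
  qed (use nonneg in auto)
qed

lemma r_pos: "r s > 0" and r_sq: "(r s)\<^sup>2 = (x s)\<^sup>2 - 1"
proof -
  have "(x s)\<^sup>2 > 1" using x_gt_1[of s] by (simp add: one_less_power)
  then show "r s > 0" "(r s)\<^sup>2 = (x s)\<^sup>2 - 1" by (auto simp: r_def)
qed

lemma DERIV_b: "(b has_real_derivative - (real n - 1) * b s * x' s / x s) (at s)"
proof -
  define m where "m = n - 2"
  have m: "n - 1 = Suc m" "real n - 1 = 1 + real m" using n by (simp_all add: m_def)
  have "((\<lambda>s. catenoid_const n t / x s ^ Suc m) has_real_derivative
      (0 * x s ^ Suc m - catenoid_const n t * ((1 + real m) * (x' s * x s ^ m))) / (x s ^ Suc m * x s ^ Suc m)) (at s)"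
    by (intro DERIV_divide DERIV_const DERIV_power_Suc[OF DERIV_x, unfolded of_nat_Suc]) simp
  also have "(0 * x s ^ Suc m - catenoid_const n t * ((1 + real m) * (x' s * x s ^ m))) / (x s ^ Suc m * x s ^ Suc m)
      = - (real n - 1) * (catenoid_const n t / x s ^ Suc m) * x' s / x s"
    unfolding m(2) by (simp add: divide_simps) (simp add: algebra_simps)
  finally show ?thesis unfolding b_def[abs_def] m(1) .
qed

lemma DERIV_r: "(r has_real_derivative x s * x' s / r s) (at s)"
proof -
  have p: "(x s)\<^sup>2 - 1 > 0" using x_gt_1[of s] by (simp add: one_less_power)
  show ?thesis
    unfolding r_def[abs_def] using p
    by (auto intro!: derivative_eq_intros DERIV_x simp: divide_simps)
qed

text \<open>By \<open>x'_sq\<close> the radicand in the angle is \<open>b\<^sup>2\<close> with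
  \<open>b > 0\<close>, so the integrand is the continuous function \<open>b / r\<^sup>2\<close> and
  the fundamental theorem applies.\<close>

lemma DERIV_theta: "(\<theta> has_real_derivative b s / (r s)\<^sup>2) (at s)"
proof -
  have cont: "continuous_on A (\<lambda>s. b s / (r s)\<^sup>2)" for A
    using r_pos by (intro continuous_intros continuous_at_imp_continuous_on ballI
        DERIV_isCont[OF DERIV_b] DERIV_isCont[OF DERIV_r]) (auto simp: less_imp_neq[THEN not_sym])
  have integrand: "sqrt ((x \<tau>)\<^sup>2 - (deriv x \<tau>)\<^sup>2 - 1) / ((x \<tau>)\<^sup>2 - 1) = b \<tau> / (r \<tau>)\<^sup>2" for \<tau>
    using x'_sq[of \<tau>] b_pos[of \<tau>] by (simp add: r_sq x'_def real_sqrt_unique)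
  \<comment> \<open>The summand 1 puts \<open>s\<close> in the interior of the interval, so the
    derivative within the interval is two-sided.\<close>
  define B where "B = \<bar>s\<bar> + 1"
  have "((\<lambda>u. LBINT y=0..u. b y / (r y)\<^sup>2) has_vector_derivative b s / (r s)\<^sup>2) (at s within {-B..B})"
    unfolding zero_ereal_def
    by (rule interval_integral_FTC2[OF _ _ cont]) (auto simp: B_def)
  then have "((\<lambda>u. LBINT y=0..u. b y / (r y)\<^sup>2) has_vector_derivative b s / (r s)\<^sup>2) (at s)"
    by (subst (asm) at_within_interior) (auto simp: B_def)
  then show ?thesis
    by (simp add: \<theta>_def catenoid_angle_def[abs_def] integrand has_real_derivative_iff_has_vector_derivative)
qed

section \<open>The plane components of the profile curve and its normal\<close>

definition y :: "real \<Rightarrow> real" where "y s = r s * sin (\<theta> s)"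
definition z :: "real \<Rightarrow> real" where "z s = r s * cos (\<theta> s)"

text \<open>The components of \<open>(y', z')\<close> and \<open>(y'', z'')\<close> in the moving frame
  \<open>(sin \<theta>, cos \<theta>)\<close>, \<open>(cos \<theta>, - sin \<theta>)\<close>.\<close>

definition rad1 :: "real \<Rightarrow> real" where "rad1 s = x s * x' s / r s"
definition tan1 :: "real \<Rightarrow> real" where "tan1 s = b s / r s"
definition rad2 :: "real \<Rightarrow> real" where
  "rad2 s = ((x' s)\<^sup>2 + x s * x'' s) / r s - (x s * x' s)\<^sup>2 / r s ^ 3 - (b s)\<^sup>2 / r s ^ 3"
definition tan2 :: "real \<Rightarrow> real" where
  "tan2 s = - (real n - 1) * b s * x' s / (x s * r s)"

definition y' :: "real \<Rightarrow> real" where "y' s = rad1 s * sin (\<theta> s) + tan1 s * cos (\<theta> s)"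
definition z' :: "real \<Rightarrow> real" where "z' s = rad1 s * cos (\<theta> s) - tan1 s * sin (\<theta> s)"
definition y'' :: "real \<Rightarrow> real" where "y'' s = rad2 s * sin (\<theta> s) + tan2 s * cos (\<theta> s)"
definition z'' :: "real \<Rightarrow> real" where "z'' s = rad2 s * cos (\<theta> s) - tan2 s * sin (\<theta> s)"

lemma r_nonzero [simp]: "r s \<noteq> 0" using r_pos[of s] by simp

lemma DERIV_y: "(y has_real_derivative y' s) (at s)"
proof -
  have "((\<lambda>s. r s * sin (\<theta> s)) has_real_derivative
      x s * x' s / r s * sin (\<theta> s) + cos (\<theta> s) * (b s / (r s)\<^sup>2) * r s) (at s)"
    by (intro DERIV_mult DERIV_r DERIV_chain2[OF DERIV_sin DERIV_theta])
  then show ?thesis by (simp add: y_def[abs_def] y'_def rad1_def tan1_def power2_eq_square mult.commute)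
qed

lemma DERIV_z: "(z has_real_derivative z' s) (at s)"
proof -
  have "((\<lambda>s. r s * cos (\<theta> s)) has_real_derivative
      x s * x' s / r s * cos (\<theta> s) + - sin (\<theta> s) * (b s / (r s)\<^sup>2) * r s) (at s)"
    by (intro DERIV_mult DERIV_r DERIV_chain2[OF DERIV_cos DERIV_theta])
  then show ?thesis by (simp add: z_def[abs_def] z'_def rad1_def tan1_def power2_eq_square mult.commute)
qed

text \<open>\<open>rad2\<close> is the radial component of the full second derivative and already
  contains the centripetal term \<open>- b\<^sup>2 / r ^ 3\<close> from the turning frame. The
  derivative of the coefficient \<open>rad1\<close> alone exceeds it by this term;
  \<open>tan2\<close> and \<open>tan1\<close> differ in the same way.\<close>

lemma DERIV_rad1: "(rad1 has_real_derivative rad2 s + (b s)\<^sup>2 / r s ^ 3) (at s)"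
  unfolding rad1_def[abs_def] rad2_def
  by (auto intro!: derivative_eq_intros DERIV_x DERIV_x' DERIV_r simp: field_simps power2_eq_square power3_eq_cube)

lemma DERIV_tan1: "(tan1 has_real_derivative tan2 s - rad1 s * b s / (r s)\<^sup>2) (at s)"
  unfolding tan1_def[abs_def] tan2_def rad1_def
  by (auto intro!: derivative_eq_intros DERIV_b DERIV_r simp: field_simps power2_eq_square)

lemma DERIV_y': "(y' has_real_derivative y'' s) (at s)"
proof -
  have "((\<lambda>s. rad1 s * sin (\<theta> s) + tan1 s * cos (\<theta> s)) has_real_derivative
     ((rad2 s + (b s)\<^sup>2 / r s ^ 3) * sin (\<theta> s) + cos (\<theta> s) * (b s / (r s)\<^sup>2) * rad1 s) +
     ((tan2 s - rad1 s * b s / (r s)\<^sup>2) * cos (\<theta> s) + - sin (\<theta> s) * (b s / (r s)\<^sup>2) * tan1 s)) (at s)"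
    by (intro DERIV_add DERIV_mult DERIV_rad1 DERIV_tan1 DERIV_chain2[OF DERIV_sin DERIV_theta]
        DERIV_chain2[OF DERIV_cos DERIV_theta])
  moreover have "tan1 s * (b s / (r s)\<^sup>2) = (b s)\<^sup>2 / r s ^ 3"
    by (simp add: tan1_def power2_eq_square power3_eq_cube)
  ultimately show ?thesis
    unfolding y'_def[abs_def] y''_def by (elim DERIV_cong) (simp add: algebra_simps flip: times_divide_eq_right)
qed

lemma DERIV_z': "(z' has_real_derivative z'' s) (at s)"
proof -
  have "((\<lambda>s. rad1 s * cos (\<theta> s) - tan1 s * sin (\<theta> s)) has_real_derivative
     ((rad2 s + (b s)\<^sup>2 / r s ^ 3) * cos (\<theta> s) + - sin (\<theta> s) * (b s / (r s)\<^sup>2) * rad1 s) -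
     ((tan2 s - rad1 s * b s / (r s)\<^sup>2) * sin (\<theta> s) + cos (\<theta> s) * (b s / (r s)\<^sup>2) * tan1 s)) (at s)"
    by (intro DERIV_diff DERIV_mult DERIV_rad1 DERIV_tan1 DERIV_chain2[OF DERIV_sin DERIV_theta]
        DERIV_chain2[OF DERIV_cos DERIV_theta])
  moreover have "tan1 s * (b s / (r s)\<^sup>2) = (b s)\<^sup>2 / r s ^ 3"
    by (simp add: tan1_def power2_eq_square power3_eq_cube)
  ultimately show ?thesis
    unfolding z'_def[abs_def] z''_def by (elim DERIV_cong) (simp add: algebra_simps flip: times_divide_eq_right)
qed

lemma hyperboloid_yz: "(y s)\<^sup>2 + (z s)\<^sup>2 = (x s)\<^sup>2 - 1"
proof -
  have "(y s)\<^sup>2 + (z s)\<^sup>2 = (r s)\<^sup>2 * ((sin (\<theta> s))\<^sup>2 + (cos (\<theta> s))\<^sup>2)"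
    unfolding y_def z_def by algebra
  then show ?thesis by (simp add: r_sq)
qed

text \<open>The moving frame is orthonormal, so inner products can be computed from its
  coefficients.\<close>

lemma rotate_inner:
  fixes A B C D \<alpha> :: real
  shows "(A * sin \<alpha> + B * cos \<alpha>) * (C * sin \<alpha> + D * cos \<alpha>) +
     (A * cos \<alpha> - B * sin \<alpha>) * (C * cos \<alpha> - D * sin \<alpha>) = A * C + B * D"
proof -
  have "(A * sin \<alpha> + B * cos \<alpha>) * (C * sin \<alpha> + D * cos \<alpha>) +
     (A * cos \<alpha> - B * sin \<alpha>) * (C * cos \<alpha> - D * sin \<alpha>) =
     (A * C + B * D) * ((sin \<alpha>)\<^sup>2 + (cos \<alpha>)\<^sup>2)"
    by algebra
  then show ?thesis by simp
qed

text \<open>In the frame the plane part has squared length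
  \<open>(x\<^sup>2 x'\<^sup>2 + b\<^sup>2) / r\<^sup>2\<close>. Since
  \<open>b\<^sup>2 = r\<^sup>2 - x'\<^sup>2\<close>, the numerator is
  \<open>r\<^sup>2 (1 + x'\<^sup>2)\<close>.\<close>

lemma unit_speed: "- (x' s)\<^sup>2 + (y' s)\<^sup>2 + (z' s)\<^sup>2 = 1"
proof -
  have "(y' s)\<^sup>2 + (z' s)\<^sup>2 = (rad1 s)\<^sup>2 + (tan1 s)\<^sup>2"
    using rotate_inner[of "rad1 s" "\<theta> s" "tan1 s" "rad1 s" "tan1 s"]
    by (simp add: y'_def z'_def power2_eq_square)
  also have "\<dots> = ((x s)\<^sup>2 * (x' s)\<^sup>2 + (b s)\<^sup>2) / (r s)\<^sup>2"
    by (simp add: rad1_def tan1_def power_divide power_mult_distrib add_divide_distrib)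
  also have "(x s)\<^sup>2 * (x' s)\<^sup>2 + (b s)\<^sup>2 = (r s)\<^sup>2 * (1 + (x' s)\<^sup>2)"
    unfolding r_sq using x'_sq[of s] by (simp add: algebra_simps)
  finally show ?thesis by simp
qed

text \<open>Minimality: the curvature of the profile curve cancels the \<open>n - 1\<close> equal curvatures
  \<open>- m / x\<close> of the orbits.\<close>

lemma normal_components:
  assumes 1: "- m * x s + c * y s + d * z s = 0" and 2: "- m * x' s + c * y' s + d * z' s = 0"
    and 3: "- m\<^sup>2 + c\<^sup>2 + d\<^sup>2 = 1"
  shows "m\<^sup>2 = (b s)\<^sup>2" and "- m * x'' s + c * y'' s + d * z'' s = (real n - 1) * m / x s"
proof -
  define A where "A = c * sin (\<theta> s) + d * cos (\<theta> s)"
  define B where "B = c * cos (\<theta> s) - d * sin (\<theta> s)"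
  have "c * y s + d * z s = r s * A" by (simp add: y_def z_def A_def algebra_simps)
  then have A: "A = m * x s / r s" using 1 by (simp add: field_simps)
  have "c * y' s + d * z' s = rad1 s * A + tan1 s * B"
    by (simp add: y'_def z'_def A_def B_def algebra_simps)
  then have "m * x' s = x s * x' s / r s * (m * x s / r s) + b s / r s * B"
    using 2 A by (simp add: rad1_def tan1_def)
  then have "m * x' s * (r s)\<^sup>2 = m * x' s * (x s)\<^sup>2 + b s * r s * B"
    by (simp add: field_simps power2_eq_square)
  then have rB: "b s * r s * B = - m * x' s" unfolding r_sq by (simp add: algebra_simps)
  \<comment> \<open>\<open>b\<close> never vanishes, whereas \<open>x'\<close> is zero at
    \<open>s = 0\<close>; hence \<open>B\<close> is expressed through \<open>m\<close> by dividing
    by \<open>b\<close>.\<close>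
  have bnz: "b s \<noteq> 0" using b_pos[of s] by simp
  have B: "B = - m * x' s / (b s * r s)" using rB bnz by (simp add: field_simps)
  have "A\<^sup>2 + B\<^sup>2 = (c\<^sup>2 + d\<^sup>2) * ((sin (\<theta> s))\<^sup>2 + (cos (\<theta> s))\<^sup>2)"
    unfolding A_def B_def by algebra
  then have AB: "A\<^sup>2 + B\<^sup>2 = 1 + m\<^sup>2" using 3 by simp
  have "A\<^sup>2 + B\<^sup>2 = m\<^sup>2 * ((x s)\<^sup>2 * (b s)\<^sup>2 + (x' s)\<^sup>2) / ((b s)\<^sup>2 * (r s)\<^sup>2)"
    unfolding A B using bnz by (simp add: field_simps power2_eq_square)
  also have "(x s)\<^sup>2 * (b s)\<^sup>2 + (x' s)\<^sup>2 = (r s)\<^sup>2 * (1 + (b s)\<^sup>2)"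
    unfolding r_sq using x'_sq[of s] by (simp add: algebra_simps)
  finally have "A\<^sup>2 + B\<^sup>2 = m\<^sup>2 * (1 + (b s)\<^sup>2) / (b s)\<^sup>2" by simp
  then have "m\<^sup>2 * (1 + (b s)\<^sup>2) = (1 + m\<^sup>2) * (b s)\<^sup>2" using AB bnz by (simp add: field_simps)
  then show "m\<^sup>2 = (b s)\<^sup>2" by (simp add: algebra_simps)
  have r3: "r s ^ 3 = r s * (r s)\<^sup>2" by (simp add: power3_eq_cube power2_eq_square)
  have "(x s * x' s)\<^sup>2 + (b s)\<^sup>2 = (r s)\<^sup>2 * (1 + (x' s)\<^sup>2)"
    unfolding r_sq using x'_sq[of s] by (simp add: algebra_simps power_mult_distrib)
  then have "(x s * x' s)\<^sup>2 / r s ^ 3 + (b s)\<^sup>2 / r s ^ 3 = (1 + (x' s)\<^sup>2) / r s"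
    unfolding r3 add_divide_distrib[symmetric] by simp
  then have rad2: "rad2 s = (x s * x'' s - 1) / r s"
    unfolding rad2_def by (simp add: diff_divide_distrib add_divide_distrib)
  have "c * y'' s + d * z'' s = rad2 s * A + tan2 s * B"
    by (simp add: y''_def z''_def A_def B_def algebra_simps)
  also have "\<dots> = m * (x s * x'' s - 1) * x s / (r s)\<^sup>2 + m * (real n - 1) * (x' s)\<^sup>2 / (x s * (r s)\<^sup>2)"
    unfolding A B rad2 tan2_def using bnz by (simp add: field_simps power2_eq_square)
  finally have E: "c * y'' s + d * z'' s = \<dots>" .
  \<comment> \<open>Denominators are cleared first. The profile equation makes
    \<open>x'' x - x\<^sup>2\<close> equal to \<open>(n - 1) b\<^sup>2\<close>, and adding
    \<open>(n - 1) x'\<^sup>2\<close> gives \<open>(n - 1) r\<^sup>2\<close> by the first integral,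
    which cancels the factor \<open>r\<^sup>2\<close>.\<close>
  have "(c * y'' s + d * z'' s) * (x s * (r s)\<^sup>2) =
      m * (x s * x'' s - 1) * (x s * x s) + m * (real n - 1) * (x' s)\<^sup>2"
    unfolding E distrib_right by simp
  then have "(- m * x'' s + c * y'' s + d * z'' s) * (x s * (r s)\<^sup>2) =
      - m * x'' s * x s * (r s)\<^sup>2 + m * (x s * x'' s - 1) * (x s)\<^sup>2 + m * (real n - 1) * (x' s)\<^sup>2"
    by (simp add: algebra_simps power2_eq_square)
  also have "\<dots> = m * (x'' s * x s - (x s)\<^sup>2 + (real n - 1) * (x' s)\<^sup>2)"
    unfolding r_sq by (simp add: algebra_simps power2_eq_square)
  also have "x'' s * x s = (x s)\<^sup>2 + (real n - 1) * (b s)\<^sup>2"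
    by (simp add: x''_def field_simps power2_eq_square)
  also have "m * ((x s)\<^sup>2 + (real n - 1) * (b s)\<^sup>2 - (x s)\<^sup>2 + (real n - 1) * (x' s)\<^sup>2) =
      m * (real n - 1) * (r s)\<^sup>2"
    unfolding r_sq x'_sq by (simp add: algebra_simps)
  finally have "((- m * x'' s + c * y'' s + d * z'' s) * x s) * (r s)\<^sup>2 = ((real n - 1) * m) * (r s)\<^sup>2"
    by (simp only: mult_ac)
  then have "(- m * x'' s + c * y'' s + d * z'' s) * x s = (real n - 1) * m"
    by (subst (asm) mult_right_cancel) simp_all
  then show "- m * x'' s + c * y'' s + d * z'' s = (real n - 1) * m / x s"
    by (subst eq_divide_eq) simp
qed

text \<open>Since \<open>unit_normal\<close> is a choice, its properties are available only once
  some vector has them. \<open>A\<close> and \<open>B\<close> are the frame coefficients that solve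
  both orthogonality relations for \<open>m = - b\<close>.\<close>

lemma normal_exists:
  "\<exists>m c d. - m * x s + c * y s + d * z s = 0 \<and> - m * x' s + c * y' s + d * z' s = 0 \<and>
     - m\<^sup>2 + c\<^sup>2 + d\<^sup>2 = 1"
proof -
  define A where "A = - b s * x s / r s"
  define B where "B = x' s / r s"
  define c where "c = A * sin (\<theta> s) + B * cos (\<theta> s)"
  define d where "d = A * cos (\<theta> s) - B * sin (\<theta> s)"
  have 1: "c * y s + d * z s = A * r s"
    using rotate_inner[of A "\<theta> s" B "r s" 0] by (simp add: c_def d_def y_def z_def)
  have 2: "c * y' s + d * z' s = A * rad1 s + B * tan1 s"
    using rotate_inner[of A "\<theta> s" B "rad1 s" "tan1 s"] by (simp add: c_def d_def y'_def z'_def)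
  also have "\<dots> = - (b s * x' s) * ((x s)\<^sup>2 - 1) / (r s)\<^sup>2"
    by (simp add: A_def B_def rad1_def tan1_def field_simps power2_eq_square)
  also have "\<dots> = - (b s * x' s)" unfolding r_sq[symmetric] by simp
  finally have 2: "c * y' s + d * z' s = - (b s * x' s)" .
  have "c\<^sup>2 + d\<^sup>2 = A\<^sup>2 + B\<^sup>2"
    using rotate_inner[of A "\<theta> s" B A B] by (simp add: c_def d_def power2_eq_square)
  also have "\<dots> = ((b s)\<^sup>2 * (x s)\<^sup>2 + (x' s)\<^sup>2) / (r s)\<^sup>2"
    by (simp add: A_def B_def power_divide power_mult_distrib add_divide_distrib)
  also have "(b s)\<^sup>2 * (x s)\<^sup>2 + (x' s)\<^sup>2 = (r s)\<^sup>2 * (1 + (b s)\<^sup>2)"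
    unfolding r_sq x'_sq by (simp add: algebra_simps)
  finally have 3: "c\<^sup>2 + d\<^sup>2 = 1 + (b s)\<^sup>2" by simp
  show ?thesis
    using 1 2 3 by (intro exI[of _ "- b s"] exI[of _ c] exI[of _ d]) (simp add: A_def)
qed

text \<open>\<open>x powr (1 - n)\<close> is a positive supersolution of the Jacobi equation; \<open>w\<close> is minus its
  logarithmic derivative.\<close>

definition w :: "real \<Rightarrow> real" where "w s = (real n - 1) * x' s / x s"
definition w' :: "real \<Rightarrow> real" where "w' s = (real n - 1) * (1 + real n * (b s)\<^sup>2) / (x s)\<^sup>2"

text \<open>The numerator of the quotient rule is \<open>x'' x - x'\<^sup>2\<close>. The
  second-order equation contributes \<open>x\<^sup>2 + (n - 1) b\<^sup>2\<close> and the first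
  integral subtracts \<open>x\<^sup>2 - 1 - b\<^sup>2\<close>, leaving
  \<open>1 + n b\<^sup>2\<close>.\<close>

lemma DERIV_w: "(w has_real_derivative w' s) (at s)"
proof -
  have "(w has_real_derivative ((real n - 1) * x'' s * x s - (real n - 1) * x' s * x' s) / (x s * x s)) (at s)"
    unfolding w_def[abs_def] by (rule DERIV_divide) (auto intro!: derivative_eq_intros DERIV_x DERIV_x')
  also have "((real n - 1) * x'' s * x s - (real n - 1) * x' s * x' s) =
      (real n - 1) * (x'' s * x s - (x' s)\<^sup>2)" by (simp add: algebra_simps power2_eq_square)
  also have "x'' s * x s - (x' s)\<^sup>2 = 1 + real n * (b s)\<^sup>2"
    unfolding x''_def x'_sq by (simp add: field_simps power2_eq_square)
  finally show ?thesis by (simp add: w'_def power2_eq_square)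
qed

lemma w'_ge: "real n * (real n - 1) * (b s / x s)\<^sup>2 \<le> w' s"
  using n unfolding w'_def by (simp add: power_divide divide_right_mono algebra_simps)

text \<open>Bootstrapping: the equation writes \<open>x''\<close> as a smooth function of
  \<open>x\<close>, so class C^j of \<open>x\<close> gives class C^(j+2). As two orders are gained
  at once, orders 0 and 1 are settled directly.\<close>

lemma Ck_real_x: "Ck_real k x"
proof (induction k)
  case 0
  then show ?case by (auto intro!: continuous_at_imp_continuous_on intro: DERIV_isCont DERIV_x)
next
  case (Suc k)
  show ?case
  proof (cases k)
    case 0
    then show ?thesis
      by (intro Ck_real_SucI[of _ x'] DERIV_x)
        (auto intro!: continuous_at_imp_continuous_on intro: DERIV_isCont DERIV_x')
  next
    case (Suc j)
    have x: "Ck_real j x" using Suc.IH Ck_real_Suc_D Suc by blast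
    have "x'' = (\<lambda>s. x s + (real n - 1) * catenoid_const n t ^ 2 *
        (inverse (x s ^ (n - 1)) ^ 2 * inverse (x s)))"
      by (rule ext) (simp add: x''_def b_def power_divide divide_inverse power_mult_distrib)
    moreover have "Ck_real j (\<lambda>s. x s + (real n - 1) * catenoid_const n t ^ 2 *
        (inverse (x s ^ (n - 1)) ^ 2 * inverse (x s)))"
      by (intro Ck_real_add Ck_real_mult Ck_real_const Ck_real_power Ck_real_inverse x) auto
    ultimately have "Ck_real k x'" unfolding Suc by (intro Ck_real_SucI[of x' x''] DERIV_x') simp
    then show ?thesis by (intro Ck_real_SucI[of x x'] DERIV_x)
  qed
qed

lemma Ck_real_yz: "Ck_real k y" "Ck_real k z"
proof -
  have r2: "(x s)\<^sup>2 + - 1 > 0" for s using r_pos[of s] r_sq[of s] by (metis add_uminus_conv_diff zero_less_power)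
  have "Ck_real k (\<lambda>s. sqrt ((x s)\<^sup>2 + - 1))"
    by (intro Ck_real_sqrt Ck_real_add Ck_real_power Ck_real_const Ck_real_x r2)
  then have r: "Ck_real k r" by (simp add: r_def[abs_def])
  have "Ck_real k (\<lambda>s. catenoid_const n t * inverse (x s ^ (n - 1)) * inverse ((x s)\<^sup>2 + - 1))"
    using r2 by (intro Ck_real_mult Ck_real_inverse Ck_real_const Ck_real_add Ck_real_power Ck_real_x)
       (auto simp: less_imp_neq[THEN not_sym])
  moreover have "(\<lambda>s. b s / (r s)\<^sup>2) = (\<lambda>s. catenoid_const n t * inverse (x s ^ (n - 1)) * inverse ((x s)\<^sup>2 + - 1))"
    by (rule ext) (simp add: b_def r_sq divide_inverse)
  ultimately have "Ck_real k (\<lambda>s. b s / (r s)\<^sup>2)" by simp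
  then have "Ck_real (Suc k) \<theta>" by (rule Ck_real_SucI[OF DERIV_theta])
  then have \<theta>: "Ck_real k \<theta>" by (rule Ck_real_Suc_D)
  show "Ck_real k y" "Ck_real k z"
    unfolding y_def[abs_def] z_def[abs_def] using Ck_real_sin_cos[OF \<theta>] by (auto intro: Ck_real_mult r)
qed

end


section \<open>Lorentz geometry and orthogonal charts of hyperbolic space\<close>

text \<open>The first form, the second form and the shape operator of the catenoid are all diagonal
  in the chart, so inverses, traces and determinants reduce to families of entries.\<close>

definition dmat :: "('n \<Rightarrow> real) \<Rightarrow> real^'n^'n" where
  "dmat a = (\<chi> i j. if i = j then a i else 0)"

lemma dmat_nth [simp]: "dmat a $ i $ j = (if i = j then a i else 0)"
  by (simp add: dmat_def)

lemma dmat_mult: "dmat a ** dmat b = dmat (\<lambda>i. a i * b i)"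
  by (simp add: vec_eq_iff matrix_matrix_mult_def if_distrib[of "\<lambda>u. u * _"] cong: if_cong)

lemma dmat_vec: "dmat a *v v = (\<chi> i. a i * v $ i)"
  by (simp add: vec_eq_iff matrix_vector_mult_def if_distrib[of "\<lambda>u. u * _"] cong: if_cong)

lemma trace_dmat: "trace (dmat a) = (\<Sum>i\<in>UNIV. a i)"
  by (simp add: trace_def)

lemma det_dmat: "det (dmat a) = (\<Prod>i\<in>UNIV. a i)"
  by (subst det_diagonal) auto

lemma matrix_inv_dmat:
  assumes "\<And>i. a i \<noteq> 0"
  shows "matrix_inv (dmat a) = dmat (\<lambda>i. inverse (a i))"
proof -
  have 1: "dmat (\<lambda>i. 1) = mat 1" by (simp add: vec_eq_iff mat_def)
  have *: "dmat a ** dmat (\<lambda>i. inverse (a i)) = mat 1" "dmat (\<lambda>i. inverse (a i)) ** dmat a = mat 1"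
    using assms by (simp_all add: dmat_mult 1)
  then have "dmat a ** matrix_inv (dmat a) = mat 1 \<and> matrix_inv (dmat a) ** dmat a = mat 1"
    unfolding matrix_inv_def by (intro someI_ex[of "\<lambda>B. dmat a ** B = mat 1 \<and> B ** dmat a = mat 1"]) blast
  then show ?thesis using * by (metis matrix_mul_assoc matrix_mul_lid matrix_mul_rid)
qed

lemma bounded_bilinear_lorentz: "bounded_bilinear (lorentz :: real \<times> 'v::euclidean_space \<Rightarrow> _)"
proof -
  have "bounded_linear (\<lambda>u :: real \<times> 'v. (- fst u, snd u))"
    by (intro bounded_linear_Pair bounded_linear_minus bounded_linear_fst bounded_linear_snd)
  from bounded_bilinear.comp[OF bounded_bilinear_inner this bounded_linear_ident]
  show ?thesis by (simp add: lorentz_def[abs_def] inner_prod_def)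
qed

interpretation lorentz: bounded_bilinear "lorentz :: real \<times> 'v::euclidean_space \<Rightarrow> _"
  by (rule bounded_bilinear_lorentz)

lemma lorentz_commute: "lorentz u v = lorentz v u"
  by (simp add: lorentz_def inner_commute)

lemma hyperbolic_space_norm:
  assumes "q \<in> hyperbolic_space"
  shows "(norm (snd q))\<^sup>2 = (fst q)\<^sup>2 - 1" "fst q \<ge> 1"
  using assms by (auto simp: hyperbolic_space_def lorentz_def power2_norm_eq_inner power2_eq_square[of "fst q"])

lemma hyperbolic_space_iff:
  "q \<in> hyperbolic_space \<longleftrightarrow> fst q = sqrt (1 + (norm (snd q))\<^sup>2)"
proof
  assume "q \<in> hyperbolic_space"
  then show "fst q = sqrt (1 + (norm (snd q))\<^sup>2)"
    using hyperbolic_space_norm[of q] by simp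
next
  assume *: "fst q = sqrt (1 + (norm (snd q))\<^sup>2)"
  then have "(fst q)\<^sup>2 = 1 + (norm (snd q))\<^sup>2" by (simp add: add_nonneg_nonneg)
  then show "q \<in> hyperbolic_space"
    using * by (simp add: hyperbolic_space_def lorentz_def power2_norm_eq_inner power2_eq_square[of "fst q"])
qed

text \<open>The last two bounds say that \<open>ln (fst q)\<close> and the Klein projection \<open>snd q / fst q\<close> are
  1-Lipschitz on hyperbolic space.\<close>

lemma tangent_lorentz:
  assumes q: "q \<in> hyperbolic_space" and v: "lorentz v q = 0"
  shows "lorentz v v \<ge> 0"
    and "lorentz v v = 0 \<Longrightarrow> v = 0"
    and "\<bar>fst v / fst q\<bar> \<le> sqrt (lorentz v v)"
    and "norm ((1 / fst q) *\<^sub>R snd v - (fst v / (fst q)\<^sup>2) *\<^sub>R snd q) \<le> sqrt (lorentz v v)"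
proof -
  note hq = hyperbolic_space_norm[OF q]
  have vq: "fst v * fst q = snd v \<bullet> snd q" using v by (simp add: lorentz_def)
  have vv: "lorentz v v = (norm (snd v))\<^sup>2 - (fst v)\<^sup>2"
    by (simp add: lorentz_def power2_norm_eq_inner power2_eq_square[of "fst v"])
  \<comment> \<open>Orthogonality to \<open>q\<close> turns the time component of \<open>v\<close>
    into an inner product of space parts. Cauchy-Schwarz with
    \<open>|snd q|\<^sup>2 = (fst q)\<^sup>2 - 1\<close> then controls it by
    \<open>lorentz v v\<close>.\<close>
  have "(fst v * fst q)\<^sup>2 \<le> (norm (snd v))\<^sup>2 * (norm (snd q))\<^sup>2"
    unfolding vq using Cauchy_Schwarz_ineq[of "snd v" "snd q"] by (simp add: power2_norm_eq_inner)
  then have cs: "(fst v)\<^sup>2 * (fst q)\<^sup>2 \<le> (norm (snd v))\<^sup>2 * ((fst q)\<^sup>2 - 1)"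
    by (simp add: power_mult_distrib hq)
  have c1: "(fst q)\<^sup>2 \<ge> 1" using hq(2) by simp
  have 1: "(fst v)\<^sup>2 \<le> ((fst q)\<^sup>2 - 1) * lorentz v v"
    using cs unfolding vv by (simp add: algebra_simps)
  show nn: "lorentz v v \<ge> 0"
  \<comment> \<open>At the vertex, where \<open>fst q = 1\<close>, the inequality \<open>1\<close>
    cannot be divided by \<open>(fst q)\<^sup>2 - 1\<close>; there it forces
    \<open>fst v = 0\<close> instead.\<close>
  proof (cases "(fst q)\<^sup>2 = 1")
    case True
    then show ?thesis using 1 unfolding vv by simp
  next
    case False
    then have "(fst q)\<^sup>2 - 1 > 0" using c1 by simp
    moreover have "0 \<le> ((fst q)\<^sup>2 - 1) * lorentz v v" using 1 zero_le_power2[of "fst v"] by linarith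
    ultimately show ?thesis by (simp add: zero_le_mult_iff)
  qed
  show "v = 0" if "lorentz v v = 0"
  proof -
    have "fst v = 0" using 1 that by simp
    moreover from this have "snd v = 0" using that unfolding vv by simp
    ultimately show ?thesis by (simp add: prod_eq_iff)
  qed
  have "(fst v)\<^sup>2 \<le> (fst q)\<^sup>2 * lorentz v v"
    using 1 nn by (simp add: algebra_simps)
  then have "(fst v / fst q)\<^sup>2 \<le> lorentz v v"
    using c1 nn by (simp add: power_divide divide_le_eq mult.commute)
  then show "\<bar>fst v / fst q\<bar> \<le> sqrt (lorentz v v)"
    by (intro real_le_rsqrt) (simp only: power2_abs)
  have c0: "fst q > 0" using hq(2) by simp
  let ?y = "(1 / fst q) *\<^sub>R snd v - (fst v / (fst q)\<^sup>2) *\<^sub>R snd q"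
  \<comment> \<open>\<open>?y\<close> is the derivative of the Klein projection in direction
    \<open>v\<close>. Its mixed term is evaluated by
    \<open>snd v \<bullet> snd q = fst v * fst q\<close>.\<close>
  have "(norm ?y)\<^sup>2 = (1 / fst q)\<^sup>2 * (norm (snd v))\<^sup>2 - 2 * (1 / fst q) * (fst v / (fst q)\<^sup>2) * (fst v * fst q)
      + (fst v / (fst q)\<^sup>2)\<^sup>2 * ((fst q)\<^sup>2 - 1)"
    unfolding vq hq(1)[symmetric] power2_norm_eq_inner
    by (simp add: inner_diff_left inner_diff_right inner_commute power2_eq_square algebra_simps)
  also have "\<dots> = lorentz v v / (fst q)\<^sup>2 - (fst v / (fst q)\<^sup>2)\<^sup>2"
    using c0 unfolding vv by (simp add: field_simps power2_eq_square)
  also have "\<dots> \<le> lorentz v v / (fst q)\<^sup>2" by simp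
  also have "\<dots> \<le> lorentz v v" using divide_left_mono[OF c1 nn] c0 by simp
  finally show "norm ?y \<le> sqrt (lorentz v v)" by (rule real_le_rsqrt)
qed

section \<open>Differentiating Lorentz products along an immersion\<close>

lemma partial_bilinear:
  assumes "bounded_bilinear b" "f differentiable (at p)" "g differentiable (at p)"
  shows "partial i (\<lambda>p. b (f p) (g p)) p = b (f p) (partial i g p) + b (partial i f p) (g p)"
proof -
  obtain f' g' where *: "(f has_derivative f') (at p)" "(g has_derivative g') (at p)"
    using assms unfolding differentiable_def by blast
  show ?thesis
    using partial_eq[OF bounded_bilinear.FDERIV[OF assms(1) *]] partial_eq[OF *(1)] partial_eq[OF *(2)] by simp
qed

text \<open>The function \<open>lorentz F F\<close> is constantly -1 on the open set
  \<open>D\<close>; its derivative is twice the product in question.\<close>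

lemma lorentz_partial_position:
  assumes "open D" "p \<in> D" "F differentiable (at p)" "\<And>q. q \<in> D \<Longrightarrow> F q \<in> hyperbolic_space"
  shows "lorentz (partial i F p) (F p) = 0"
proof -
  have "partial i (\<lambda>p. lorentz (F p) (F p)) p = partial i (\<lambda>p. - 1) p"
    using assms by (intro partial_cong[of D]) (auto simp: hyperbolic_space_def)
  then show ?thesis
    using partial_bilinear[OF bounded_bilinear_lorentz assms(3,3)] lorentz_commute[of "F p"] by simp
qed

lemma first_form_quadratic:
  assumes "(F has_derivative F') (at p)"
  shows "v \<bullet> (first_form F p *v v) = lorentz (F' v) (F' v)"
proof -
  have "lorentz (F' v) (F' v) = (\<Sum>i\<in>UNIV. \<Sum>j\<in>UNIV. v $ i * (v $ j * lorentz (partial j F p) (partial i F p)))"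
    unfolding derivative_eq_sum_partial[OF assms]
    by (simp add: lorentz.sum_left lorentz.sum_right lorentz.scaleR_left lorentz.scaleR_right)
       (simp add: sum_distrib_left mult_ac)
  also have "\<dots> = (\<Sum>i\<in>UNIV. \<Sum>j\<in>UNIV. v $ i * (v $ j * lorentz (partial i F p) (partial j F p)))"
    by (intro sum.cong refl arg_cong2[of _ _ _ _ "(*)"] lorentz_commute)
  also have "\<dots> = v \<bullet> (first_form F p *v v)"
    by (simp add: inner_vec_def matrix_vector_mult_def first_form_def sum_distrib_left mult_ac)
  finally show ?thesis by simp
qed

section \<open>Metric and topology of an orthogonal chart\<close>

locale orthogonal_chart =
  fixes U :: "(real^'k) set" and \<phi> :: "real^'k \<Rightarrow> real \<times> (real^'k)"
  assumes chart: "orthogonal_parametrization U \<phi>"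
begin

lemma open_U: "open U" and smooth_phi: "smooth_on U \<phi>"
  and phi_in: "p \<in> U \<Longrightarrow> \<phi> p \<in> hyperbolic_space"
  using chart by (auto simp: orthogonal_parametrization_def)

lemma phi_differentiable: "p \<in> U \<Longrightarrow> \<phi> differentiable (at p)"
  "p \<in> U \<Longrightarrow> partial i \<phi> differentiable (at p)"
  using smooth_phi by (auto intro: smooth_on_differentiable smooth_on_partial)

definition e :: "real^'k \<Rightarrow> 'k \<Rightarrow> real" where
  "e p i = lorentz (partial i \<phi> p) (partial i \<phi> p)"

lemma lorentz_phi_phi: "p \<in> U \<Longrightarrow> lorentz (\<phi> p) (\<phi> p) = - 1"
  using phi_in by (simp add: hyperbolic_space_def)

lemma lorentz_partial_phi: "p \<in> U \<Longrightarrow> lorentz (partial i \<phi> p) (\<phi> p) = 0"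
  by (rule lorentz_partial_position[OF open_U]) (auto intro: phi_differentiable phi_in)

lemma lorentz_partials: "p \<in> U \<Longrightarrow> lorentz (partial i \<phi> p) (partial j \<phi> p) = (if i = j then e p i else 0)"
  using chart by (auto simp: orthogonal_parametrization_def e_def)

text \<open>Injectivity of the derivative makes each partial derivative nonzero, and nonzero vectors
  tangent to hyperbolic space are spacelike.\<close>

lemma e_pos: "p \<in> U \<Longrightarrow> e p i > 0"
proof -
  assume p: "p \<in> U"
  obtain \<phi>' where d: "(\<phi> has_derivative \<phi>') (at p)"
    using phi_differentiable(1)[OF p] unfolding differentiable_def by blast
  have inj: "inj \<phi>'" using chart p frechet_derivative_at[OF d] by (auto simp: orthogonal_parametrization_def)
  have "\<phi>' (axis i 1) \<noteq> \<phi>' 0" using inj by (simp add: inj_eq axis_eq_0_iff)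
  then have "partial i \<phi> p \<noteq> 0"
    using partial_eq[OF d] has_derivative_linear[OF d] by (simp add: linear_0)
  then show ?thesis
    using tangent_lorentz(1,2)[OF phi_in[OF p] lorentz_partial_phi[OF p, of i]]
    unfolding e_def by (metis order_le_less)
qed

text \<open>Differentiating the tangency relation gives minus the first form, which is diagonal in
  an orthogonal chart. Because the normal of the catenoid has an orbit part proportional to
  \<open>\<phi>\<close>, its second form is diagonal too.\<close>

lemma lorentz_partial2_phi:
  assumes "p \<in> U"
  shows "lorentz (partial i (partial j \<phi>) p) (\<phi> p) = (if i = j then - e p i else 0)"
proof -
  have "partial i (\<lambda>p. lorentz (partial j \<phi> p) (\<phi> p)) p = partial i (\<lambda>p. 0) p"
    using assms by (intro partial_cong[OF open_U]) (auto simp: lorentz_partial_phi)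
  then have "lorentz (partial j \<phi> p) (partial i \<phi> p) + lorentz (partial i (partial j \<phi>) p) (\<phi> p) = 0"
    using partial_bilinear[OF bounded_bilinear_lorentz phi_differentiable(2)[OF assms] phi_differentiable(1)[OF assms]] by simp
  then show ?thesis using lorentz_partials[OF assms, of j i] by (auto split: if_splits)
qed

text \<open>The position vector and its partial derivatives form a basis because they are as many
  as the dimension and pairwise orthogonal.\<close>

lemma orthogonal_to_tangent_space:
  assumes p: "p \<in> U" and u: "\<And>i. lorentz u (partial i \<phi> p) = 0"
  shows "\<exists>m. u = m *\<^sub>R \<phi> p"
proof -
  \<comment> \<open>\<open>?S\<close> sends coefficients to combinations of the position vector and
    the partial derivatives. Its source and target are the same space, so injectivity gives
    surjectivity.\<close>
  let ?S = "\<lambda>v :: real \<times> (real^'k). fst v *\<^sub>R \<phi> p + (\<Sum>i\<in>UNIV. snd v $ i *\<^sub>R partial i \<phi> p)"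
  have lin: "linear ?S"
    by (rule linearI) (simp_all add: algebra_simps sum.distrib scaleR_sum_right)
  have S1: "lorentz (?S v) (\<phi> p) = - fst v" for v
    using p by (simp add: lorentz.add_left lorentz.sum_left lorentz.scaleR_left lorentz_phi_phi lorentz_partial_phi)
  have S2: "lorentz (?S v) (partial j \<phi> p) = snd v $ j * e p j" for v j
    using p lorentz_commute[of "\<phi> p"]
    by (simp add: lorentz.add_left lorentz.sum_left lorentz.scaleR_left lorentz_partial_phi lorentz_partials
        if_distrib[of "\<lambda>u. _ * u"] cong: if_cong)
  have "v = 0" if "?S v = 0" for v
  proof -
    have "fst v = 0" using S1[of v] that by (simp add: lorentz.zero_left)
    moreover have "snd v $ j = 0" for j
      using S2[of v j] that e_pos[OF p, of j] by (simp add: lorentz.zero_left)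
    ultimately show ?thesis by (simp add: prod_eq_iff vec_eq_iff)
  qed
  then have "inj ?S" using linear_injective_0[OF lin] by blast
  then have "surj ?S" using linear_injective_imp_surjective[OF lin] by blast
  then have "u \<in> range ?S" by simp
  then obtain v where v: "u = ?S v" by (rule rangeE)
  have "snd v $ j = 0" for j using S2[of v j] u[of j] e_pos[OF p, of j] v by simp
  then show ?thesis using v by auto
qed

text \<open>Hyperbolic space is a graph over its space part, so forgetting the time component leaves
  an injective map of \<open>U\<close> onto a Euclidean space of the same dimension. The continuous
  inverse yields connectedness of \<open>U\<close> and, later, convergence of chart points from
  convergence of their images.\<close>

lemma homeomorphism_snd_phi:
  obtains \<psi> where "homeomorphism U UNIV (\<lambda>p. snd (\<phi> p)) \<psi>"
proof -
  have cont: "continuous_on U (\<lambda>p. snd (\<phi> p))"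
    using smooth_on_continuous_on[OF smooth_phi] by (rule continuous_on_snd)
  have inj: "inj_on (\<lambda>p. snd (\<phi> p)) U"
  proof (rule inj_onI)
    fix p q assume "p \<in> U" "q \<in> U" "snd (\<phi> p) = snd (\<phi> q)"
    moreover from this have "fst (\<phi> p) = fst (\<phi> q)" using phi_in hyperbolic_space_iff by metis
    ultimately have "\<phi> p = \<phi> q" by (simp add: prod_eq_iff)
    then show "p = q" using chart \<open>p \<in> U\<close> \<open>q \<in> U\<close> by (auto simp: orthogonal_parametrization_def inj_on_def)
  qed
  have im: "(\<lambda>p. snd (\<phi> p)) ` U = UNIV"
  proof -
    have "w \<in> (\<lambda>p. snd (\<phi> p)) ` U" for w
    proof -
      have "(sqrt (1 + (norm w)\<^sup>2), w) \<in> hyperbolic_space" by (simp add: hyperbolic_space_iff)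
      then have "(sqrt (1 + (norm w)\<^sup>2), w) \<in> \<phi> ` U" using chart by (simp add: orthogonal_parametrization_def)
      then obtain p where "p \<in> U" "(sqrt (1 + (norm w)\<^sup>2), w) = \<phi> p" by (rule imageE)
      then show ?thesis by (metis imageI snd_conv)
    qed
    then show ?thesis by auto
  qed
  show ?thesis
    using invariance_of_domain_homeomorphism[OF open_U cont _ inj] that unfolding im by auto
qed

lemma connected_U: "connected U" and U_nonempty: "U \<noteq> {}"
proof -
  obtain \<psi> where h: "homeomorphism U UNIV (\<lambda>p. snd (\<phi> p)) \<psi>" by (rule homeomorphism_snd_phi)
  then have "U = \<psi> ` UNIV" "continuous_on UNIV \<psi>" by (auto simp: homeomorphism_def)
  then show "connected U" "U \<noteq> {}" by (auto intro: connected_continuous_image)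
qed

end


section \<open>The fundamental forms of the catenoid\<close>

text \<open>Groups the time component with the orbit directions. The ambient space becomes the
  orthogonal sum of a smaller Lorentz space and a plane, which the nested product type does not
  show.\<close>

definition vec4 :: "real \<times> 'v::euclidean_space \<Rightarrow> real \<Rightarrow> real \<Rightarrow> real \<times> 'v \<times> real \<times> real" where
  "vec4 u c d = (fst u, snd u, c, d)"

lemma lorentz_vec4: "lorentz (vec4 u c d) (vec4 u' c' d') = lorentz u u' + c * c' + d * d'"
  by (simp add: vec4_def lorentz_def)

lemma vec4_surj: "\<exists>u c d. v = vec4 u c d"
proof (intro exI)
  show "v = vec4 (fst v, fst (snd v)) (fst (snd (snd v))) (snd (snd (snd v)))" by (simp add: vec4_def)
qed

text \<open>A form to which the rules for scalar multiples and sums apply, both for derivatives and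
  for C^k classes.\<close>

lemma vec4_eq: "vec4 (a *\<^sub>R u) c d = a *\<^sub>R vec4 u 0 0 + c *\<^sub>R vec4 0 1 0 + d *\<^sub>R vec4 0 0 1"
  by (simp add: vec4_def prod_eq_iff)

lemma bounded_linear_vec4: "bounded_linear (\<lambda>u. vec4 u 0 0)"
  unfolding vec4_def
  by (intro bounded_linear_Pair bounded_linear_fst bounded_linear_snd bounded_linear_zero)

lemma partial_None_vec4:
  assumes "(g has_real_derivative g') (at (par_s p))" "(c has_real_derivative c') (at (par_s p))"
    "(d has_real_derivative d') (at (par_s p))"
  shows "partial None (\<lambda>p. vec4 (g (par_s p) *\<^sub>R f (par_t p)) (c (par_s p)) (d (par_s p))) p
    = vec4 (g' *\<^sub>R f (par_t p)) c' d'"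
proof -
  have sh: "((\<lambda>h. k (par_s p + h)) has_real_derivative k') (at 0)"
    if "(k has_real_derivative k') (at (par_s p))" for k k'
    using that DERIV_shift[of k k' 0 "par_s p"] by (simp add: add.commute)
  have "((\<lambda>h. g (par_s p + h) *\<^sub>R vec4 (f (par_t p)) 0 0 + c (par_s p + h) *\<^sub>R vec4 0 1 0 +
      d (par_s p + h) *\<^sub>R vec4 0 0 1) has_vector_derivative
      ((g (par_s p + 0) *\<^sub>R 0 + g' *\<^sub>R vec4 (f (par_t p)) 0 0) +
       (c (par_s p + 0) *\<^sub>R 0 + c' *\<^sub>R vec4 0 1 0)) + (d (par_s p + 0) *\<^sub>R 0 + d' *\<^sub>R vec4 0 0 1)) (at 0)"
    using assms by (intro has_vector_derivative_add has_vector_derivative_scaleR sh has_vector_derivative_const)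
  then show ?thesis unfolding partial_def vec4_eq by (intro vector_derivative_at) simp
qed

lemma partial_Some_vec4:
  assumes "f differentiable (at (par_t p))"
  shows "partial (Some i) (\<lambda>p. vec4 (g (par_s p) *\<^sub>R f (par_t p)) (c (par_s p)) (d (par_s p))) p
    = vec4 (g (par_s p) *\<^sub>R partial i f (par_t p)) 0 0"
proof -
  obtain f' where f': "(f has_derivative f') (at (par_t p))" using assms unfolding differentiable_def by blast
  have "((\<lambda>h. par_t p + h *\<^sub>R axis i 1) has_derivative (\<lambda>h. h *\<^sub>R axis i 1)) (at 0)"
    by (auto intro!: derivative_eq_intros)
  then have "((\<lambda>h. f (par_t p + h *\<^sub>R axis i 1)) has_derivative (\<lambda>h. f' (h *\<^sub>R axis i 1))) (at 0)"
    by (rule has_derivative_compose) (simp add: f')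
  then have d: "((\<lambda>h. f (par_t p + h *\<^sub>R axis i 1)) has_derivative (\<lambda>h. h *\<^sub>R partial i f (par_t p))) (at 0)"
    using has_derivative_linear[OF f'] by (simp add: partial_eq[OF f'] linear_scale)
  have "((\<lambda>h. vec4 (g (par_s p) *\<^sub>R f (par_t p + h *\<^sub>R axis i 1)) (c (par_s p)) (d (par_s p)))
      has_derivative (\<lambda>h. h *\<^sub>R vec4 (g (par_s p) *\<^sub>R partial i f (par_t p)) 0 0)) (at 0)"
    unfolding vec4_eq
    by (rule derivative_eq_intros bounded_linear.has_derivative[OF bounded_linear_vec4] d refl)+
       (simp add: vec4_def fun_eq_iff)
  then show ?thesis unfolding partial_def
    by (intro vector_derivative_at) (simp add: has_vector_derivative_def)
qed

lemma Ck_on_vec4: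
  assumes "open U" "Ck_real k g" "Ck_real k c" "Ck_real k d" "Ck_on k U f"
  shows "Ck_on k (catenoid_domain U) (\<lambda>p. vec4 (g (par_s p) *\<^sub>R f (par_t p)) (c (par_s p)) (d (par_s p)))"
proof -
  note o = open_catenoid_domain[OF assms(1)]
  show ?thesis
    unfolding vec4_eq
    by (intro Ck_on_add[OF o] Ck_on_bilinear[OF o bounded_bilinear_scaleR] Ck_on_const
        Ck_on_real_compose[OF o bounded_linear_par_s] Ck_on_linear[OF o bounded_linear_vec4]
        Ck_on_comp_par_t assms)
qed

lemma sum_option:
  fixes f :: "'k::finite option \<Rightarrow> 'a::comm_monoid_add"
  shows "(\<Sum>i\<in>UNIV. f i) = f None + (\<Sum>i\<in>UNIV. f (Some i))"
  by (simp add: UNIV_option_conv sum.reindex)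

lemma prod_option:
  fixes f :: "'k::finite option \<Rightarrow> 'a::comm_monoid_mult"
  shows "(\<Prod>i\<in>UNIV. f i) = f None * (\<Prod>i\<in>UNIV. f (Some i))"
  by (simp add: UNIV_option_conv prod.reindex)

section \<open>The immersion and its first and second forms\<close>

locale catenoid = catenoid_profile_curve n t x + orthogonal_chart U \<phi>
  for n :: nat and t :: real and x :: "real \<Rightarrow> real"
    and U :: "(real^'k) set" and \<phi> :: "real^'k \<Rightarrow> real \<times> (real^'k)" +
  assumes dim: "n = CARD('k) + 1"
begin

abbreviation D :: "(real^'k option) set" where "D \<equiv> catenoid_domain U"
abbreviation F :: "real^'k option \<Rightarrow> real \<times> (real^'k) \<times> real \<times> real" where "F \<equiv> catenoid_map x \<phi>"

lemma par_t_in: "p \<in> D \<longleftrightarrow> par_t p \<in> U"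
  by (simp add: catenoid_domain_def)

lemma open_D: "open D"
  by (rule open_catenoid_domain[OF open_U])

lemma F_eq: "F = (\<lambda>p. vec4 (x (par_s p) *\<^sub>R \<phi> (par_t p)) (y (par_s p)) (z (par_s p)))"
  by (rule ext) (simp add: catenoid_map_def Let_def vec4_def y_def z_def r_def \<theta>_def)

lemma smooth_F: "smooth_on D F"
  unfolding smooth_on_def F_eq using smooth_phi open_U
  by (auto intro!: Ck_on_vec4 Ck_real_x Ck_real_yz simp: smooth_on_def)

lemma F_differentiable: "p \<in> D \<Longrightarrow> F differentiable (at p)"
  using smooth_F by (rule smooth_on_differentiable)

lemma F_hyperbolic: "p \<in> D \<Longrightarrow> F p \<in> hyperbolic_space"
proof -
  assume "p \<in> D"
  then have p: "par_t p \<in> U" by (simp add: par_t_in)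
  let ?s = "par_s p"
  have "lorentz (F p) (F p) = x ?s * (x ?s * lorentz (\<phi> (par_t p)) (\<phi> (par_t p))) + y ?s * y ?s + z ?s * z ?s"
    by (simp add: F_eq lorentz_vec4 lorentz.scaleR_left lorentz.scaleR_right)
  then have 1: "lorentz (F p) (F p) = - 1"
    using hyperboloid_yz[of ?s] by (simp add: lorentz_phi_phi[OF p] power2_eq_square)
  have "1 * 1 \<le> x ?s * fst (\<phi> (par_t p))"
    using x_gt_1[of ?s] hyperbolic_space_norm(2)[OF phi_in[OF p]] by (intro mult_mono) auto
  then show ?thesis using 1 by (simp add: hyperbolic_space_def F_eq vec4_def)
qed

lemma partial_F_None: "partial None F =
    (\<lambda>p. vec4 (x' (par_s p) *\<^sub>R \<phi> (par_t p)) (y' (par_s p)) (z' (par_s p)))"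
  unfolding F_eq by (rule ext) (rule partial_None_vec4[OF DERIV_x DERIV_y DERIV_z])

lemma partial_F_Some: "p \<in> D \<Longrightarrow> partial (Some i) F p =
    vec4 (x (par_s p) *\<^sub>R partial i \<phi> (par_t p)) 0 0"
  unfolding F_eq by (rule partial_Some_vec4) (simp add: par_t_in phi_differentiable)

definition g :: "real^'k option \<Rightarrow> 'k option \<Rightarrow> real" where
  "g p i = (case i of None \<Rightarrow> 1 | Some i \<Rightarrow> (x (par_s p))\<^sup>2 * e (par_t p) i)"

lemma g_simps [simp]: "g p None = 1" "g p (Some i) = (x (par_s p))\<^sup>2 * e (par_t p) i"
  by (simp_all add: g_def)

lemma g_pos: "p \<in> D \<Longrightarrow> g p i > 0"
  by (cases i) (simp_all add: par_t_in e_pos)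

lemma first_form_F: assumes "p \<in> D" shows "first_form F p = dmat (g p)"
proof -
  let ?s = "par_s p" and ?q = "par_t p"
  have q: "?q \<in> U" using assms by (simp add: par_t_in)
  have "lorentz (partial None F p) (partial None F p) = - (x' ?s)\<^sup>2 + (y' ?s)\<^sup>2 + (z' ?s)\<^sup>2"
    by (simp add: partial_F_None lorentz_vec4 lorentz.scaleR_left lorentz.scaleR_right
        lorentz_phi_phi[OF q] power2_eq_square)
  then have 1: "lorentz (partial None F p) (partial None F p) = 1" using unit_speed by simp
  have 2: "lorentz (partial (Some i) F p) (partial None F p) = 0" for i
    by (simp add: partial_F_None partial_F_Some[OF assms] lorentz_vec4 lorentz.scaleR_left
        lorentz.scaleR_right lorentz_partial_phi[OF q])
  have 3: "lorentz (partial (Some i) F p) (partial (Some j) F p) = (if i = j then g p (Some i) else 0)" for i j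
    by (simp add: partial_F_Some[OF assms] lorentz_vec4 lorentz.scaleR_left lorentz.scaleR_right
        lorentz_partials[OF q] power2_eq_square)
  have "lorentz (partial i F p) (partial j F p) = (if i = j then g p i else 0)" for i j
  proof (cases i)
    case None
    then show ?thesis using 1 2 lorentz_commute[of "partial None F p" "partial j F p"] by (cases j) simp_all
  next
    case (Some i')
    then show ?thesis using 2 3 by (cases j) simp_all
  qed
  then show ?thesis by (simp add: first_form_def vec_eq_iff)
qed

lemma quadratic_form_F: "p \<in> D \<Longrightarrow> v \<bullet> (first_form F p *v v) = (\<Sum>i\<in>UNIV. g p i * (v $ i)\<^sup>2)"
  by (simp add: first_form_F dmat_vec inner_vec_def power2_eq_square mult_ac)

text \<open>The derivative is injective because the first form is positive definite: a vector in its
  kernel has squared length 0. Connectedness holds since \<open>D\<close> is a continuous image of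
  the product of \<open>U\<close> with the line.\<close>

lemma immersed_F: "immersed_hypersurface D F"
proof -
  have conn: "connected D"
  proof -
    define G where "G q = (\<chi> i. case i of None \<Rightarrow> snd q | Some i \<Rightarrow> fst q $ i)" for q :: "(real^'k) \<times> real"
    have "D = G ` (U \<times> UNIV)"
    proof (intro equalityI subsetI)
      fix p assume p: "p \<in> D"
      have "p = G (par_t p, par_s p)"
        unfolding G_def par_t_def par_s_def vec_eq_iff by (auto split: option.split)
      then show "p \<in> G ` (U \<times> UNIV)" using p by (auto simp: par_t_in)
    qed (auto simp: G_def par_t_in par_t_def)
    moreover have "continuous_on (U \<times> UNIV) G"
      unfolding G_def
    proof (rule continuous_on_vec_lambda)
      fix i :: "'k option"
      show "continuous_on (U \<times> UNIV) (\<lambda>q. case i of None \<Rightarrow> snd q | Some i \<Rightarrow> fst q $ i)"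
        by (cases i) (auto intro!: continuous_intros)
    qed
    ultimately show ?thesis
      using connected_U by (auto intro!: connected_continuous_image connected_Times)
  qed
  have ne: "D \<noteq> {}"
  proof -
    obtain q where "q \<in> U" using U_nonempty by blast
    then have "(\<chi> i. case i of None \<Rightarrow> 0 | Some i \<Rightarrow> q $ i) \<in> D" by (simp add: par_t_in par_t_def)
    then show ?thesis by blast
  qed
  have inj: "inj (frechet_derivative F (at p))" if p: "p \<in> D" for p
  proof -
    obtain F' where F': "(F has_derivative F') (at p)"
      using F_differentiable[OF p] unfolding differentiable_def by blast
    have "v = 0" if "F' v = 0" for v
    proof -
      have "(\<Sum>i\<in>UNIV. g p i * (v $ i)\<^sup>2) = 0"
        using first_form_quadratic[OF F', of v] that by (simp add: quadratic_form_F[OF p] lorentz.zero_left)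
      then have "\<forall>i\<in>UNIV. g p i * (v $ i)\<^sup>2 = 0"
        using less_imp_le[OF g_pos[OF p]] by (subst (asm) sum_nonneg_eq_0_iff) auto
      then have "\<forall>i. v $ i = 0" using g_pos[OF p] by (metis UNIV_I less_irrefl mult_eq_0_iff power_eq_0_iff)
      then show ?thesis by (simp add: vec_eq_iff)
    qed
    then have "inj F'" using linear_injective_0[OF has_derivative_linear[OF F']] by blast
    then show ?thesis using frechet_derivative_at[OF F'] by simp
  qed
  have "DIM((real^'k) \<times> real \<times> real) = CARD('k option) + 1" by simp
  then show ?thesis
    unfolding immersed_hypersurface_def using open_D conn ne smooth_F F_hyperbolic inj by blast
qed

text \<open>Orthogonality to the orbit directions forces the orbit part of any unit normal to be a
  multiple of \<open>\<phi>\<close>. What remains are the three scalar equations of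
  \<open>normal_components\<close>. Either sign of \<open>m\<close> is possible, so only its square
  is stated.\<close>

lemma unit_normal_F:
  assumes p: "p \<in> D"
  obtains m c d where "unit_normal F p = vec4 (m *\<^sub>R \<phi> (par_t p)) c d"
    "m\<^sup>2 = (b (par_s p))\<^sup>2"
    "- m * x'' (par_s p) + c * y'' (par_s p) + d * z'' (par_s p) = (real n - 1) * m / x (par_s p)"
proof -
  let ?s = "par_s p" and ?q = "par_t p"
  have q: "?q \<in> U" using p by (simp add: par_t_in)
  let ?P = "\<lambda>\<nu>. lorentz \<nu> \<nu> = 1 \<and> lorentz \<nu> (F p) = 0 \<and> (\<forall>i. lorentz \<nu> (partial i F p) = 0)"
  have val: "lorentz (vec4 (m *\<^sub>R \<phi> ?q) c d) (vec4 (m *\<^sub>R \<phi> ?q) c d) = - m\<^sup>2 + c\<^sup>2 + d\<^sup>2"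
    "lorentz (vec4 (m *\<^sub>R \<phi> ?q) c d) (F p) = - m * x ?s + c * y ?s + d * z ?s"
    "lorentz (vec4 (m *\<^sub>R \<phi> ?q) c d) (partial None F p) = - m * x' ?s + c * y' ?s + d * z' ?s" for m c d
    by (simp_all add: F_eq partial_F_None[unfolded F_eq] lorentz_vec4 lorentz.scaleR_left
        lorentz.scaleR_right lorentz_phi_phi[OF q] power2_eq_square)
  have "\<exists>\<nu>. ?P \<nu>"
  proof -
    obtain m c d where mcd: "- m * x ?s + c * y ?s + d * z ?s = 0"
      "- m * x' ?s + c * y' ?s + d * z' ?s = 0" "- m\<^sup>2 + c\<^sup>2 + d\<^sup>2 = 1"
      using normal_exists by blast
    have "lorentz (vec4 (m *\<^sub>R \<phi> ?q) c d) (partial i F p) = 0" for i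
    proof (cases i)
      case None
      then show ?thesis using val(3) mcd(2) by simp
    next
      case (Some j)
      then show ?thesis using lorentz_partial_phi[OF q, of j] lorentz_commute[of "\<phi> ?q" "partial j \<phi> ?q"]
        by (simp add: partial_F_Some[OF p] lorentz_vec4 lorentz.scaleR_left lorentz.scaleR_right)
    qed
    then have "?P (vec4 (m *\<^sub>R \<phi> ?q) c d)" using val(1,2) mcd(1,3) by simp
    then show ?thesis by blast
  qed
  then have P: "?P (unit_normal F p)" unfolding unit_normal_def by (rule someI_ex)
  obtain u c d where nu: "unit_normal F p = vec4 u c d" using vec4_surj by blast
  have "lorentz u (partial i \<phi> ?q) = 0" for i
  proof -
    have "lorentz (vec4 u c d) (partial (Some i) F p) = 0" using P nu by simp
    then show ?thesis by (simp add: partial_F_Some[OF p] lorentz_vec4 lorentz.scaleR_right)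
  qed
  then obtain m where u: "u = m *\<^sub>R \<phi> ?q" using orthogonal_to_tangent_space[OF q] by blast
  have 1: "- m * x ?s + c * y ?s + d * z ?s = 0" and 2: "- m * x' ?s + c * y' ?s + d * z' ?s = 0"
    and 3: "- m\<^sup>2 + c\<^sup>2 + d\<^sup>2 = 1"
    using P unfolding nu u val[symmetric] by simp_all
  show ?thesis
    by (rule that[OF nu[unfolded u] normal_components(1)[OF 1 2 3] normal_components(2)[OF 1 2 3]])
qed

lemma partial2_F:
  assumes p: "p \<in> D"
  shows "partial None (partial None F) p = vec4 (x'' (par_s p) *\<^sub>R \<phi> (par_t p)) (y'' (par_s p)) (z'' (par_s p))"
    and "partial (Some i) (partial None F) p = vec4 (x' (par_s p) *\<^sub>R partial i \<phi> (par_t p)) 0 0"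
    and "partial None (partial (Some j) F) p = vec4 (x' (par_s p) *\<^sub>R partial j \<phi> (par_t p)) 0 0"
    and "partial (Some i) (partial (Some j) F) p = vec4 (x (par_s p) *\<^sub>R partial i (partial j \<phi>) (par_t p)) 0 0"
proof -
  have q: "par_t p \<in> U" using p by (simp add: par_t_in)
  show "partial None (partial None F) p = vec4 (x'' (par_s p) *\<^sub>R \<phi> (par_t p)) (y'' (par_s p)) (z'' (par_s p))"
    unfolding partial_F_None by (rule partial_None_vec4[OF DERIV_x' DERIV_y' DERIV_z'])
  show "partial (Some i) (partial None F) p = vec4 (x' (par_s p) *\<^sub>R partial i \<phi> (par_t p)) 0 0"
    unfolding partial_F_None by (rule partial_Some_vec4[OF phi_differentiable(1)[OF q]])
  \<comment> \<open>The formula for \<open>partial (Some j) F\<close> holds on \<open>D\<close>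
    only; openness of \<open>D\<close> allows differentiating it at \<open>p\<close>.\<close>
  have cong: "partial k (partial (Some j) F) p =
      partial k (\<lambda>p. vec4 (x (par_s p) *\<^sub>R partial j \<phi> (par_t p)) 0 0) p" for k
    by (rule partial_cong[OF open_D p]) (rule partial_F_Some)
  show "partial None (partial (Some j) F) p = vec4 (x' (par_s p) *\<^sub>R partial j \<phi> (par_t p)) 0 0"
    unfolding cong by (rule partial_None_vec4[OF DERIV_x DERIV_const DERIV_const])
  show "partial (Some i) (partial (Some j) F) p = vec4 (x (par_s p) *\<^sub>R partial i (partial j \<phi>) (par_t p)) 0 0"
    unfolding cong by (rule partial_Some_vec4[OF phi_differentiable(2)[OF q]])
qed

text \<open>\<open>\<kappa>\<close> is \<open>m / x\<close> for the chosen normal. Its square is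
  enough, since the trace vanishes for either sign and \<open>norm_A_sq\<close> is quadratic in
  \<open>\<kappa>\<close>.\<close>

lemma shape_operator_F:
  assumes p: "p \<in> D"
  obtains \<kappa> where "\<kappa>\<^sup>2 = (b (par_s p) / x (par_s p))\<^sup>2"
    "shape_operator F p = dmat (\<lambda>i. case i of None \<Rightarrow> (real n - 1) * \<kappa> | Some i \<Rightarrow> - \<kappa>)"
proof -
  let ?s = "par_s p" and ?q = "par_t p"
  have q: "?q \<in> U" using p by (simp add: par_t_in)
  obtain m c d where nu: "unit_normal F p = vec4 (m *\<^sub>R \<phi> ?q) c d" and m: "m\<^sup>2 = (b ?s)\<^sup>2"
    and m2: "- m * x'' ?s + c * y'' ?s + d * z'' ?s = (real n - 1) * m / x ?s"
    by (rule unit_normal_F[OF p])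
  \<comment> \<open>The entry at \<open>None\<close> is the curvature term of the profile; the
    others come from \<open>lorentz_partial2_phi\<close>, scaled by \<open>x\<close> from the
    immersion and by \<open>m\<close> from the normal.\<close>
  let ?h = "\<lambda>i. case i of None \<Rightarrow> (real n - 1) * m / x ?s | Some j \<Rightarrow> - (x ?s * m * e ?q j)"
  have "lorentz (partial i (partial j F) p) (unit_normal F p) = (if i = j then ?h i else 0)" for i j
  proof (cases i)
    case i: None
    show ?thesis
    proof (cases j)
      case None
      then show ?thesis using m2 unfolding i nu
        by (simp add: partial2_F[OF p] lorentz_vec4 lorentz.scaleR_left lorentz.scaleR_right
            lorentz_phi_phi[OF q] mult_ac)
    next
      case (Some j')
      then show ?thesis unfolding i nu
        by (simp add: partial2_F[OF p] lorentz_vec4 lorentz.scaleR_left lorentz.scaleR_right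
            lorentz_partial_phi[OF q])
    qed
  next
    case i: (Some i')
    show ?thesis
    proof (cases j)
      case None
      then show ?thesis unfolding i nu
        by (simp add: partial2_F[OF p] lorentz_vec4 lorentz.scaleR_left lorentz.scaleR_right
            lorentz_partial_phi[OF q])
    next
      case (Some j')
      then show ?thesis unfolding i nu
        by (simp add: partial2_F[OF p] lorentz_vec4 lorentz.scaleR_left lorentz.scaleR_right
            lorentz_partial2_phi[OF q])
    qed
  qed
  then have h: "second_form F p = dmat ?h" by (simp add: second_form_def vec_eq_iff)
  have gnz: "g p i \<noteq> 0" for i using g_pos[OF p, of i] by simp
  have ei: "e ?q i \<noteq> 0" for i using e_pos[OF q, of i] by simp
  have "(\<lambda>i. inverse (g p i) * ?h i) = (\<lambda>i. case i of None \<Rightarrow> (real n - 1) * (m / x ?s) | Some i \<Rightarrow> - (m / x ?s))"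
  proof
    fix i show "inverse (g p i) * ?h i = (case i of None \<Rightarrow> (real n - 1) * (m / x ?s) | Some i \<Rightarrow> - (m / x ?s))"
      using ei by (cases i) (simp_all add: field_simps power2_eq_square)
  qed
  then have "shape_operator F p = dmat (\<lambda>i. case i of None \<Rightarrow> (real n - 1) * (m / x ?s) | Some i \<Rightarrow> - (m / x ?s))"
    unfolding shape_operator_def first_form_F[OF p] matrix_inv_dmat[OF gnz] h dmat_mult by simp
  moreover have "(m / x ?s)\<^sup>2 = (b ?s / x ?s)\<^sup>2" using m by (simp add: power_divide)
  ultimately show ?thesis using that by blast
qed

lemma minimal_F: "minimal_hypersurface D F"
proof -
  have "trace (shape_operator F p) = 0" if p: "p \<in> D" for p
  proof -
    obtain \<kappa> where "shape_operator F p = dmat (\<lambda>i. case i of None \<Rightarrow> (real n - 1) * \<kappa> | Some i \<Rightarrow> - \<kappa>)"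
      by (rule shape_operator_F[OF p])
    then show ?thesis using dim by (simp add: trace_dmat sum_option)
  qed
  then show ?thesis using immersed_F by (simp add: minimal_hypersurface_def)
qed

lemma norm_A_sq_F:
  assumes p: "p \<in> D"
  shows "norm_A_sq F p = real n * (real n - 1) * (b (par_s p) / x (par_s p))\<^sup>2"
proof -
  obtain \<kappa> where k: "\<kappa>\<^sup>2 = (b (par_s p) / x (par_s p))\<^sup>2"
    "shape_operator F p = dmat (\<lambda>i. case i of None \<Rightarrow> (real n - 1) * \<kappa> | Some i \<Rightarrow> - \<kappa>)"
    by (rule shape_operator_F[OF p])
  have "norm_A_sq F p = ((real n - 1)\<^sup>2 + (real n - 1)) * \<kappa>\<^sup>2"
    unfolding norm_A_sq_def k(2) dmat_mult trace_dmat sum_option using dim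
    by (simp add: power2_eq_square algebra_simps)
  also have "(real n - 1)\<^sup>2 + (real n - 1) = real n * (real n - 1)" by (simp add: power2_eq_square algebra_simps)
  finally show ?thesis by (simp add: k(1))
qed

text \<open>Volume density of the orbit chart, the factor constant along the
  \<open>s\<close>-lines.\<close>

definition \<rho> :: "real^'k \<Rightarrow> real" where "\<rho> q = sqrt (\<Prod>i\<in>UNIV. e q i)"

lemma volume_density_F: "p \<in> D \<Longrightarrow> volume_density F p = x (par_s p) ^ (n - 1) * \<rho> (par_t p)"
proof -
  assume p: "p \<in> D"
  have "det (first_form F p) = (x (par_s p) ^ (n - 1))\<^sup>2 * (\<Prod>i\<in>UNIV. e (par_t p) i)"
    unfolding first_form_F[OF p] det_dmat prod_option using dim
    by (simp add: prod.distrib power_mult[symmetric] mult.commute)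
  then show ?thesis by (simp add: volume_density_def \<rho>_def real_sqrt_mult less_imp_le)
qed

lemma norm_grad_sq_F: "p \<in> D \<Longrightarrow> (partial None \<psi> p)\<^sup>2 \<le> norm_grad_sq F \<psi> p"
proof -
  assume p: "p \<in> D"
  have gnz: "g p i \<noteq> 0" for i using g_pos[OF p, of i] by simp
  have "norm_grad_sq F \<psi> p = (\<Sum>i\<in>UNIV. inverse (g p i) * (partial i \<psi> p)\<^sup>2)"
    unfolding norm_grad_sq_def first_form_F[OF p] matrix_inv_dmat[OF gnz] Let_def dmat_vec
    by (simp add: inner_vec_def power2_eq_square mult_ac)
  also have "\<dots> \<ge> inverse (g p None) * (partial None \<psi> p)\<^sup>2"
    using less_imp_le[OF g_pos[OF p]]
    by (intro member_le_sum) auto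
  finally show ?thesis by simp
qed

end


section \<open>Riemannian distance and completeness\<close>

text \<open>The derivative may be unbounded near the exceptional points, so its integrability is not
  automatic. An infinite right-hand side leaves nothing to prove; a finite one makes the derivative
  Lebesgue integrable, and its integral agrees with the gauge integral of the fundamental
  theorem.\<close>

lemma norm_increment_le_nn_integral:
  fixes u :: "real \<Rightarrow> 'b::euclidean_space"
  assumes S: "finite S" and cont: "continuous_on {0..1} u"
    and d: "\<And>\<tau>. \<tau> \<in> {0..1} - S \<Longrightarrow> (u has_vector_derivative u' \<tau>) (at \<tau>)"
    and le: "\<And>\<tau>. \<tau> \<in> {0..1} - S \<Longrightarrow> norm (u' \<tau>) \<le> v \<tau>"
  shows "ennreal (norm (u 1 - u 0)) \<le> (\<integral>\<^sup>+\<tau>\<in>{0..1}. ennreal (v \<tau>) \<partial>lborel)" (is "_ \<le> ?I")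
proof (cases "?I = \<infinity>")
  case False
  \<comment> \<open>The bound by \<open>v\<close> is available only off \<open>S\<close>. Setting
    the integrand to 0 on \<open>S\<close> extends it without changing the integral.\<close>
  define f where "f \<tau> = (if \<tau> \<in> {0..1} then if \<tau> \<in> S then 0 else u' \<tau> else 0)" for \<tau>
  have "(u' has_integral (u 1 - u 0)) {0..1}"
    by (rule fundamental_theorem_of_calculus_strong[OF S _ d cont]) auto
  then have "((\<lambda>\<tau>. if \<tau> \<in> S then 0 else u' \<tau>) has_integral (u 1 - u 0)) {0..1}"
    by (rule has_integral_spike_finite[OF S, rotated]) auto
  then have f: "(f has_integral (u 1 - u 0)) UNIV"
    unfolding f_def by (rule has_integral_restrict_UNIV[THEN iffD2])
  then have mf: "f \<in> borel_measurable lebesgue"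
    using integrable_imp_measurable[of f UNIV] by (auto simp: lebesgue_on_UNIV_eq)
  have fle: "ennreal (norm (f \<tau>)) \<le> ennreal (v \<tau>) * indicator {0..1} \<tau>" for \<tau>
    using le[of \<tau>] by (auto simp: f_def indicator_def intro: ennreal_leI)
  have "(\<integral>\<^sup>+\<tau>. ennreal (norm (f \<tau>)) \<partial>lebesgue) \<le> (\<integral>\<^sup>+\<tau>. ennreal (v \<tau>) * indicator {0..1} \<tau> \<partial>lebesgue)"
    by (intro nn_integral_mono fle)
  then have bound: "(\<integral>\<^sup>+\<tau>. ennreal (norm (f \<tau>)) \<partial>lebesgue) \<le> ?I"
    by (simp add: nn_integral_completion)
  then have "integrable lebesgue f"
    using False mf by (intro integrableI_bounded) (auto simp: less_top[symmetric] top_unique)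
  moreover from this have "integral\<^sup>L lebesgue f = u 1 - u 0"
    using has_integral_unique[OF has_integral_integral_lebesgue f] by blast
  ultimately show ?thesis
    using integral_norm_bound_ennreal[of lebesgue f] bound by simp
qed simp

text \<open>\<open>G\<close> maps each admissible curve to one that is at most as long, so every
  curve from \<open>p\<close> to \<open>q\<close> has at least the length of the increment of
  \<open>G\<close>. Points joined by no curve in \<open>D\<close> have infinite distance.\<close>

lemma riem_dist_ge:
  fixes F :: "real^'m \<Rightarrow> real \<times> 'v::euclidean_space" and G :: "real^'m \<Rightarrow> 'b::euclidean_space"
  assumes G: "\<And>\<xi>. \<xi> \<in> D \<Longrightarrow> (G has_derivative G' \<xi>) (at \<xi>)"
    and le: "\<And>\<xi> v. \<xi> \<in> D \<Longrightarrow> norm (G' \<xi> v) \<le> sqrt (v \<bullet> (first_form F \<xi> *v v))"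
  shows "ennreal (norm (G q - G p)) \<le> riem_dist D F p q"
  unfolding riem_dist_def
proof (rule INF_greatest)
  fix \<gamma> assume "\<gamma> \<in> {\<gamma>. valid_path \<gamma> \<and> path_image \<gamma> \<subseteq> D \<and> pathstart \<gamma> = p \<and> pathfinish \<gamma> = q}"
  then have g: "valid_path \<gamma>" "path_image \<gamma> \<subseteq> D" "\<gamma> 0 = p" "\<gamma> 1 = q"
    by (auto simp: pathstart_def pathfinish_def)
  obtain S where S: "finite S" "\<And>\<tau>. \<tau> \<in> {0..1} - S \<Longrightarrow> \<gamma> differentiable (at \<tau>)"
    and cont: "continuous_on {0..1} \<gamma>"
    using g(1) unfolding valid_path_def piecewise_C1_differentiable_on_def C1_differentiable_on_eq by blast
  have inD: "\<gamma> \<tau> \<in> D" if "\<tau> \<in> {0..1}" for \<tau> using g(2) that by (auto simp: path_image_def)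
  have contG: "continuous_on D G"
    using G by (intro continuous_at_imp_continuous_on ballI has_derivative_continuous) blast
  have "ennreal (norm ((G \<circ> \<gamma>) 1 - (G \<circ> \<gamma>) 0)) \<le> (\<integral>\<^sup>+ \<tau>\<in>{0..1}. ennreal (sqrt (vector_derivative \<gamma> (at \<tau>) \<bullet>
          (first_form F (\<gamma> \<tau>) *v vector_derivative \<gamma> (at \<tau>)))) \<partial>lborel)"
  proof (rule norm_increment_le_nn_integral[OF S(1), where u'="\<lambda>\<tau>. G' (\<gamma> \<tau>) (vector_derivative \<gamma> (at \<tau>))"])
    show "continuous_on {0..1} (G \<circ> \<gamma>)"
      by (rule continuous_on_compose[OF cont continuous_on_subset[OF contG]]) (use inD in auto)
    fix \<tau> assume t: "\<tau> \<in> {0..1} - S"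
    have d: "(\<gamma> has_vector_derivative vector_derivative \<gamma> (at \<tau>)) (at \<tau>)"
      by (rule vector_derivative_works[THEN iffD1, OF S(2)[OF t]])
    have "(G has_derivative G' (\<gamma> \<tau>)) (at (\<gamma> \<tau>) within range \<gamma>)"
      by (rule has_derivative_at_withinI[OF G[OF inD]]) (use t in simp)
    from vector_derivative_diff_chain_within[OF d this]
    show "(G \<circ> \<gamma> has_vector_derivative G' (\<gamma> \<tau>) (vector_derivative \<gamma> (at \<tau>))) (at \<tau>)" .
    show "norm (G' (\<gamma> \<tau>) (vector_derivative \<gamma> (at \<tau>))) \<le> sqrt (vector_derivative \<gamma> (at \<tau>) \<bullet>
          (first_form F (\<gamma> \<tau>) *v vector_derivative \<gamma> (at \<tau>)))"
      by (rule le[OF inD]) (use t in simp)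
  qed
  then show "ennreal (norm (G q - G p)) \<le> curve_length F \<gamma>"
    by (simp add: curve_length_def g)
qed

lemma riem_dist_le_segment:
  assumes seg: "closed_segment p q \<subseteq> D"
    and le: "\<And>\<xi>. \<xi> \<in> closed_segment p q \<Longrightarrow> sqrt ((q - p) \<bullet> (first_form F \<xi> *v (q - p))) \<le> K"
  shows "riem_dist D F p q \<le> ennreal K"
proof -
  have "riem_dist D F p q \<le> curve_length F (linepath p q)"
    unfolding riem_dist_def using seg by (intro INF_lower) auto
  also have "\<dots> \<le> (\<integral>\<^sup>+ \<tau>\<in>{0..1}. ennreal K \<partial>(lborel :: real measure))"
    unfolding curve_length_def
  proof (rule nn_integral_mono)
    fix \<tau> :: real
    have "linepath p q \<tau> \<in> closed_segment p q" if "\<tau> \<in> {0..1}"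
      using that linepath_in_path by blast
    then show "ennreal (sqrt (vector_derivative (linepath p q) (at \<tau>) \<bullet>
        (first_form F (linepath p q \<tau>) *v vector_derivative (linepath p q) (at \<tau>)))) * indicator {0..1} \<tau>
        \<le> ennreal K * indicator {0..1} \<tau>"
      using le by (auto simp: indicator_def intro!: ennreal_leI)
  qed
  also have "\<dots> = ennreal K" by (simp add: nn_integral_cmult)
  finally show ?thesis .
qed

text \<open>The first form is the Lorentz form evaluated on \<open>F' v\<close>, which is tangent to
  hyperbolic space, so the bounds of \<open>tangent_lorentz\<close> apply pointwise. The two
  functions together determine \<open>F\<close>.\<close>

lemma hyperbolic_coordinates_riem_dist:
  fixes F :: "real^'m \<Rightarrow> real \<times> 'v::euclidean_space"
  assumes D: "open D" and F: "\<And>p. p \<in> D \<Longrightarrow> F differentiable (at p)"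
    "\<And>p. p \<in> D \<Longrightarrow> F p \<in> hyperbolic_space"
  shows "ennreal (norm (ln (fst (F q)) - ln (fst (F p)))) \<le> riem_dist D F p q"
    and "ennreal (norm ((1 / fst (F q)) *\<^sub>R snd (F q) - (1 / fst (F p)) *\<^sub>R snd (F p))) \<le> riem_dist D F p q"
proof -
  define F' where "F' p = frechet_derivative F (at p)" for p
  have F': "(F has_derivative F' p) (at p)" if "p \<in> D" for p
    using F(1)[OF that] unfolding F'_def frechet_derivative_works .
  have pos: "fst (F p) > 0" if "p \<in> D" for p
    using hyperbolic_space_norm(2)[OF F(2)[OF that]] by simp
  have tan: "lorentz (F' p v) (F p) = 0" if "p \<in> D" for p v
    unfolding derivative_eq_sum_partial[OF F'[OF that]]
    using lorentz_partial_position[OF D that F(1)[OF that] F(2)]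
    by (simp add: lorentz.sum_left lorentz.scaleR_left)
  have d1: "((\<lambda>p. fst (F p)) has_derivative (\<lambda>v. fst (F' p v))) (at p)"
    and d2: "((\<lambda>p. snd (F p)) has_derivative (\<lambda>v. snd (F' p v))) (at p)" if "p \<in> D" for p
    using F'[OF that] by (auto intro: has_derivative_fst has_derivative_snd)
  show "ennreal (norm (ln (fst (F q)) - ln (fst (F p)))) \<le> riem_dist D F p q"
  proof (rule riem_dist_ge[where G'="\<lambda>p v. fst (F' p v) / fst (F p)"])
    fix p v assume p: "p \<in> D"
    show "((\<lambda>p. ln (fst (F p))) has_derivative (\<lambda>v. fst (F' p v) / fst (F p))) (at p)"
      using has_derivative_ln[OF pos[OF p] d1[OF p]] by (simp add: divide_inverse)
    show "norm (fst (F' p v) / fst (F p)) \<le> sqrt (v \<bullet> (first_form F p *v v))"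
      unfolding first_form_quadratic[OF F'[OF p]] real_norm_def
      by (rule tangent_lorentz(3)[OF F(2)[OF p] tan[OF p]])
  qed
  show "ennreal (norm ((1 / fst (F q)) *\<^sub>R snd (F q) - (1 / fst (F p)) *\<^sub>R snd (F p))) \<le> riem_dist D F p q"
  proof (rule riem_dist_ge[where G'="\<lambda>p v. (1 / fst (F p)) *\<^sub>R snd (F' p v) - (fst (F' p v) / (fst (F p))\<^sup>2) *\<^sub>R snd (F p)"])
    fix p v assume p: "p \<in> D"
    have "((\<lambda>p. 1 / fst (F p)) has_derivative (\<lambda>v. - (fst (F' p v) / (fst (F p))\<^sup>2))) (at p)"
      using has_derivative_divide[OF has_derivative_const d1[OF p], of 1] pos[OF p]
      by (simp add: divide_inverse power2_eq_square mult_ac)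
    from has_derivative_scaleR[OF this d2[OF p]]
    show "((\<lambda>p. (1 / fst (F p)) *\<^sub>R snd (F p)) has_derivative
        (\<lambda>v. (1 / fst (F p)) *\<^sub>R snd (F' p v) - (fst (F' p v) / (fst (F p))\<^sup>2) *\<^sub>R snd (F p))) (at p)"
      by (simp add: algebra_simps)
    show "norm ((1 / fst (F p)) *\<^sub>R snd (F' p v) - (fst (F' p v) / (fst (F p))\<^sup>2) *\<^sub>R snd (F p))
        \<le> sqrt (v \<bullet> (first_form F p *v v))"
      unfolding first_form_quadratic[OF F'[OF p]]
      by (rule tangent_lorentz(4)[OF F(2)[OF p] tan[OF p]])
  qed
qed

lemma convergent_of_riem_dist_Cauchy:
  fixes G :: "real^'m \<Rightarrow> 'b::euclidean_space"
  assumes le: "\<And>p q. ennreal (norm (G q - G p)) \<le> riem_dist D F p q"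
    and cauchy: "\<forall>e>0. \<exists>N::nat. \<forall>i\<ge>N. \<forall>j\<ge>N. riem_dist D F (\<sigma> i) (\<sigma> j) < ennreal e"
  obtains l where "(\<lambda>i. G (\<sigma> i)) \<longlonglongrightarrow> l"
proof -
  have "Cauchy (\<lambda>i. G (\<sigma> i))"
  proof (rule CauchyI)
    fix e :: real assume e: "0 < e"
    then obtain N where N: "\<forall>i\<ge>N. \<forall>j\<ge>N. riem_dist D F (\<sigma> i) (\<sigma> j) < ennreal e" using cauchy by blast
    have "norm (G (\<sigma> i) - G (\<sigma> j)) < e" if "i \<ge> N" "j \<ge> N" for i j
    proof -
      have "ennreal (norm (G (\<sigma> i) - G (\<sigma> j))) < ennreal e"
        using le[of "\<sigma> i" "\<sigma> j"] N that by (meson order_le_less_trans)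
      then show ?thesis using e by (simp add: ennreal_less_iff)
    qed
    then show "\<exists>M. \<forall>m\<ge>M. \<forall>n\<ge>M. norm (G (\<sigma> m) - G (\<sigma> n)) < e" by blast
  qed
  then show ?thesis using that Cauchy_convergent convergent_def by blast
qed

section \<open>Distance estimates and completeness of the catenoid\<close>

context catenoid
begin

lemma riem_dist_ge_par_s: "ennreal (norm (par_s q - par_s p)) \<le> riem_dist D F p q"
proof (rule riem_dist_ge[where G'="\<lambda>_ v. par_s v"])
  fix \<xi> v assume p: "\<xi> \<in> D"
  show "(par_s has_derivative par_s) (at \<xi>)"
    by (rule bounded_linear_imp_has_derivative[OF bounded_linear_par_s])
  have "g \<xi> None * (v $ None)\<^sup>2 \<le> (\<Sum>i\<in>UNIV. g \<xi> i * (v $ i)\<^sup>2)"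
    using less_imp_le[OF g_pos[OF p]] by (intro member_le_sum) auto
  then show "norm (par_s v) \<le> sqrt (v \<bullet> (first_form F \<xi> *v v))"
    unfolding quadratic_form_F[OF p] by (intro real_le_rsqrt) (simp add: par_s_def)
qed

lemma par_t_line [simp]: "par_t (p + h *\<^sub>R axis None 1) = par_t p"
  and par_s_line [simp]: "par_s (p + h *\<^sub>R axis None 1) = par_s p + h"
  by simp_all

lemma riem_dist_line:
  assumes p: "p \<in> D"
  shows "riem_dist D F p (p + h *\<^sub>R axis None 1) \<le> ennreal \<bar>h\<bar>"
proof (rule riem_dist_le_segment)
  have seg: "\<exists>k. \<xi> = p + k *\<^sub>R axis None 1" if "\<xi> \<in> closed_segment p (p + h *\<^sub>R axis None 1)" for \<xi>
    using that by (auto simp: closed_segment_def algebra_simps)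
  show sub: "closed_segment p (p + h *\<^sub>R axis None 1) \<subseteq> D"
  proof
    fix \<xi> assume "\<xi> \<in> closed_segment p (p + h *\<^sub>R axis None 1)"
    then obtain k where "\<xi> = p + k *\<^sub>R axis None 1" using seg by blast
    then show "\<xi> \<in> D" using p by (simp add: par_t_in)
  qed
  fix \<xi> assume "\<xi> \<in> closed_segment p (p + h *\<^sub>R axis None 1)"
  then have \<xi>: "\<xi> \<in> D" using sub by blast
  show "sqrt ((p + h *\<^sub>R axis None 1 - p) \<bullet> (first_form F \<xi> *v (p + h *\<^sub>R axis None 1 - p))) \<le> \<bar>h\<bar>"
    unfolding add_diff_cancel_left' quadratic_form_F[OF \<xi>] sum_option by (simp add: axis_def)
qed

text \<open>The trace \<open>T\<close> of the first form bounds its quadratic form and is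
  continuous, hence at most \<open>T p0 + 1\<close> near \<open>p0\<close>. Balls are convex, so
  segments stay where this bound holds.\<close>

lemma riem_dist_locally_le:
  assumes p0: "p0 \<in> D"
  obtains \<epsilon> C where "\<epsilon> > 0" "ball p0 \<epsilon> \<subseteq> D" "C \<ge> 0"
    "\<And>p q. p \<in> ball p0 \<epsilon> \<Longrightarrow> q \<in> ball p0 \<epsilon> \<Longrightarrow> riem_dist D F p q \<le> ennreal (C * norm (q - p))"
proof -
  define T where "T p = (\<Sum>i\<in>UNIV. lorentz (partial i F p) (partial i F p))" for p
  have T: "T p = (\<Sum>i\<in>UNIV. g p i)" if "p \<in> D" for p
  proof -
    have "lorentz (partial i F p) (partial i F p) = first_form F p $ i $ i" for i by (simp add: first_form_def)
    then show ?thesis by (simp add: T_def first_form_F[OF that])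
  qed
  have "continuous_on D T"
    unfolding T_def
    by (intro continuous_on_sum bounded_bilinear.continuous_on[OF bounded_bilinear_lorentz]
        smooth_on_continuous_on smooth_on_partial smooth_F)
  then have "isCont T p0" using p0 open_D continuous_on_eq_continuous_at by blast
  then have "(T \<longlongrightarrow> T p0) (at p0)" by (simp add: isCont_def)
  then have "\<forall>\<^sub>F p in at p0. T p < T p0 + 1" by (rule order_tendstoD) simp
  then obtain d1 where d1: "d1 > 0" "\<And>p. dist p p0 < d1 \<Longrightarrow> T p \<le> T p0 + 1"
    unfolding eventually_at by (metis UNIV_I add_increasing2 dual_order.refl less_imp_le zero_le_one)
  obtain d2 where d2: "d2 > 0" "ball p0 d2 \<subseteq> D" using open_D p0 open_contains_ball by blast
  define \<epsilon> where "\<epsilon> = min d1 d2"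
  have \<epsilon>: "\<epsilon> > 0" "ball p0 \<epsilon> \<subseteq> D" using d1 d2 by (auto simp: \<epsilon>_def)
  have T0: "T p \<ge> 0" if "p \<in> D" for p unfolding T[OF that] using less_imp_le[OF g_pos[OF that]] by (intro sum_nonneg) auto
  define C where "C = sqrt (T p0 + 1)"
  have C: "C \<ge> 0" using T0[OF p0] by (simp add: C_def)
  have "riem_dist D F p q \<le> ennreal (C * norm (q - p))" if pq: "p \<in> ball p0 \<epsilon>" "q \<in> ball p0 \<epsilon>" for p q
  proof (rule riem_dist_le_segment)
    have seg: "closed_segment p q \<subseteq> ball p0 \<epsilon>"
      using pq by (intro closed_segment_subset) auto
    then show "closed_segment p q \<subseteq> D" using \<epsilon> by blast
    fix \<xi> assume "\<xi> \<in> closed_segment p q"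
    then have x: "\<xi> \<in> D" "dist \<xi> p0 < d1" using seg \<epsilon>(2) by (auto simp: \<epsilon>_def dist_commute)
    let ?v = "q - p"
    have "(\<Sum>i\<in>UNIV. g \<xi> i * (?v $ i)\<^sup>2) \<le> (\<Sum>i\<in>UNIV. g \<xi> i * (norm ?v)\<^sup>2)"
    proof (intro sum_mono mult_left_mono)
      fix i
      have "\<bar>?v $ i\<bar>\<^sup>2 \<le> (norm ?v)\<^sup>2" by (intro power_mono component_le_norm_cart) auto
      then show "(?v $ i)\<^sup>2 \<le> (norm ?v)\<^sup>2" by simp
    qed (use less_imp_le[OF g_pos[OF x(1)]] in auto)
    also have "\<dots> = T \<xi> * (norm ?v)\<^sup>2" by (simp add: T[OF x(1)] sum_distrib_right)
    also have "\<dots> \<le> (T p0 + 1) * (norm ?v)\<^sup>2" using d1(2)[OF x(2)] by (intro mult_right_mono) auto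
    finally have "sqrt (\<Sum>i\<in>UNIV. g \<xi> i * (?v $ i)\<^sup>2) \<le> sqrt ((T p0 + 1) * (norm ?v)\<^sup>2)" by simp
    then show "sqrt (?v \<bullet> (first_form F \<xi> *v ?v)) \<le> C * norm ?v"
      unfolding quadratic_form_F[OF x(1)] C_def by (simp add: real_sqrt_mult)
  qed
  then show ?thesis using that \<epsilon> C by blast
qed

lemma complete_F: "complete_hypersurface D F"
  unfolding complete_hypersurface_def
proof (intro conjI allI impI)
  show "immersed_hypersurface D F" by (rule immersed_F)
  fix \<sigma> :: "nat \<Rightarrow> real^'k option"
  assume \<sigma>: "range \<sigma> \<subseteq> D"
    and cauchy: "\<forall>e>0. \<exists>N. \<forall>i\<ge>N. \<forall>j\<ge>N. riem_dist D F (\<sigma> i) (\<sigma> j) < ennreal e"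
  note conv = convergent_of_riem_dist_Cauchy[OF _ cauchy]
  have inD: "\<sigma> i \<in> D" for i using \<sigma> by blast
  have inU: "par_t (\<sigma> i) \<in> U" for i using inD by (simp add: par_t_in)
  obtain s where s: "(\<lambda>i. par_s (\<sigma> i)) \<longlonglongrightarrow> s"
    by (rule conv[of par_s]) (rule riem_dist_ge_par_s)
  obtain l where l: "(\<lambda>i. ln (fst (F (\<sigma> i)))) \<longlonglongrightarrow> l"
    by (rule conv[of "\<lambda>p. ln (fst (F p))"])
      (rule hyperbolic_coordinates_riem_dist(1)[OF open_D F_differentiable F_hyperbolic])
  obtain Y where Y: "(\<lambda>i. (1 / fst (F (\<sigma> i))) *\<^sub>R snd (F (\<sigma> i))) \<longlonglongrightarrow> Y"
    by (rule conv[of "\<lambda>p. (1 / fst (F p)) *\<^sub>R snd (F p)"])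
      (rule hyperbolic_coordinates_riem_dist(2)[OF open_D F_differentiable F_hyperbolic])
  have pos: "fst (F (\<sigma> i)) > 0" for i
    using hyperbolic_space_norm(2)[OF F_hyperbolic[OF inD[of i]]] by simp
  \<comment> \<open>The logarithm keeps the time component away from infinity, so the images
    converge in the ambient space. As \<open>F\<close> is only an immersion, this need not determine
    a point of the chart; \<open>s\<close> has therefore been found from its own Lipschitz
    bound.\<close>
  have "(\<lambda>i. exp (ln (fst (F (\<sigma> i))))) \<longlonglongrightarrow> exp l" by (intro tendsto_exp l)
  then have "(\<lambda>i. fst (F (\<sigma> i))) \<longlonglongrightarrow> exp l" using pos by simp
  from tendsto_scaleR[OF this Y] have "(\<lambda>i. snd (F (\<sigma> i))) \<longlonglongrightarrow> exp l *\<^sub>R Y"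
    using pos by (simp add: less_imp_neq[THEN not_sym])
  then have "(\<lambda>i. fst (snd (F (\<sigma> i)))) \<longlonglongrightarrow> fst (exp l *\<^sub>R Y)" by (rule tendsto_fst)
  then have xphi: "(\<lambda>i. x (par_s (\<sigma> i)) *\<^sub>R snd (\<phi> (par_t (\<sigma> i)))) \<longlonglongrightarrow> fst (exp l *\<^sub>R Y)"
    by (simp add: F_eq vec4_def)
  have "(\<lambda>i. x (par_s (\<sigma> i))) \<longlonglongrightarrow> x s"
    using DERIV_isCont[OF DERIV_x] s by (rule isCont_tendsto_compose)
  \<comment> \<open>The limit \<open>x s\<close> is nonzero, so the known profile factor can be
    divided out of the orbit part.\<close>
  from tendsto_scaleR[OF tendsto_inverse[OF this] xphi]
  obtain W where W: "(\<lambda>i. snd (\<phi> (par_t (\<sigma> i)))) \<longlonglongrightarrow> W" by simp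
  obtain \<psi> where h: "homeomorphism U UNIV (\<lambda>p. snd (\<phi> p)) \<psi>" by (rule homeomorphism_snd_phi)
  have "isCont \<psi> W" using h by (simp add: homeomorphism_def continuous_on_eq_continuous_at)
  from isCont_tendsto_compose[OF this W]
  have T: "(\<lambda>i. par_t (\<sigma> i)) \<longlonglongrightarrow> \<psi> W" using h inU by (simp add: homeomorphism_def)
  define p where "p = (\<chi> i. case i of None \<Rightarrow> s | Some i \<Rightarrow> \<psi> W $ i)"
  have pt: "par_t p = \<psi> W" by (simp add: p_def par_t_def vec_eq_iff)
  have "\<psi> W \<in> U" using h by (auto simp: homeomorphism_def)
  then have pD: "p \<in> D" by (simp add: par_t_in pt)
  have lim: "\<sigma> \<longlonglongrightarrow> p"
  proof (rule vec_tendstoI)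
    fix i show "(\<lambda>j. \<sigma> j $ i) \<longlonglongrightarrow> p $ i"
    proof (cases i)
      case None
      then show ?thesis using s by (simp add: p_def par_s_def)
    next
      case (Some k)
      then show ?thesis using tendsto_vec_nth[OF T, of k] by (simp add: p_def par_t_def)
    qed
  qed
  obtain \<epsilon> C where \<epsilon>: "\<epsilon> > 0" "ball p \<epsilon> \<subseteq> D" "C \<ge> 0"
    "\<And>p' q. p' \<in> ball p \<epsilon> \<Longrightarrow> q \<in> ball p \<epsilon> \<Longrightarrow> riem_dist D F p' q \<le> ennreal (C * norm (q - p'))"
    using riem_dist_locally_le[OF pD] by blast
  have "\<forall>\<^sub>F i in sequentially. \<sigma> i \<in> ball p \<epsilon>"
    using lim \<epsilon>(1) by (intro topological_tendstoD) auto
  then have ev: "\<forall>\<^sub>F i in sequentially. riem_dist D F (\<sigma> i) p \<le> ennreal (C * norm (p - \<sigma> i))"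
    by eventually_elim (use \<epsilon> in auto)
  have "(\<lambda>i. ennreal (C * norm (p - \<sigma> i))) \<longlonglongrightarrow> ennreal (C * norm (p - p))"
    using lim by (intro tendsto_intros)
  then have up: "(\<lambda>i. ennreal (C * norm (p - \<sigma> i))) \<longlonglongrightarrow> 0" by simp
  have "(\<lambda>i. riem_dist D F (\<sigma> i) p) \<longlonglongrightarrow> 0"
    by (rule tendsto_sandwich[OF _ ev tendsto_const up]) simp
  then show "\<exists>p\<in>D. (\<lambda>i. riem_dist D F (\<sigma> i) p) \<longlonglongrightarrow> 0" using pD by blast
qed

end


section \<open>Stability\<close>

lemma real_C1_Lipschitz_on_interval:
  fixes k :: "real \<Rightarrow> real"
  assumes d: "\<And>s. (k has_real_derivative k' s) (at s)" and c: "continuous_on {a..b} k'"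
  obtains M where "M \<ge> 0" "\<And>u v. u \<in> {a..b} \<Longrightarrow> v \<in> {a..b} \<Longrightarrow> \<bar>k u - k v\<bar> \<le> M * \<bar>u - v\<bar>"
proof -
  have "bounded (k' ` {a..b})" by (intro compact_imp_bounded compact_continuous_image c) auto
  then obtain M where "M > 0" and M: "\<And>s. s \<in> {a..b} \<Longrightarrow> \<bar>k' s\<bar> \<le> M"
    unfolding bounded_pos by auto
  have "norm (k u - k v) \<le> M * norm (u - v)" if "u \<in> {a..b}" "v \<in> {a..b}" for u v
    using that M by (intro field_differentiable_bound[of "{a..b}" k k' M])
      (auto intro: has_field_derivative_at_within d)
  then show ?thesis using that[of M] \<open>M > 0\<close> by simp
qed

text \<open>Provides the Lipschitz bound for \<open>k \<psi>\<^sup>2\<close> along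
  \<open>s\<close>-lines that dominates its difference quotients.\<close>

lemma abs_product_difference_le:
  fixes k0 k1 f0 f1 :: real
  assumes "\<bar>k1 - k0\<bar> \<le> M * h" "\<bar>k0\<bar> \<le> N" "\<bar>f0\<bar> \<le> B" "\<bar>f1\<bar> \<le> B" "\<bar>f1 - f0\<bar> \<le> L * h"
    "0 \<le> h" "0 \<le> M" "0 \<le> L"
  shows "\<bar>k1 * f1\<^sup>2 - k0 * f0\<^sup>2\<bar> \<le> (M * B\<^sup>2 + N * (2 * B * L)) * h"
proof -
  have "k1 * f1\<^sup>2 - k0 * f0\<^sup>2 = (k1 - k0) * f1\<^sup>2 + k0 * ((f1 + f0) * (f1 - f0))"
    by (simp add: algebra_simps power2_eq_square)
  then have "\<bar>k1 * f1\<^sup>2 - k0 * f0\<^sup>2\<bar> \<le> \<bar>k1 - k0\<bar> * \<bar>f1\<bar>\<^sup>2 + \<bar>k0\<bar> * (\<bar>f1 + f0\<bar> * \<bar>f1 - f0\<bar>)"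
    using abs_triangle_ineq[of "(k1 - k0) * f1\<^sup>2" "k0 * ((f1 + f0) * (f1 - f0))"]
    by (simp add: abs_mult)
  also have "\<dots> \<le> (M * h) * B\<^sup>2 + N * ((2 * B) * (L * h))"
    using assms by (intro add_mono mult_mono power_mono) auto
  finally show ?thesis by (simp add: algebra_simps)
qed

section \<open>The stability inequality on the catenoid\<close>

context catenoid
begin

lemma isCont_x: "isCont x s" and isCont_w: "isCont w s" and isCont_w': "isCont w' s"
proof -
  show "isCont x s" by (rule DERIV_isCont[OF DERIV_x])
  show "isCont w s" by (rule DERIV_isCont[OF DERIV_w])
  have "isCont b s" by (rule DERIV_isCont[OF DERIV_b])
  then show "isCont w' s"
    unfolding w'_def[abs_def] using \<open>isCont x s\<close> by (intro continuous_intros) auto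
qed

text \<open>The flux density \<open>k \<psi>\<^sup>2\<close> of the vector field \<open>w \<partial>/\<partial>s\<close>.\<close>

definition k :: "real \<Rightarrow> real" where "k s = x s ^ (n - 1) * w s"
definition k' :: "real \<Rightarrow> real" where "k' s = x s ^ (n - 1) * ((w s)\<^sup>2 + w' s)"

text \<open>The logarithmic derivative of \<open>x ^ (n - 1)\<close> is \<open>w\<close> itself.
  This produces the term \<open>w\<^sup>2\<close> that completes the square in
  \<open>stability_integrand_ge\<close>.\<close>

lemma DERIV_k: "(k has_real_derivative k' s) (at s)"
proof -
  define m where "m = n - 2"
  have m: "n - 1 = Suc m" "real n - 1 = 1 + real m" using n by (simp_all add: m_def)
  have "((\<lambda>s. x s ^ Suc m * w s) has_real_derivative
      (1 + real m) * (x' s * x s ^ m) * w s + w' s * x s ^ Suc m) (at s)"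
    by (intro DERIV_mult DERIV_power_Suc[OF DERIV_x, unfolded of_nat_Suc] DERIV_w)
  also have "(1 + real m) * (x' s * x s ^ m) * w s + w' s * x s ^ Suc m = x s ^ Suc m * ((w s)\<^sup>2 + w' s)"
    unfolding w_def m(2) by (simp add: field_simps power2_eq_square)
  finally show ?thesis unfolding k_def[abs_def] k'_def m(1) .
qed

lemma isCont_k': "isCont k' s"
  unfolding k'_def[abs_def] by (intro continuous_intros isCont_x isCont_w isCont_w')

lemma rho_nonneg: "q \<in> U \<Longrightarrow> \<rho> q \<ge> 0"
  unfolding \<rho>_def using e_pos by (intro real_sqrt_ge_zero prod_nonneg) (auto intro: less_imp_le)

lemma continuous_on_rho: "continuous_on U \<rho>"
  unfolding \<rho>_def[abs_def] e_def
  by (intro continuous_on_real_sqrt continuous_on_prod bounded_bilinear.continuous_on[OF bounded_bilinear_lorentz]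
      smooth_on_continuous_on smooth_on_partial smooth_phi)

lemma line_in_D [simp]: "p + h *\<^sub>R axis None 1 \<in> D \<longleftrightarrow> p \<in> D"
  by (simp add: par_t_in)

text \<open>The Lipschitz condition is measured by the Riemannian distance, so upper bounds for that
  distance, along \<open>s\<close>-lines and locally, turn it into Euclidean estimates. Continuity
  is recorded for measurability.\<close>

lemma Lipschitz_line:
  assumes "compactly_supported_lipschitz D F \<psi>"
  obtains L where "L \<ge> 0" "\<And>p h. p \<in> D \<Longrightarrow> \<bar>\<psi> (p + h *\<^sub>R axis None 1) - \<psi> p\<bar> \<le> L * \<bar>h\<bar>"
    "continuous_on D \<psi>"
proof -
  obtain L where L: "L \<ge> 0" "\<And>p q. p \<in> D \<Longrightarrow> q \<in> D \<Longrightarrow> ennreal \<bar>\<psi> p - \<psi> q\<bar> \<le> ennreal L * riem_dist D F p q"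
    using assms unfolding compactly_supported_lipschitz_def by blast
  have le: "\<bar>\<psi> p - \<psi> q\<bar> \<le> L * c" if "p \<in> D" "q \<in> D" "riem_dist D F p q \<le> ennreal c" "c \<ge> 0" for p q c
  proof -
    have "ennreal \<bar>\<psi> p - \<psi> q\<bar> \<le> ennreal L * ennreal c"
      using L(2)[OF that(1,2)] mult_left_mono[OF that(3), of "ennreal L"] by (meson order_trans zero_le)
    then have "ennreal \<bar>\<psi> p - \<psi> q\<bar> \<le> ennreal (L * c)" using L(1) that(4) by (simp add: ennreal_mult)
    then show ?thesis using L(1) that(4) by (subst (asm) ennreal_le_iff) auto
  qed
  have line: "\<bar>\<psi> (p + h *\<^sub>R axis None 1) - \<psi> p\<bar> \<le> L * \<bar>h\<bar>" if "p \<in> D" for p h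
    using le[OF that _ riem_dist_line[OF that]] that by (simp add: abs_minus_commute)
  have "isCont \<psi> p0" if p0: "p0 \<in> D" for p0
  proof -
    obtain \<epsilon> C where \<epsilon>: "\<epsilon> > 0" "ball p0 \<epsilon> \<subseteq> D" "C \<ge> 0"
      "\<And>p q. p \<in> ball p0 \<epsilon> \<Longrightarrow> q \<in> ball p0 \<epsilon> \<Longrightarrow> riem_dist D F p q \<le> ennreal (C * norm (q - p))"
      using riem_dist_locally_le[OF p0] by blast
    have "(L * C)-lipschitz_on (ball p0 \<epsilon>) \<psi>"
    proof (rule lipschitz_onI)
      show "dist (\<psi> p) (\<psi> q) \<le> L * C * dist p q" if "p \<in> ball p0 \<epsilon>" "q \<in> ball p0 \<epsilon>" for p q
      proof -
        have "p \<in> D" "q \<in> D" using that \<epsilon>(2) by blast+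
        then show ?thesis
          using le[OF _ _ \<epsilon>(4)[OF that]] \<epsilon>(3) by (simp add: dist_real_def dist_norm norm_minus_commute mult.assoc)
      qed
    qed (use L(1) \<epsilon>(3) in auto)
    then have "continuous_on (ball p0 \<epsilon>) \<psi>" by (rule lipschitz_on_continuous_on)
    then show ?thesis using \<epsilon>(1) by (simp add: continuous_on_eq_continuous_at)
  qed
  then have "continuous_on D \<psi>" by (intro continuous_at_imp_continuous_on) blast
  then show ?thesis using that L(1) line by blast
qed

text \<open>Completing the square: with \<open>w' \<ge> \<bar>A\<bar>\<^sup>2\<close>, the stability integrand differs from a
  nonnegative function by minus the derivative of \<open>\<rho> k \<psi>\<^sup>2\<close> along the \<open>s\<close>-lines.\<close>

lemma stability_integrand_ge:
  assumes p: "p \<in> D"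
  defines "s \<equiv> par_s p"
  shows "- (\<rho> (par_t p) * (k' s * (\<psi> p)\<^sup>2 + 2 * k s * \<psi> p * partial None \<psi> p)) \<le>
    (norm_grad_sq F \<psi> p - (norm_A_sq F p - real CARD('k option)) * (\<psi> p)\<^sup>2) * volume_density F p"
proof -
  define P where "P = x s ^ (n - 1) * \<rho> (par_t p)"
  have P: "P \<ge> 0" using rho_nonneg p by (simp add: P_def par_t_in less_imp_le)
  have "norm_A_sq F p - real CARD('k option) \<le> w' s"
    using w'_ge[of s] by (simp add: norm_A_sq_F[OF p] s_def)
  then have "(norm_A_sq F p - real CARD('k option)) * (\<psi> p)\<^sup>2 \<le> w' s * (\<psi> p)\<^sup>2"
    by (intro mult_right_mono) auto
  then have "(partial None \<psi> p)\<^sup>2 - w' s * (\<psi> p)\<^sup>2 \<le>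
      norm_grad_sq F \<psi> p - (norm_A_sq F p - real CARD('k option)) * (\<psi> p)\<^sup>2"
    using norm_grad_sq_F[OF p, of \<psi>] by linarith
  then have 1: "((partial None \<psi> p)\<^sup>2 - w' s * (\<psi> p)\<^sup>2) * P \<le>
      (norm_grad_sq F \<psi> p - (norm_A_sq F p - real CARD('k option)) * (\<psi> p)\<^sup>2) * volume_density F p"
    unfolding volume_density_F[OF p] P_def[unfolded s_def, symmetric] using P by (rule mult_right_mono)
  have "((partial None \<psi> p)\<^sup>2 - w' s * (\<psi> p)\<^sup>2) * P +
      \<rho> (par_t p) * (k' s * (\<psi> p)\<^sup>2 + 2 * k s * \<psi> p * partial None \<psi> p) =
      P * (partial None \<psi> p + w s * \<psi> p)\<^sup>2"
    unfolding P_def k_def k'_def by (simp add: power2_eq_square algebra_simps)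
  moreover have "P * (partial None \<psi> p + w s * \<psi> p)\<^sup>2 \<ge> 0" using P by simp
  ultimately show ?thesis using 1 by linarith
qed

lemma stability_inequality:
  assumes csl: "compactly_supported_lipschitz D F \<psi>"
  shows "(LINT p:D|lebesgue. (norm_grad_sq F \<psi> p - (norm_A_sq F p - real CARD('k option)) * (\<psi> p)\<^sup>2)
                              * volume_density F p) \<ge> 0"
proof -
  let ?G = "\<lambda>p. (norm_grad_sq F \<psi> p - (norm_A_sq F p - real CARD('k option)) * (\<psi> p)\<^sup>2) * volume_density F p"
  let ?a = "axis None 1 :: real^'k option"
  obtain L where L: "L \<ge> 0" "\<And>p h. p \<in> D \<Longrightarrow> \<bar>\<psi> (p + h *\<^sub>R ?a) - \<psi> p\<bar> \<le> L * \<bar>h\<bar>"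
    and cont: "continuous_on D \<psi>"
    using Lipschitz_line[OF csl] by blast
  obtain K where K: "compact K" "K \<subseteq> D" "\<And>p. p \<in> D - K \<Longrightarrow> \<psi> p = 0"
    using csl unfolding compactly_supported_lipschitz_def by blast
  \<comment> \<open>Values of \<open>\<psi>\<close> outside \<open>D\<close> are arbitrary and are
    replaced by 0. \<open>D\<close> is a union of complete \<open>s\<close>-lines, so the cut-off
    keeps the Lipschitz bound along every line.\<close>
  define f where "f p = indicator D p *\<^sub>R \<psi> p" for p
  have Db: "D \<in> sets borel" using open_D by simp
  have fm: "f \<in> borel_measurable borel"
    unfolding f_def[abs_def] by (rule borel_measurable_continuous_on_indicator[OF Db cont])
  have "AE p in lborel. (\<lambda>h. f (p + h *\<^sub>R ?a)) differentiable (at 0)"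
  proof (rule AE_line_differentiable[OF fm, where L=L])
    show "\<bar>f (p + h *\<^sub>R ?a) - f p\<bar> \<le> L * \<bar>h\<bar>" for p h
      using L by (cases "p \<in> D") (auto simp: f_def simp del: par_t_axis)
  qed
  moreover have "(\<lambda>h. f (p + h *\<^sub>R ?a)) = (\<lambda>h. \<psi> (p + h *\<^sub>R ?a))" if "p \<in> D" for p
    using that by (simp add: f_def)
  ultimately have diff: "AE p in lborel. p \<in> D \<longrightarrow> (\<lambda>h. \<psi> (p + h *\<^sub>R ?a)) differentiable (at 0)"
    by (elim AE_mp) (intro AE_I2, metis)
  define H where "H p = indicator D p *\<^sub>R (\<rho> (par_t p) * (k (par_s p) * (\<psi> p)\<^sup>2))" for p
  have HD: "H p = (if p \<in> D then \<rho> (par_t p) * (k (par_s p) * (\<psi> p)\<^sup>2) else 0)" for p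
    by (simp add: H_def)
  have contk: "continuous_on A (\<lambda>p. k (par_s p))" for A :: "(real^'k option) set"
    by (rule continuous_on_compose2[where t=UNIV and g=k])
      (auto intro: linear_continuous_on bounded_linear_par_s DERIV_isCont[OF DERIV_k] continuous_at_imp_continuous_on)
  have contr: "continuous_on D (\<lambda>p. \<rho> (par_t p))"
    by (rule continuous_on_compose2[OF continuous_on_rho])
      (auto intro: linear_continuous_on bounded_linear_par_t simp: par_t_in)
  have Hm: "H \<in> borel_measurable borel"
    unfolding H_def[abs_def]
    by (rule borel_measurable_continuous_on_indicator[OF Db]) (intro continuous_intros contr contk cont)
  \<comment> \<open>The support is enlarged by all translates along \<open>s\<close> of length at
    most 1. If one of two points at such a distance along a line lies in \<open>K\<close>, both lie
    in the compact set \<open>K1\<close>, where all coefficients are bounded.\<close>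
  define K1 where "K1 = (\<lambda>(p, h). p + h *\<^sub>R ?a) ` (K \<times> {-1..1})"
  have K1: "compact K1"
    unfolding K1_def
    by (intro compact_continuous_image compact_Times K(1) compact_Icc)
      (auto simp: case_prod_beta intro!: continuous_intros)
  have K1D: "K1 \<subseteq> D" using K(2) by (auto simp: K1_def)
  have K1I: "p + h *\<^sub>R ?a \<in> K1" if "p \<in> K" "\<bar>h\<bar> \<le> 1" for p h
    using that unfolding K1_def by (intro image_eqI[where x="(p, h)"]) auto
  have KK1: "p \<in> K1" if "p \<in> K" for p using K1I[OF that, of 0] by simp
  have bdd: "\<exists>B\<ge>0. \<forall>p\<in>K1. \<bar>h p\<bar> \<le> B" if "continuous_on K1 h" for h :: "real^'k option \<Rightarrow> real"
  proof -
    have "bounded (h ` K1)" by (intro compact_imp_bounded compact_continuous_image that K1)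
    then show ?thesis unfolding bounded_pos by (auto intro: less_imp_le)
  qed
  obtain B where B: "B \<ge> 0" "\<And>p. p \<in> K1 \<Longrightarrow> \<bar>\<psi> p\<bar> \<le> B"
    using bdd[OF continuous_on_subset[OF cont K1D]] by blast
  obtain R where R: "R \<ge> 0" "\<And>p. p \<in> K1 \<Longrightarrow> \<bar>\<rho> (par_t p)\<bar> \<le> R"
    using bdd[OF continuous_on_subset[OF contr K1D]] by blast
  obtain N where N: "N \<ge> 0" "\<And>p. p \<in> K1 \<Longrightarrow> \<bar>k (par_s p)\<bar> \<le> N"
    using bdd[OF contk] by blast
  obtain S where S: "S \<ge> 0" "\<And>p. p \<in> K1 \<Longrightarrow> \<bar>par_s p\<bar> \<le> S"
    using bdd[OF linear_continuous_on[OF bounded_linear_par_s]] by blast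
  obtain M where M: "M \<ge> 0" "\<And>u v. u \<in> {-S..S} \<Longrightarrow> v \<in> {-S..S} \<Longrightarrow> \<bar>k u - k v\<bar> \<le> M * \<bar>u - v\<bar>"
    by (rule real_C1_Lipschitz_on_interval[OF DERIV_k, of "-S" S])
      (auto intro: continuous_at_imp_continuous_on isCont_k')
  have H0: "H p = 0" if "p \<notin> K" for p using that K(3) by (auto simp: HD)
  have Hb: "\<bar>H p\<bar> \<le> R * (N * B\<^sup>2)" for p
  proof (cases "p \<in> K")
    case True
    then have p: "p \<in> K1" "p \<in> D" using KK1 K(2) by auto
    have "\<bar>\<rho> (par_t p)\<bar> * (\<bar>k (par_s p)\<bar> * \<bar>\<psi> p\<bar>\<^sup>2) \<le> R * (N * B\<^sup>2)"
      using p B R N by (intro mult_mono power_mono) auto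
    then show ?thesis using p(2) by (simp add: HD abs_mult)
  next
    case False
    then show ?thesis using H0 R(1) N(1) by simp
  qed
  define C where "C = R * (M * B\<^sup>2 + N * (2 * B * L))"
  have C0: "C \<ge> 0" using R(1) M(1) N(1) B(1) L(1) by (simp add: C_def)
  have HC: "\<bar>H (p + h *\<^sub>R ?a) - H p\<bar> \<le> C * \<bar>h\<bar>" if h: "\<bar>h\<bar> \<le> 1" for p h
  proof (cases "p \<in> K \<or> p + h *\<^sub>R ?a \<in> K")
    case True
    have both: "p \<in> K1" "p + h *\<^sub>R ?a \<in> K1"
      using True h KK1 K1I[of p h] K1I[of "p + h *\<^sub>R ?a" "- h"] by (auto simp: algebra_simps)
    then have p: "p \<in> D" using K1D by blast
    have "\<bar>par_s p\<bar> \<le> S" "\<bar>par_s p + h\<bar> \<le> S" using S(2)[OF both(1)] S(2)[OF both(2)] by simp_all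
    then have "\<bar>k (par_s p + h) - k (par_s p)\<bar> \<le> M * \<bar>h\<bar>"
      using M(2)[of "par_s p + h" "par_s p"] by (simp add: abs_le_iff)
    then have "\<bar>k (par_s p + h) * (\<psi> (p + h *\<^sub>R ?a))\<^sup>2 - k (par_s p) * (\<psi> p)\<^sup>2\<bar> \<le> (M * B\<^sup>2 + N * (2 * B * L)) * \<bar>h\<bar>"
      using N(2)[OF both(1)] B(2)[OF both(1)] B(2)[OF both(2)] L(2)[OF p, of h] M(1) L(1)
      by (intro abs_product_difference_le) auto
    then have "\<bar>\<rho> (par_t p)\<bar> * \<bar>k (par_s p + h) * (\<psi> (p + h *\<^sub>R ?a))\<^sup>2 - k (par_s p) * (\<psi> p)\<^sup>2\<bar>
        \<le> R * ((M * B\<^sup>2 + N * (2 * B * L)) * \<bar>h\<bar>)"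
      using R(1) R(2)[OF both(1)] by (intro mult_mono) auto
    moreover have "H (p + h *\<^sub>R ?a) - H p =
        \<rho> (par_t p) * (k (par_s p + h) * (\<psi> (p + h *\<^sub>R ?a))\<^sup>2 - k (par_s p) * (\<psi> p)\<^sup>2)"
      unfolding HD line_in_D par_t_line par_s_line using p by (simp add: right_diff_distrib del: par_t_axis)
    ultimately show ?thesis by (simp add: abs_mult C_def mult_ac)
  next
    case False
    then show ?thesis using H0 C0 by simp
  qed
  define Dv where "Dv p = (if p \<in> D then \<rho> (par_t p) *
      (k' (par_s p) * (\<psi> p)\<^sup>2 + 2 * k (par_s p) * \<psi> p * partial None \<psi> p) else 0)" for p
  have dH: "AE p in lborel. ((\<lambda>h. H (p + h *\<^sub>R ?a)) has_real_derivative Dv p) (at 0)"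
    using diff
  proof eventually_elim
    fix p assume d: "p \<in> D \<longrightarrow> (\<lambda>h. \<psi> (p + h *\<^sub>R ?a)) differentiable (at 0)"
    show "((\<lambda>h. H (p + h *\<^sub>R ?a)) has_real_derivative Dv p) (at 0)"
    proof (cases "p \<in> D")
      case True
      then have "(\<lambda>h. \<psi> (p + h *\<^sub>R ?a)) differentiable (at 0)" using d by blast
      then have d\<psi>: "((\<lambda>h. \<psi> (p + h *\<^sub>R ?a)) has_real_derivative partial None \<psi> p) (at 0)"
        unfolding partial_def has_real_derivative_iff_has_vector_derivative
        by (simp add: vector_derivative_works)
      have dk: "((\<lambda>h. k (par_s p + h)) has_real_derivative k' (par_s p)) (at 0)"
        using DERIV_k[of "par_s p"] DERIV_shift[of k "k' (par_s p)" 0 "par_s p"] by (simp add: add.commute)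
      have "((\<lambda>h. \<rho> (par_t p) * (k (par_s p + h) * (\<psi> (p + h *\<^sub>R ?a))\<^sup>2)) has_real_derivative
          \<rho> (par_t p) * (k' (par_s p) * (\<psi> (p + 0 *\<^sub>R ?a))\<^sup>2 +
            of_nat 2 * (partial None \<psi> p * \<psi> (p + 0 *\<^sub>R ?a) ^ (2 - Suc 0)) * k (par_s p + 0))) (at 0)"
        by (intro DERIV_cmult DERIV_mult dk DERIV_power d\<psi>)
      then have "((\<lambda>h. \<rho> (par_t p) * (k (par_s p + h) * (\<psi> (p + h *\<^sub>R ?a))\<^sup>2)) has_real_derivative Dv p) (at 0)"
        using True by (simp add: Dv_def mult_ac)
      moreover have "(\<lambda>h. H (p + h *\<^sub>R ?a)) = (\<lambda>h. \<rho> (par_t p) * (k (par_s p + h) * (\<psi> (p + h *\<^sub>R ?a))\<^sup>2))"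
        unfolding HD line_in_D par_t_line par_s_line using True by simp
      ultimately show ?thesis by simp
    next
      case False
      have "(\<lambda>h. H (p + h *\<^sub>R ?a)) = (\<lambda>h. 0)"
        unfolding HD line_in_D using False by simp
      then show ?thesis using False by (simp add: Dv_def)
    qed
  qed
  obtain D' where D': "integrable lborel D'" "integral\<^sup>L lborel D' = 0" "AE p in lborel. D' p = Dv p"
    by (rule integral_line_derivative_eq_0[OF Hm compact_imp_bounded[OF K(1)] H0 Hb HC dH])
  let ?I = "\<lambda>p. indicator D p *\<^sub>R ?G p"
  show ?thesis
  \<comment> \<open>If the integrand is not integrable, its integral is 0 by convention. Otherwise
    it is compared with \<open>- D'\<close>, whose integral vanishes.\<close>
  proof (cases "integrable lebesgue ?I")
    case True
    have "integral\<^sup>L lebesgue (\<lambda>p. - D' p) \<le> integral\<^sup>L lebesgue ?I"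
    proof (rule integral_mono_AE)
      show "integrable lebesgue (\<lambda>p. - D' p)"
        using D'(1) by (simp add: integrable_completion)
      show "AE p in lebesgue. - D' p \<le> ?I p"
        using AE_completion[OF D'(3)]
      proof eventually_elim
        fix p assume "D' p = Dv p"
        then show "- D' p \<le> ?I p"
          using stability_integrand_ge[of p \<psi>] by (simp add: Dv_def)
      qed
    qed (rule True)
    moreover have "integral\<^sup>L lebesgue (\<lambda>p. - D' p) = 0"
      using D'(1,2) by (simp add: integral_completion)
    ultimately show ?thesis by (simp add: set_lebesgue_integral_def)
  next
    case False
    then show ?thesis by (simp add: set_lebesgue_integral_def not_integrable_integral_eq)
  qed
qed

lemma stable_F: "stable_hypersurface D F"
  unfolding stable_hypersurface_def using minimal_F stability_inequality by blast

end

theorem theorem4p4: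
  fixes n :: nat and t :: real and x :: "real \<Rightarrow> real"
    and U :: "(real^'k) set" and \<phi> :: "real^'k \<Rightarrow> real \<times> (real^'k)"
  assumes "n \<ge> 2" and "n = CARD('k) + 1"
    and "catenoid_profile n t x"
    and "orthogonal_parametrization U \<phi>"
    and "1 < t" and "t < 1 + (real n + 1)\<^sup>2 / (4 * real n * (real n - 1))"
  shows "complete_hypersurface (catenoid_domain U) (catenoid_map x \<phi>) \<and>
         stable_hypersurface (catenoid_domain U) (catenoid_map x \<phi>)"
proof -
  interpret catenoid n t x U \<phi>
    using assms by unfold_locales auto
  show ?thesis using complete_F stable_F by blast
qed

end
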